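(* Let $G$ be a compact group and let $A$ be a locally $C^*$-algebra. Then any action of $C^*\mathbf K_G^a$ on $A$ is an inverse limit action.
   Context: A locally $C^*$-algebra is a complete Hausdorff complex topological $*$-algebra $A$ whose topology is determined by a (directed) family of $C^*$-seminorms. A morphism is a continuous $*$-morphism. $M(A)$ is the multiplier algebra of $A$ and $A\otimes B$ the injective tensor product (the inverse limit of the minimal $C^*$-tensor products of the $C^*$-quotients). $M(A,B)$ is the set of $x\in M(A\otimes B)$ with $x(1\otimes B)+(1\otimes B)x\subseteq A\otimes B$. An $S$-morphism $\Phi:A\to M(B)$ is a morphism such that for every approximate unit $(e_i)$ of $A$, $\Phi(e_i)\to1$ in the strict topology; it extends uniquely to a morphism $\overline\Phi:M(A)\to M(B)$. $M(A,C_0(G))$ is identified with $C_b(G,A)$, the bounded continuous functions $G\to A$. $C^*\mathbf K_G^a$ is the commutative Kac $C^*$-algebra $C_0(G)$ with comultiplication $d_G^a(f)(s,t)=f(st)$, coinvolution $j_G^a(f)(s)=f(s^{-1})$ and weight given by Haar measure. With $\sigma_{C_0(G)}$ the flip on $C_0(G)\otimes C_0(G)$, an action of $C^*\mathbf K_G^a$ on $A$ is an injective $S$-morphism $\alpha:A\to M(A,C_0(G))$ with $(\overline{\alpha\otimes\mathrm{id}_{C_0(G)}})\circ\alpha=(\overline{\mathrm{id}_A\otimes(\sigma_{C_0(G)}\circ d_G^a)})\circ\alpha$. It is an inverse limit action if $A$ can be written as an inverse limit $\varprojlim_\delta A_\delta$ of $C^*$-algebras such that there are actions $\alpha^{(\delta)}$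 of $C^*\mathbf K_G^a$ on $A_\delta$ with $\alpha=\varprojlim_\delta\alpha^{(\delta)}$, i.e. the $\alpha^{(\delta)}$ are compatible with the connecting maps and $\alpha$ is the induced map on the limit. *)

theory Defs
  imports "HOL-Analysis.Analysis"
begin

section \<open>Locally C*-algebras\<close>

text \<open>Algebras need not be unital. They live on carrier sets, so that multiplier algebras, tensor
  products and inverse limits are again objects of the same kind.\<close>

record 'a talg =
  carrier :: "'a set"
  add :: "'a \<Rightarrow> 'a \<Rightarrow> 'a"  (infixl "\<oplus>\<index>" 65)
  zero :: "'a"  ("\<zero>\<index>")
  scale :: "complex \<Rightarrow> 'a \<Rightarrow> 'a"
  mult :: "'a \<Rightarrow> 'a \<Rightarrow> 'a"  (infixl "\<cdot>\<index>" 70)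
  star :: "'a \<Rightarrow> 'a"
  topo :: "'a topology"

definition diff :: "('a, 'm) talg_scheme \<Rightarrow> 'a \<Rightarrow> 'a \<Rightarrow> 'a" where
  "diff A x y = x \<oplus>\<^bsub>A\<^esub> scale A (-1) y"

locale star_algebra =
  fixes A :: "('a, 'm) talg_scheme" (structure)
  assumes add_closed: "\<lbrakk>x \<in> carrier A; y \<in> carrier A\<rbrakk> \<Longrightarrow> x \<oplus> y \<in> carrier A"
    and zero_closed: "\<zero> \<in> carrier A"
    and scale_closed: "x \<in> carrier A \<Longrightarrow> scale A c x \<in> carrier A"
    and mult_closed: "\<lbrakk>x \<in> carrier A; y \<in> carrier A\<rbrakk> \<Longrightarrow> x \<cdot> y \<in> carrier A"
    and star_closed: "x \<in> carrier A \<Longrightarrow> star A x \<in> carrier A"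
    and add_assoc: "\<lbrakk>x \<in> carrier A; y \<in> carrier A; z \<in> carrier A\<rbrakk>
      \<Longrightarrow> (x \<oplus> y) \<oplus> z = x \<oplus> (y \<oplus> z)"
    and add_comm: "\<lbrakk>x \<in> carrier A; y \<in> carrier A\<rbrakk> \<Longrightarrow> x \<oplus> y = y \<oplus> x"
    and add_zero: "x \<in> carrier A \<Longrightarrow> x \<oplus> \<zero> = x"
    and add_neg: "x \<in> carrier A \<Longrightarrow> x \<oplus> scale A (-1) x = \<zero>"
    and scale_one: "x \<in> carrier A \<Longrightarrow> scale A 1 x = x"
    and scale_scale: "x \<in> carrier A \<Longrightarrow> scale A c (scale A d x) = scale A (c * d) x"
    and scale_add_left: "x \<in> carrier A \<Longrightarrow> scale A (c + d) x = scale A c x \<oplus> scale A d x"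
    and scale_add_right: "\<lbrakk>x \<in> carrier A; y \<in> carrier A\<rbrakk>
      \<Longrightarrow> scale A c (x \<oplus> y) = scale A c x \<oplus> scale A c y"
    and mult_assoc: "\<lbrakk>x \<in> carrier A; y \<in> carrier A; z \<in> carrier A\<rbrakk>
      \<Longrightarrow> (x \<cdot> y) \<cdot> z = x \<cdot> (y \<cdot> z)"
    and distrib_left: "\<lbrakk>x \<in> carrier A; y \<in> carrier A; z \<in> carrier A\<rbrakk>
      \<Longrightarrow> x \<cdot> (y \<oplus> z) = x \<cdot> y \<oplus> x \<cdot> z"
    and distrib_right: "\<lbrakk>x \<in> carrier A; y \<in> carrier A; z \<in> carrier A\<rbrakk>
      \<Longrightarrow> (x \<oplus> y) \<cdot> z = x \<cdot> z \<oplus> y \<cdot> z"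
    and scale_mult_left: "\<lbrakk>x \<in> carrier A; y \<in> carrier A\<rbrakk>
      \<Longrightarrow> scale A c x \<cdot> y = scale A c (x \<cdot> y)"
    and scale_mult_right: "\<lbrakk>x \<in> carrier A; y \<in> carrier A\<rbrakk>
      \<Longrightarrow> x \<cdot> scale A c y = scale A c (x \<cdot> y)"
    and star_add: "\<lbrakk>x \<in> carrier A; y \<in> carrier A\<rbrakk> \<Longrightarrow> star A (x \<oplus> y) = star A x \<oplus> star A y"
    and star_scale: "x \<in> carrier A \<Longrightarrow> star A (scale A c x) = scale A (cnj c) (star A x)"
    and star_mult: "\<lbrakk>x \<in> carrier A; y \<in> carrier A\<rbrakk> \<Longrightarrow> star A (x \<cdot> y) = star A y \<cdot> star A x"
    and star_star: "x \<in> carrier A \<Longrightarrow> star A (star A x) = x"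

definition cstar_seminorm :: "('a, 'm) talg_scheme \<Rightarrow> ('a \<Rightarrow> real) \<Rightarrow> bool" where
  "cstar_seminorm A p \<longleftrightarrow>
    (\<forall>x\<in>carrier A. 0 \<le> p x) \<and>
    (\<forall>x\<in>carrier A. \<forall>y\<in>carrier A. p (x \<oplus>\<^bsub>A\<^esub> y) \<le> p x + p y) \<and>
    (\<forall>c. \<forall>x\<in>carrier A. p (scale A c x) = cmod c * p x) \<and>
    (\<forall>x\<in>carrier A. \<forall>y\<in>carrier A. p (x \<cdot>\<^bsub>A\<^esub> y) \<le> p x * p y) \<and>
    (\<forall>x\<in>carrier A. p (star A x \<cdot>\<^bsub>A\<^esub> x) = (p x)\<^sup>2)"

text \<open>The topology on the carrier determined by a family of seminorms. The family is not required to
  be directed, hence the finite intersections of balls.\<close>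

definition seminorm_topology :: "('a, 'm) talg_scheme \<Rightarrow> ('a \<Rightarrow> real) set \<Rightarrow> 'a topology" where
  "seminorm_topology A P = topology (\<lambda>U. U \<subseteq> carrier A \<and>
    (\<forall>x\<in>U. \<exists>F e. finite F \<and> F \<subseteq> P \<and> e > 0 \<and>
      {y \<in> carrier A. \<forall>p\<in>F. p (diff A y x) < e} \<subseteq> U))"

definition complete_talg :: "('a, 'm) talg_scheme \<Rightarrow> bool" where
  "complete_talg A \<longleftrightarrow> (\<forall>F. F \<noteq> bot \<and> eventually (\<lambda>x. x \<in> carrier A) F \<and>
      (\<forall>U. openin (topo A) U \<and> zero A \<in> U \<longrightarrow> eventually (\<lambda>(x, y). diff A x y \<in> U) (F \<times>\<^sub>F F))
    \<longrightarrow> (\<exists>x. limitin (topo A) (\<lambda>y. y) x F))"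

text \<open>Continuity of the algebraic operations follows from the topology being given by
  C*-seminorms.\<close>

definition locally_cstar_algebra :: "('a, 'm) talg_scheme \<Rightarrow> bool" where
  "locally_cstar_algebra A \<longleftrightarrow>
    star_algebra A \<and> Hausdorff_space (topo A) \<and> complete_talg A \<and>
    (\<exists>P. (\<forall>p\<in>P. cstar_seminorm A p) \<and> topo A = seminorm_topology A P)"

definition cstar_algebra :: "('a, 'm) talg_scheme \<Rightarrow> bool" where
  "cstar_algebra A \<longleftrightarrow>
    star_algebra A \<and> Hausdorff_space (topo A) \<and> complete_talg A \<and>
    (\<exists>p. cstar_seminorm A p \<and> topo A = seminorm_topology A {p})"

text \<open>The set \<open>S(A)\<close> of all continuous C*-seminorms. Seminorms are functions on the whole type; only
  their values on the carrier matter.\<close>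

definition cont_seminorms :: "('a, 'm) talg_scheme \<Rightarrow> ('a \<Rightarrow> real) set" where
  "cont_seminorms A = {p. cstar_seminorm A p \<and> continuous_map (topo A) euclideanreal p}"

definition morphism :: "('a, 'm) talg_scheme \<Rightarrow> ('b, 'n) talg_scheme \<Rightarrow> ('a \<Rightarrow> 'b) \<Rightarrow> bool" where
  "morphism A B \<phi> \<longleftrightarrow>
    \<phi> \<in> carrier A \<rightarrow> carrier B \<and>
    (\<forall>x\<in>carrier A. \<forall>y\<in>carrier A. \<phi> (x \<oplus>\<^bsub>A\<^esub> y) = \<phi> x \<oplus>\<^bsub>B\<^esub> \<phi> y) \<and>
    (\<forall>c. \<forall>x\<in>carrier A. \<phi> (scale A c x) = scale B c (\<phi> x)) \<and>
    (\<forall>x\<in>carrier A. \<forall>y\<in>carrier A. \<phi> (x \<cdot>\<^bsub>A\<^esub> y) = \<phi> x \<cdot>\<^bsub>B\<^esub> \<phi> y) \<and>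
    (\<forall>x\<in>carrier A. \<phi> (star A x) = star B (\<phi> x)) \<and>
    continuous_map (topo A) (topo B) \<phi>"

definition talg_iso :: "('a, 'm) talg_scheme \<Rightarrow> ('b, 'n) talg_scheme \<Rightarrow> ('a \<Rightarrow> 'b) \<Rightarrow> bool" where
  "talg_iso A B \<phi> \<longleftrightarrow> morphism A B \<phi> \<and> homeomorphic_map (topo A) (topo B) \<phi>"


section \<open>Multipliers and S-morphisms\<close>

text \<open>A multiplier \<open>m\<close> of \<open>A\<close> is a double centralizer \<open>(l, r)\<close>, where \<open>l a\<close> stands for \<open>m a\<close> and \<open>r a\<close>
  for \<open>a m\<close>. Both maps are extensional, so that equality of multipliers is equality of pairs.
  The boundedness clause is automatic for double centralizers of a locally C*-algebra; it is part of
  the definition so that the suprema in the topology are visibly finite.\<close>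

type_synonym 'a multiplier = "('a \<Rightarrow> 'a) \<times> ('a \<Rightarrow> 'a)"

definition linear_on :: "('a, 'm) talg_scheme \<Rightarrow> ('a \<Rightarrow> 'a) \<Rightarrow> bool" where
  "linear_on A l \<longleftrightarrow>
    (\<forall>x\<in>carrier A. \<forall>y\<in>carrier A. l (x \<oplus>\<^bsub>A\<^esub> y) = l x \<oplus>\<^bsub>A\<^esub> l y) \<and>
    (\<forall>c. \<forall>x\<in>carrier A. l (scale A c x) = scale A c (l x))"

definition multipliers :: "('a, 'm) talg_scheme \<Rightarrow> 'a multiplier set" where
  "multipliers A = {(l, r).
    l \<in> carrier A \<rightarrow>\<^sub>E carrier A \<and> r \<in> carrier A \<rightarrow>\<^sub>E carrier A \<and>
    linear_on A l \<and> linear_on A r \<and>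
    (\<forall>a\<in>carrier A. \<forall>b\<in>carrier A.
      l (a \<cdot>\<^bsub>A\<^esub> b) = l a \<cdot>\<^bsub>A\<^esub> b \<and> r (a \<cdot>\<^bsub>A\<^esub> b) = a \<cdot>\<^bsub>A\<^esub> r b \<and> a \<cdot>\<^bsub>A\<^esub> l b = r a \<cdot>\<^bsub>A\<^esub> b) \<and>
    (\<forall>p\<in>cont_seminorms A. \<exists>C. \<forall>a\<in>carrier A. p (l a) \<le> C * p a \<and> p (r a) \<le> C * p a)}"

definition mult_seminorm :: "('a, 'm) talg_scheme \<Rightarrow> ('a \<Rightarrow> real) \<Rightarrow> 'a multiplier \<Rightarrow> real" where
  "mult_seminorm A p m = (SUP a\<in>{a \<in> carrier A. p a \<le> 1}. p (fst m a))"

text \<open>The underlying algebra of \<open>M(A)\<close>, with a placeholder topology, is needed first, since seminorm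
  topologies refer to differences.\<close>

definition mult_algebra0 :: "('a, 'm) talg_scheme \<Rightarrow> 'a multiplier talg" where
  "mult_algebra0 A = \<lparr>
    carrier = multipliers A,
    add = (\<lambda>m n. (\<lambda>a\<in>carrier A. fst m a \<oplus>\<^bsub>A\<^esub> fst n a, \<lambda>a\<in>carrier A. snd m a \<oplus>\<^bsub>A\<^esub> snd n a)),
    zero = (\<lambda>a\<in>carrier A. zero A, \<lambda>a\<in>carrier A. zero A),
    scale = (\<lambda>c m. (\<lambda>a\<in>carrier A. scale A c (fst m a), \<lambda>a\<in>carrier A. scale A c (snd m a))),
    mult = (\<lambda>m n. (\<lambda>a\<in>carrier A. fst m (fst n a), \<lambda>a\<in>carrier A. snd n (snd m a))),
    star = (\<lambda>m. (\<lambda>a\<in>carrier A. star A (snd m (star A a)), \<lambda>a\<in>carrier A. star A (fst m (star A a)))),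
    topo = discrete_topology (multipliers A)\<rparr>"

definition mult_algebra :: "('a, 'm) talg_scheme \<Rightarrow> 'a multiplier talg" where
  "mult_algebra A = mult_algebra0 A
    \<lparr>topo := seminorm_topology (mult_algebra0 A) (mult_seminorm A ` cont_seminorms A)\<rparr>"

definition mult_one :: "('a, 'm) talg_scheme \<Rightarrow> 'a multiplier" where
  "mult_one A = (\<lambda>a\<in>carrier A. a, \<lambda>a\<in>carrier A. a)"

definition mult_embed :: "('a, 'm) talg_scheme \<Rightarrow> 'a \<Rightarrow> 'a multiplier" where
  "mult_embed A a = (\<lambda>b\<in>carrier A. a \<cdot>\<^bsub>A\<^esub> b, \<lambda>b\<in>carrier A. b \<cdot>\<^bsub>A\<^esub> a)"

definition strict_topology :: "('a, 'm) talg_scheme \<Rightarrow> 'a multiplier topology" where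
  "strict_topology A = seminorm_topology (mult_algebra A)
    {\<lambda>m. p (fst m a) + p (snd m a) | p a. p \<in> cont_seminorms A \<and> a \<in> carrier A}"

definition leq :: "('a, 'm) talg_scheme \<Rightarrow> 'a \<Rightarrow> 'a \<Rightarrow> bool" where
  "leq A x y \<longleftrightarrow> (\<exists>b\<in>carrier A. diff A y x = star A b \<cdot>\<^bsub>A\<^esub> b)"

text \<open>An approximate unit is an increasing net of positive elements, bounded by 1 in every continuous
  C*-seminorm. A net \<open>(e\<^sub>i)\<close> is represented by its range \<open>R\<close> and its eventuality filter \<open>E\<close> on \<open>A\<close>,
  which avoids quantifying over index types. The net being increasing means that \<open>e\<^sub>0 \<le> e\<close> holds
  eventually, for each \<open>e\<^sub>0 \<in> R\<close>: conversely, given such \<open>R\<close> and \<open>E\<close>, the pairs \<open>(X, e)\<close> with \<open>X \<in> E\<close>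
  and \<open>e \<in> X \<inter> R\<close>, ordered by reverse inclusion in \<open>X\<close> and \<open>\<le>\<close> in \<open>e\<close>, index an increasing net with
  eventuality filter \<open>E\<close>.\<close>

definition approximate_unit :: "('a, 'm) talg_scheme \<Rightarrow> 'a filter \<Rightarrow> bool" where
  "approximate_unit A E \<longleftrightarrow> E \<noteq> bot \<and>
    (\<exists>R \<subseteq> carrier A.
      (\<forall>e\<in>R. leq A (zero A) e \<and> (\<forall>p\<in>cont_seminorms A. p e \<le> 1)) \<and>
      eventually (\<lambda>e. e \<in> R) E \<and>
      (\<forall>e\<^sub>0\<in>R. eventually (\<lambda>e. leq A e\<^sub>0 e) E)) \<and>
    (\<forall>a\<in>carrier A. limitin (topo A) (\<lambda>e. e \<cdot>\<^bsub>A\<^esub> a) a E \<and> limitin (topo A) (\<lambda>e. a \<cdot>\<^bsub>A\<^esub> e) a E)"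

definition S_morphism ::
  "('a, 'm) talg_scheme \<Rightarrow> ('b, 'n) talg_scheme \<Rightarrow> ('a \<Rightarrow> 'b multiplier) \<Rightarrow> bool" where
  "S_morphism A B \<Phi> \<longleftrightarrow> morphism A (mult_algebra B) \<Phi> \<and>
    (\<forall>E. approximate_unit A E \<longrightarrow> limitin (strict_topology B) \<Phi> (mult_one B) E)"

definition mult_extension :: "('a, 'm) talg_scheme \<Rightarrow> ('b, 'n) talg_scheme \<Rightarrow>
    ('a \<Rightarrow> 'b multiplier) \<Rightarrow> ('a multiplier \<Rightarrow> 'b multiplier) \<Rightarrow> bool" where
  "mult_extension A B \<Phi> \<Phi>' \<longleftrightarrow> morphism (mult_algebra A) (mult_algebra B) \<Phi>' \<and>
    (\<forall>a\<in>carrier A. \<Phi>' (mult_embed A a) = \<Phi> a)"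


section \<open>The algebra \<open>C\<^sub>0(X)\<close> and injective tensor products with it\<close>

text \<open>\<open>A \<otimes> C\<^sub>0(X)\<close> is identified with \<open>C\<^sub>0(X, A)\<close>, the continuous functions vanishing at infinity with
  the topology of uniform convergence: \<open>a \<otimes> f\<close> is \<open>\<lambda>x. f x a\<close>, and the injective C*-seminorm built from
  \<open>p \<in> S(A)\<close> and the sup norm is \<open>h \<mapsto> sup\<^sub>x p (h x)\<close>. This is the identification that leads from
  \<open>M(A, C\<^sub>0(X)) \<subseteq> M(A \<otimes> C\<^sub>0(X))\<close> to \<open>C\<^sub>b(X, A)\<close>. In the iterated product
  \<open>(A \<otimes> C\<^sub>0(X)) \<otimes> C\<^sub>0(X)\<close>, identified with functions \<open>h\<close> of two variables, the value at the point
  \<open>(s, t)\<close> is \<open>h t s\<close>.\<close>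

definition sup_seminorm :: "('a \<Rightarrow> real) \<Rightarrow> ('x \<Rightarrow> 'a) \<Rightarrow> real" where
  "sup_seminorm p h = (SUP x. p (h x))"

definition C0_carrier :: "('a, 'm) talg_scheme \<Rightarrow> ('x::topological_space \<Rightarrow> 'a) set" where
  "C0_carrier A = {h. continuous_map euclidean (topo A) h \<and> range h \<subseteq> carrier A \<and>
    (\<forall>U. openin (topo A) U \<and> zero A \<in> U \<longrightarrow> (\<exists>K. compact K \<and> (\<forall>x. x \<notin> K \<longrightarrow> h x \<in> U)))}"

definition C0_algebra0 :: "('a, 'm) talg_scheme \<Rightarrow> ('x::topological_space \<Rightarrow> 'a) talg" where
  "C0_algebra0 A = \<lparr>
    carrier = C0_carrier A,
    add = (\<lambda>g h x. g x \<oplus>\<^bsub>A\<^esub> h x),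
    zero = (\<lambda>x. zero A),
    scale = (\<lambda>c h x. scale A c (h x)),
    mult = (\<lambda>g h x. g x \<cdot>\<^bsub>A\<^esub> h x),
    star = (\<lambda>h x. star A (h x)),
    topo = discrete_topology (C0_carrier A)\<rparr>"

definition tensor_C0 :: "('a, 'm) talg_scheme \<Rightarrow> ('x::topological_space \<Rightarrow> 'a) talg" where
  "tensor_C0 A = C0_algebra0 A
    \<lparr>topo := seminorm_topology (C0_algebra0 A) (sup_seminorm ` cont_seminorms A)\<rparr>"

definition complex_talg :: "complex talg" where
  "complex_talg = \<lparr>carrier = UNIV, add = (+), zero = 0, scale = (*), mult = (*), star = cnj,
    topo = euclidean\<rparr>"

abbreviation C0 :: "('x::topological_space \<Rightarrow> complex) talg" where
  "C0 \<equiv> tensor_C0 complex_talg"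

definition elem_tensor :: "('a, 'm) talg_scheme \<Rightarrow> 'a \<Rightarrow> ('x \<Rightarrow> complex) \<Rightarrow> 'x \<Rightarrow> 'a" where
  "elem_tensor A a f = (\<lambda>x. scale A (f x) a)"

text \<open>\<open>m \<otimes> f \<in> M(A \<otimes> C\<^sub>0(X))\<close> for \<open>m \<in> M(A)\<close> and \<open>f \<in> C\<^sub>0(X)\<close>\<close>

definition mult_tensor ::
  "('a, 'm) talg_scheme \<Rightarrow> 'a multiplier \<Rightarrow> ('x::topological_space \<Rightarrow> complex) \<Rightarrow> ('x \<Rightarrow> 'a) multiplier"
  where
  "mult_tensor A m f =
    (\<lambda>h\<in>carrier (tensor_C0 A). \<lambda>x. scale A (f x) (fst m (h x)),
     \<lambda>h\<in>carrier (tensor_C0 A). \<lambda>x. scale A (f x) (snd m (h x)))"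

text \<open>\<open>a \<otimes> k \<in> M(A \<otimes> C\<^sub>0(X) \<otimes> C\<^sub>0(X))\<close> for \<open>a \<in> A\<close> and \<open>k \<in> C\<^sub>b(X \<times> X) = M(C\<^sub>0(X) \<otimes> C\<^sub>0(X))\<close>\<close>

definition elem_tensor2 :: "('a, 'm) talg_scheme \<Rightarrow> 'a \<Rightarrow> ('x::topological_space \<times> 'x \<Rightarrow> complex)
    \<Rightarrow> ('x \<Rightarrow> 'x \<Rightarrow> 'a) multiplier" where
  "elem_tensor2 A a k =
    (\<lambda>h\<in>carrier (tensor_C0 (tensor_C0 A)). \<lambda>t s. scale A (k (s, t)) (a \<cdot>\<^bsub>A\<^esub> h t s),
     \<lambda>h\<in>carrier (tensor_C0 (tensor_C0 A)). \<lambda>t s. scale A (k (s, t)) (h t s \<cdot>\<^bsub>A\<^esub> a))"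

text \<open>\<open>M(A, C\<^sub>0(X))\<close>\<close>

definition mult_rel :: "('a, 'm) talg_scheme \<Rightarrow> ('x::topological_space \<Rightarrow> 'a) multiplier set" where
  "mult_rel A = {m \<in> multipliers (tensor_C0 A). \<forall>f\<in>carrier C0.
    m \<cdot>\<^bsub>mult_algebra (tensor_C0 A)\<^esub> mult_tensor A (mult_one A) f
      \<in> mult_embed (tensor_C0 A) ` carrier (tensor_C0 A) \<and>
    mult_tensor A (mult_one A) f \<cdot>\<^bsub>mult_algebra (tensor_C0 A)\<^esub> m
      \<in> mult_embed (tensor_C0 A) ` carrier (tensor_C0 A)}"

text \<open>For a morphism \<open>\<pi> : A \<rightarrow> B\<close>, not necessarily nondegenerate, \<open>\<pi> \<otimes> id : M(A, C\<^sub>0(X)) \<rightarrow> M(B, C\<^sub>0(X))\<close>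
  maps \<open>m\<close> to the only \<open>n\<close> with \<open>n (1 \<otimes> f) = (\<pi> \<otimes> id) (m (1 \<otimes> f))\<close> and
  \<open>(1 \<otimes> f) n = (\<pi> \<otimes> id) ((1 \<otimes> f) m)\<close> for all \<open>f \<in> C\<^sub>0(X)\<close>; the right-hand sides involve just
  \<open>\<pi> \<otimes> id : A \<otimes> C\<^sub>0(X) \<rightarrow> B \<otimes> C\<^sub>0(X)\<close>, which is \<open>h \<mapsto> \<pi> \<circ> h\<close>.
  On \<open>C\<^sub>b(X, A)\<close> it is composition with \<open>\<pi>\<close>, too.\<close>

definition induced_mult :: "('a, 'm) talg_scheme \<Rightarrow> ('b, 'n) talg_scheme \<Rightarrow> ('a \<Rightarrow> 'b) \<Rightarrow>
    ('x::topological_space \<Rightarrow> 'a) multiplier \<Rightarrow> ('x \<Rightarrow> 'b) multiplier \<Rightarrow> bool" where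
  "induced_mult A B \<pi> m n \<longleftrightarrow> m \<in> mult_rel A \<and> n \<in> mult_rel B \<and>
    (\<forall>f\<in>carrier C0. \<forall>h\<in>carrier (tensor_C0 A).
      (m \<cdot>\<^bsub>mult_algebra (tensor_C0 A)\<^esub> mult_tensor A (mult_one A) f = mult_embed (tensor_C0 A) h \<longrightarrow>
       n \<cdot>\<^bsub>mult_algebra (tensor_C0 B)\<^esub> mult_tensor B (mult_one B) f
         = mult_embed (tensor_C0 B) (\<pi> \<circ> h)) \<and>
      (mult_tensor A (mult_one A) f \<cdot>\<^bsub>mult_algebra (tensor_C0 A)\<^esub> m = mult_embed (tensor_C0 A) h \<longrightarrow>
       mult_tensor B (mult_one B) f \<cdot>\<^bsub>mult_algebra (tensor_C0 B)\<^esub> n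
         = mult_embed (tensor_C0 B) (\<pi> \<circ> h)))"


section \<open>Actions of \<open>C*K\<^sub>G\<^sup>a\<close>\<close>

text \<open>The library's class of (not necessarily commutative) topological groups is written additively,
  so \<open>s + t\<close> is the product \<open>st\<close> in \<open>G\<close>. Of the Kac algebra \<open>C\<^sub>0(G)\<close>, only the algebra and the
  comultiplication enter the definition of an action; the coinvolution and the Haar weight do not.
  Comultiplication and flip take values in \<open>M(C\<^sub>0(G) \<otimes> C\<^sub>0(G)) = C\<^sub>b(G \<times> G)\<close>.\<close>

definition comult :: "('g::topological_group_add \<Rightarrow> complex) \<Rightarrow> 'g \<times> 'g \<Rightarrow> complex" where
  "comult f = (\<lambda>(s, t). f (s + t))"

definition tensor_flip :: "('g \<times> 'g \<Rightarrow> complex) \<Rightarrow> 'g \<times> 'g \<Rightarrow> complex" where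
  "tensor_flip k = (\<lambda>(s, t). k (t, s))"

text \<open>\<open>\<alpha> \<otimes> id\<close> and \<open>id \<otimes> (\<sigma> \<circ> d)\<close> as morphisms \<open>A \<otimes> C\<^sub>0(G) \<rightarrow> M(A \<otimes> C\<^sub>0(G) \<otimes> C\<^sub>0(G))\<close>; being
  continuous, they are determined by their values on elementary tensors.\<close>

definition is_alpha_tensor_id :: "('a, 'm) talg_scheme \<Rightarrow>
    ('a \<Rightarrow> ('g::topological_group_add \<Rightarrow> 'a) multiplier) \<Rightarrow>
    (('g \<Rightarrow> 'a) \<Rightarrow> ('g \<Rightarrow> 'g \<Rightarrow> 'a) multiplier) \<Rightarrow> bool" where
  "is_alpha_tensor_id A \<alpha> \<Theta> \<longleftrightarrow>
    morphism (tensor_C0 A) (mult_algebra (tensor_C0 (tensor_C0 A))) \<Theta> \<and>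
    (\<forall>a\<in>carrier A. \<forall>f\<in>carrier C0. \<Theta> (elem_tensor A a f) = mult_tensor (tensor_C0 A) (\<alpha> a) f)"

definition is_id_tensor_flip_comult :: "('a, 'm) talg_scheme \<Rightarrow>
    (('g::topological_group_add \<Rightarrow> 'a) \<Rightarrow> ('g \<Rightarrow> 'g \<Rightarrow> 'a) multiplier) \<Rightarrow> bool" where
  "is_id_tensor_flip_comult A \<Delta> \<longleftrightarrow>
    morphism (tensor_C0 A) (mult_algebra (tensor_C0 (tensor_C0 A))) \<Delta> \<and>
    (\<forall>a\<in>carrier A. \<forall>f\<in>carrier C0.
      \<Delta> (elem_tensor A a f) = elem_tensor2 A a (tensor_flip (comult f)))"

text \<open>The extensions \<open>\<Theta>'\<close>, \<open>\<Delta>'\<close> to the multiplier algebras exist and are unique for an S-morphism \<open>\<alpha>\<close>;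
  the existential quantifier only names them.\<close>

definition kac_action :: "('a, 'm) talg_scheme \<Rightarrow>
    ('a \<Rightarrow> ('g::topological_group_add \<Rightarrow> 'a) multiplier) \<Rightarrow> bool" where
  "kac_action A \<alpha> \<longleftrightarrow>
    S_morphism A (tensor_C0 A) \<alpha> \<and> \<alpha> ` carrier A \<subseteq> mult_rel A \<and> inj_on \<alpha> (carrier A) \<and>
    (\<exists>\<Theta> \<Theta>' \<Delta> \<Delta>'.
      is_alpha_tensor_id A \<alpha> \<Theta> \<and> mult_extension (tensor_C0 A) (tensor_C0 (tensor_C0 A)) \<Theta> \<Theta>' \<and>
      is_id_tensor_flip_comult A \<Delta> \<and> mult_extension (tensor_C0 A) (tensor_C0 (tensor_C0 A)) \<Delta> \<Delta>' \<and>
      (\<forall>a\<in>carrier A. \<Theta>' (\<alpha> a) = \<Delta>' (\<alpha> a)))"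


section \<open>Inverse limits\<close>

definition directed_index :: "'i set \<Rightarrow> ('i \<Rightarrow> 'i \<Rightarrow> bool) \<Rightarrow> bool" where
  "directed_index D le \<longleftrightarrow> D \<noteq> {} \<and> (\<forall>i\<in>D. le i i) \<and>
    (\<forall>i\<in>D. \<forall>j\<in>D. \<forall>k\<in>D. le i j \<longrightarrow> le j k \<longrightarrow> le i k) \<and>
    (\<forall>i\<in>D. \<forall>j\<in>D. \<exists>k\<in>D. le i k \<and> le j k)"

text \<open>\<open>\<kappa> j i : B j \<rightarrow> B i\<close> is the connecting morphism for \<open>i \<le> j\<close>.\<close>

definition cstar_inverse_system :: "'i set \<Rightarrow> ('i \<Rightarrow> 'i \<Rightarrow> bool) \<Rightarrow> ('i \<Rightarrow> 'b talg) \<Rightarrow>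
    ('i \<Rightarrow> 'i \<Rightarrow> 'b \<Rightarrow> 'b) \<Rightarrow> bool" where
  "cstar_inverse_system D le B \<kappa> \<longleftrightarrow> directed_index D le \<and>
    (\<forall>i\<in>D. cstar_algebra (B i)) \<and>
    (\<forall>i\<in>D. \<forall>j\<in>D. le i j \<longrightarrow> morphism (B j) (B i) (\<kappa> j i)) \<and>
    (\<forall>i\<in>D. \<forall>x\<in>carrier (B i). \<kappa> i i x = x) \<and>
    (\<forall>i\<in>D. \<forall>j\<in>D. \<forall>k\<in>D. le i j \<longrightarrow> le j k \<longrightarrow>
      (\<forall>x\<in>carrier (B k). \<kappa> j i (\<kappa> k j x) = \<kappa> k i x))"

definition inverse_limit_carrier :: "'i set \<Rightarrow> ('i \<Rightarrow> 'i \<Rightarrow> bool) \<Rightarrow> ('i \<Rightarrow> 'b talg) \<Rightarrow>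
    ('i \<Rightarrow> 'i \<Rightarrow> 'b \<Rightarrow> 'b) \<Rightarrow> ('i \<Rightarrow> 'b) set" where
  "inverse_limit_carrier D le B \<kappa> =
    {x \<in> (\<Pi>\<^sub>E i\<in>D. carrier (B i)). \<forall>i\<in>D. \<forall>j\<in>D. le i j \<longrightarrow> \<kappa> j i (x j) = x i}"

definition inverse_limit :: "'i set \<Rightarrow> ('i \<Rightarrow> 'i \<Rightarrow> bool) \<Rightarrow> ('i \<Rightarrow> 'b talg) \<Rightarrow>
    ('i \<Rightarrow> 'i \<Rightarrow> 'b \<Rightarrow> 'b) \<Rightarrow> ('i \<Rightarrow> 'b) talg" where
  "inverse_limit D le B \<kappa> = \<lparr>
    carrier = inverse_limit_carrier D le B \<kappa>,
    add = (\<lambda>x y. \<lambda>i\<in>D. x i \<oplus>\<^bsub>B i\<^esub> y i),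
    zero = (\<lambda>i\<in>D. zero (B i)),
    scale = (\<lambda>c x. \<lambda>i\<in>D. scale (B i) c (x i)),
    mult = (\<lambda>x y. \<lambda>i\<in>D. x i \<cdot>\<^bsub>B i\<^esub> y i),
    star = (\<lambda>x. \<lambda>i\<in>D. star (B i) (x i)),
    topo = subtopology (product_topology (\<lambda>i. topo (B i)) D) (inverse_limit_carrier D le B \<kappa>)\<rparr>"

text \<open>\<open>\<theta>\<close> is the isomorphism from \<open>A\<close> onto the inverse limit, so \<open>\<lambda>a. \<theta> a i\<close> is the canonical morphism
  \<open>A \<rightarrow> B i\<close>.\<close>

definition is_inverse_limit_of_actions :: "('a, 'm) talg_scheme \<Rightarrow>
    ('a \<Rightarrow> ('g::topological_group_add \<Rightarrow> 'a) multiplier) \<Rightarrow>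
    'i set \<Rightarrow> ('i \<Rightarrow> 'i \<Rightarrow> bool) \<Rightarrow> ('i \<Rightarrow> 'b talg) \<Rightarrow> ('i \<Rightarrow> 'i \<Rightarrow> 'b \<Rightarrow> 'b) \<Rightarrow>
    ('a \<Rightarrow> 'i \<Rightarrow> 'b) \<Rightarrow> ('i \<Rightarrow> 'b \<Rightarrow> ('g \<Rightarrow> 'b) multiplier) \<Rightarrow> bool" where
  "is_inverse_limit_of_actions A \<alpha> D le B \<kappa> \<theta> \<beta> \<longleftrightarrow>
    cstar_inverse_system D le B \<kappa> \<and>
    talg_iso A (inverse_limit D le B \<kappa>) \<theta> \<and>
    (\<forall>i\<in>D. kac_action (B i) (\<beta> i)) \<and>
    (\<forall>i\<in>D. \<forall>j\<in>D. le i j \<longrightarrow>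
      (\<forall>b\<in>carrier (B j). induced_mult (B j) (B i) (\<kappa> j i) (\<beta> j b) (\<beta> i (\<kappa> j i b)))) \<and>
    (\<forall>i\<in>D. \<forall>a\<in>carrier A. induced_mult A (B i) (\<lambda>a. \<theta> a i) (\<alpha> a) (\<beta> i (\<theta> a i)))"

text \<open>HOL cannot quantify existentially over the types of the indices and of the elements of the
  C*-algebras. They are fixed here to types that can hold seminorms on \<open>A\<close> and completions of
  \<open>A\<close> (classes of Cauchy sequences) with respect to them; this makes the existence claim stronger than
  one with arbitrary types.\<close>

definition inverse_limit_action :: "('a, 'm) talg_scheme \<Rightarrow>
    ('a \<Rightarrow> ('g::topological_group_add \<Rightarrow> 'a) multiplier) \<Rightarrow> bool" where
  "inverse_limit_action A \<alpha> \<longleftrightarrow>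
    (\<exists>(D :: ('a \<Rightarrow> real) set) le (B :: ('a \<Rightarrow> real) \<Rightarrow> (nat \<Rightarrow> 'a) set talg) \<kappa> \<theta> \<beta>.
      is_inverse_limit_of_actions A \<alpha> D le B \<kappa> \<theta> \<beta>)"

end

theory Submission
  imports Defs
begin

text \<open>Since \<open>G\<close> is compact, \<open>M(A, C\<^sub>0(G)) = C(G, A)\<close>, so \<open>\<alpha>\<close> assigns to each \<open>a\<close> a continuous function
  \<open>t \<mapsto> \<alpha>\<^sub>t(a)\<close>, and the action identity evaluated at points says \<open>\<alpha>\<^sub>s \<circ> \<alpha>\<^sub>t = \<alpha>\<^sub>t\<^sub>s\<close>; injectivity then forces
  \<open>\<alpha>\<^sub>e = id\<close>. For a continuous C*-seminorm \<open>p\<close>, compactness makes \<open>sup\<^sub>t p(\<alpha>\<^sub>t(a))\<close> a continuous C*-seminorm,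
  which dominates \<open>p\<close> and is invariant under all \<open>\<alpha>\<^sub>t\<close>. Hence the invariant seminorms \<open>q\<close> determine the
  topology of \<open>A\<close>, the automorphisms \<open>\<alpha>\<^sub>t\<close> extend to isometries of the completion \<open>A\<^sub>q\<close>, and \<open>A\<close> with its
  action is the inverse limit of the \<open>A\<^sub>q\<close>. That the extended automorphisms again give an action in the
  sense of multipliers rests on explicit formulas for the extensions of \<open>\<alpha> \<otimes> id\<close> and
  \<open>id \<otimes> (\<sigma> \<circ> d)\<close>.\<close>


section \<open>Calculus in star algebras\<close>

text \<open>Multipliers cause different trouble in the two directions. For the given action,
  \<open>\<Theta>\<close> and \<open>\<Delta>\<close> are known only on elementary tensors. They are
  reached by density, applied to constant functions, which lie in C(G, C(G, A)) because G is
  compact, and evaluated at a point. An identity of multipliers thus becomes an identity of products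
  x e for all e in A, and the C*-identity cancels e. For the completions, the extensions to
  multiplier algebras must be exhibited. Instead of extending nondegenerate morphisms by approximate
  units, each one is written as multiplication in one variable, conjugated by an automorphism of the
  functions of two variables; isometry of the action is what makes this continuous. A further
  obstacle is that the multiplier topologies involve all continuous C*-seminorms r, even over a
  normed algebra. Continuity gives only r \<le> C p. A log-convexity argument removes C from the
  bounds for multipliers, after which the norm p alone controls them.\<close>

context star_algebra
begin

lemmas closed [simp, intro] = add_closed zero_closed scale_closed mult_closed star_closed

lemma diff_closed [simp, intro]: "\<lbrakk>x \<in> carrier A; y \<in> carrier A\<rbrakk> \<Longrightarrow> diff A x y \<in> carrier A"
  by (simp add: diff_def)

lemma zero_add [simp]: "x \<in> carrier A \<Longrightarrow> \<zero> \<oplus> x = x"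
  using add_comm add_zero by auto

lemma add_left_comm: "\<lbrakk>x \<in> carrier A; y \<in> carrier A; z \<in> carrier A\<rbrakk>
    \<Longrightarrow> x \<oplus> (y \<oplus> z) = y \<oplus> (x \<oplus> z)"
  by (metis add_assoc add_comm)

lemmas add_ac = add_assoc add_comm add_left_comm

lemma diff_self [simp]: "x \<in> carrier A \<Longrightarrow> diff A x x = \<zero>"
  by (simp add: diff_def add_neg)

lemma neg_add [simp]: "x \<in> carrier A \<Longrightarrow> scale A (-1) x \<oplus> x = \<zero>"
  using add_comm add_neg by auto

lemma diff_add_cancel [simp]: "\<lbrakk>x \<in> carrier A; y \<in> carrier A\<rbrakk> \<Longrightarrow> diff A x y \<oplus> y = x"
  by (simp add: diff_def add_assoc add_zero)

lemma diff_eq_zeroD: "\<lbrakk>diff A x y = \<zero>; x \<in> carrier A; y \<in> carrier A\<rbrakk> \<Longrightarrow> x = y"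
  by (metis diff_add_cancel zero_add)

lemma diff_trans: "\<lbrakk>x \<in> carrier A; y \<in> carrier A; z \<in> carrier A\<rbrakk>
    \<Longrightarrow> diff A x z = diff A x y \<oplus> diff A y z"
  by (metis add_assoc diff_add_cancel diff_closed diff_def scale_closed)

lemma scale_zero_left [simp]: "x \<in> carrier A \<Longrightarrow> scale A 0 x = \<zero>"
  using scale_add_left[of x 1 "-1"] by (simp add: scale_one add_neg)

lemma scale_zero_right [simp]: "scale A c \<zero> = \<zero>"
  using scale_scale[of \<zero> c 0] by (simp)

lemma diff_zero [simp]: "x \<in> carrier A \<Longrightarrow> diff A x \<zero> = x"
  by (simp add: diff_def add_zero)

lemma diff_add: "\<lbrakk>x \<in> carrier A; y \<in> carrier A; x' \<in> carrier A; y' \<in> carrier A\<rbrakk>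
    \<Longrightarrow> diff A (x \<oplus> y) (x' \<oplus> y') = diff A x x' \<oplus> diff A y y'"
  by (simp add: diff_def scale_add_right add_ac)

lemma diff_scale: "\<lbrakk>x \<in> carrier A; y \<in> carrier A\<rbrakk>
    \<Longrightarrow> diff A (scale A c x) (scale A c y) = scale A c (diff A x y)"
  by (simp add: diff_def scale_add_right scale_scale mult.commute)

lemma diff_scale_left: "x \<in> carrier A \<Longrightarrow> diff A (scale A c x) (scale A d x) = scale A (c - d) x"
  by (simp add: diff_def scale_scale flip: scale_add_left)

lemma diff_mult_right: "\<lbrakk>x \<in> carrier A; y \<in> carrier A; z \<in> carrier A\<rbrakk>
    \<Longrightarrow> diff A (x \<cdot> z) (y \<cdot> z) = diff A x y \<cdot> z"
  by (simp add: diff_def distrib_right scale_mult_left)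

lemma diff_mult_left: "\<lbrakk>x \<in> carrier A; y \<in> carrier A; z \<in> carrier A\<rbrakk>
    \<Longrightarrow> diff A (z \<cdot> x) (z \<cdot> y) = z \<cdot> diff A x y"
  by (simp add: diff_def distrib_left scale_mult_right)

lemma diff_star: "\<lbrakk>x \<in> carrier A; y \<in> carrier A\<rbrakk>
    \<Longrightarrow> diff A (star A x) (star A y) = star A (diff A x y)"
  by (simp add: diff_def star_add star_scale)

lemma neg_diff: "\<lbrakk>x \<in> carrier A; y \<in> carrier A\<rbrakk> \<Longrightarrow> scale A (-1) (diff A x y) = diff A y x"
  by (simp add: diff_def scale_add_right scale_scale scale_one add_comm)

lemma zero_mult [simp]: "x \<in> carrier A \<Longrightarrow> \<zero> \<cdot> x = \<zero>"
  by (metis scale_mult_left scale_zero_left zero_closed mult_closed)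

lemma star_zero [simp]: "star A \<zero> = \<zero>"
  by (metis complex_cnj_zero scale_zero_left star_scale zero_closed star_closed)

end

text \<open>The topological lemmas ask for no more than this, because the operator seminorms of a
  multiplier algebra enter them only as seminorms, without a C*-identity.\<close>

definition seminorm_on :: "('a, 'm) talg_scheme \<Rightarrow> ('a \<Rightarrow> real) \<Rightarrow> bool" where
  "seminorm_on A p \<longleftrightarrow>
    (\<forall>x\<in>carrier A. 0 \<le> p x) \<and>
    (\<forall>x\<in>carrier A. \<forall>y\<in>carrier A. p (x \<oplus>\<^bsub>A\<^esub> y) \<le> p x + p y) \<and>
    (\<forall>c. \<forall>x\<in>carrier A. p (scale A c x) = cmod c * p x)"

lemma cstar_imp_seminorm: "cstar_seminorm A p \<Longrightarrow> seminorm_on A p"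
  by (simp add: cstar_seminorm_def seminorm_on_def)

locale seminormed_star_algebra = star_algebra +
  fixes p :: "'a \<Rightarrow> real"
  assumes seminorm: "seminorm_on A p"
begin

lemma nonneg [simp]: "x \<in> carrier A \<Longrightarrow> 0 \<le> p x"
  using seminorm by (simp add: seminorm_on_def)

lemma subadd: "\<lbrakk>x \<in> carrier A; y \<in> carrier A\<rbrakk> \<Longrightarrow> p (x \<oplus> y) \<le> p x + p y"
  using seminorm by (simp add: seminorm_on_def)

lemma homog: "x \<in> carrier A \<Longrightarrow> p (scale A c x) = cmod c * p x"
  using seminorm by (simp add: seminorm_on_def)

lemma p_zero [simp]: "p \<zero> = 0"
  using homog[of \<zero> 0] by simp

lemma p_diff_commute: "\<lbrakk>x \<in> carrier A; y \<in> carrier A\<rbrakk> \<Longrightarrow> p (diff A x y) = p (diff A y x)"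
  using homog[of "diff A x y" "-1"] by (simp add: neg_diff)

lemma p_diff_triangle: "\<lbrakk>x \<in> carrier A; y \<in> carrier A; z \<in> carrier A\<rbrakk>
    \<Longrightarrow> p (diff A x z) \<le> p (diff A x y) + p (diff A y z)"
  using subadd[of "diff A x y" "diff A y z"] by (simp add: diff_trans[of x y z])

lemma p_le_diff: "\<lbrakk>x \<in> carrier A; y \<in> carrier A\<rbrakk> \<Longrightarrow> p x \<le> p (diff A x y) + p y"
  using subadd[of "diff A x y" y] by simp

lemma p_diff_le: "\<lbrakk>x \<in> carrier A; y \<in> carrier A\<rbrakk> \<Longrightarrow> p (diff A x y) \<le> p x + p y"
  using subadd[of x "scale A (-1) y"] by (simp add: diff_def homog)

lemma abs_p_diff: "\<lbrakk>x \<in> carrier A; y \<in> carrier A\<rbrakk> \<Longrightarrow> \<bar>p x - p y\<bar> \<le> p (diff A x y)"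
  using p_le_diff[of x y] p_le_diff[of y x] p_diff_commute[of x y] by auto

end

locale cstar_seminormed = star_algebra +
  fixes p :: "'a \<Rightarrow> real"
  assumes cstar: "cstar_seminorm A p"

sublocale cstar_seminormed \<subseteq> seminormed_star_algebra
  by unfold_locales (rule cstar_imp_seminorm[OF cstar])

context cstar_seminormed
begin

lemma submult: "\<lbrakk>x \<in> carrier A; y \<in> carrier A\<rbrakk> \<Longrightarrow> p (x \<cdot> y) \<le> p x * p y"
  using cstar by (simp add: cstar_seminorm_def)

lemma cstar_eq: "x \<in> carrier A \<Longrightarrow> p (star A x \<cdot> x) = (p x)\<^sup>2"
  using cstar by (simp add: cstar_seminorm_def)

text \<open>The C*-identity bounds the square of p x by p x times the value at the adjoint, and a
  factor p x cancels unless it is zero. Applied to the adjoint as well, this makes the involution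
  isometric.\<close>

lemma p_le_star: assumes "x \<in> carrier A" shows "p x \<le> p (star A x)"
proof (cases "p x = 0")
  case False
  have "p x * p x \<le> p (star A x) * p x"
    using submult[of "star A x" x] cstar_eq[of x] assms by (simp add: power2_eq_square)
  then show ?thesis using False nonneg[OF assms] by simp
qed (use assms in simp)

lemma p_star [simp]: "x \<in> carrier A \<Longrightarrow> p (star A x) = p x"
  using p_le_star[of x] p_le_star[of "star A x"] by (simp add: star_star)

lemma diff_mult_bound:
  assumes "x \<in> carrier A" "y \<in> carrier A" "x' \<in> carrier A" "y' \<in> carrier A"
  shows "p (diff A (x \<cdot> y) (x' \<cdot> y')) \<le> p (diff A x x') * p y + p x' * p (diff A y y')"
proof -
  have "p (diff A (x \<cdot> y) (x' \<cdot> y')) \<le> p (diff A (x \<cdot> y) (x' \<cdot> y)) + p (diff A (x' \<cdot> y) (x' \<cdot> y'))"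
    by (rule p_diff_triangle) (use assms in auto)
  also have "\<dots> \<le> p (diff A x x') * p y + p x' * p (diff A y y')"
    using assms by (simp add: diff_mult_left diff_mult_right submult add_mono)
  finally show ?thesis .
qed

end

lemma cstar_seminormed_cont:
  "star_algebra A \<Longrightarrow> p \<in> cont_seminorms A \<Longrightarrow> cstar_seminormed A p"
  by (simp add: cstar_seminormed_def cstar_seminormed_axioms_def cont_seminorms_def)

section \<open>Seminorm topologies\<close>

text \<open>\<open>topology\<close> returns the intended open sets only once the predicate is known
  to be a topology. Two basic balls are intersected by uniting their finite families and taking the
  smaller radius.\<close>

lemma openin_seminorm_topology:
  "openin (seminorm_topology A P) U \<longleftrightarrow> U \<subseteq> carrier A \<and>
    (\<forall>x\<in>U. \<exists>F e. finite F \<and> F \<subseteq> P \<and> e > 0 \<and>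
      {y \<in> carrier A. \<forall>p\<in>F. p (diff A y x) < e} \<subseteq> U)"
proof -
  let ?L = "\<lambda>U. U \<subseteq> carrier A \<and> (\<forall>x\<in>U. \<exists>F e. finite F \<and> F \<subseteq> P \<and> e > 0 \<and>
      {y \<in> carrier A. \<forall>p\<in>F. p (diff A y x) < e} \<subseteq> U)"
  have "istopology ?L"
    unfolding istopology_def
  proof (intro conjI allI impI)
    fix S T assume S: "?L S" and T: "?L T"
    show "S \<inter> T \<subseteq> carrier A" using S by auto
    show "\<forall>x\<in>S \<inter> T. \<exists>F e. finite F \<and> F \<subseteq> P \<and> e > 0 \<and>
      {y \<in> carrier A. \<forall>p\<in>F. p (diff A y x) < e} \<subseteq> S \<inter> T"
    proof
      fix x assume x: "x \<in> S \<inter> T"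
      obtain F d where F: "finite F" "F \<subseteq> P" "d > 0" "{y \<in> carrier A. \<forall>p\<in>F. p (diff A y x) < d} \<subseteq> S"
        using S x by blast
      obtain F' d' where F': "finite F'" "F' \<subseteq> P" "d' > 0"
        "{y \<in> carrier A. \<forall>p\<in>F'. p (diff A y x) < d'} \<subseteq> T"
        using T x by blast
      show "\<exists>F e. finite F \<and> F \<subseteq> P \<and> e > 0 \<and>
          {y \<in> carrier A. \<forall>p\<in>F. p (diff A y x) < e} \<subseteq> S \<inter> T"
        using F F' by (intro exI[of _ "F \<union> F'"] exI[of _ "min d d'"]) (auto; blast)
    qed
  next
    fix K assume K: "\<forall>S\<in>K. ?L S"
    show "\<Union>K \<subseteq> carrier A" using K by blast
    show "\<forall>x\<in>\<Union>K. \<exists>F e. finite F \<and> F \<subseteq> P \<and> e > 0 \<and>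
      {y \<in> carrier A. \<forall>p\<in>F. p (diff A y x) < e} \<subseteq> \<Union>K"
    proof
      fix x assume "x \<in> \<Union>K"
      then obtain S where S: "S \<in> K" "x \<in> S" by blast
      then obtain F d where "finite F" "F \<subseteq> P" "d > 0" "{y \<in> carrier A. \<forall>p\<in>F. p (diff A y x) < d} \<subseteq> S"
        using K by meson
      then show "\<exists>F e. finite F \<and> F \<subseteq> P \<and> e > 0 \<and>
          {y \<in> carrier A. \<forall>p\<in>F. p (diff A y x) < e} \<subseteq> \<Union>K"
        using S by (intro exI[of _ F] exI[of _ d]) blast
    qed
  qed
  then show ?thesis
    unfolding seminorm_topology_def by (simp add: topology_inverse')
qed

lemma topspace_seminorm_topology [simp]: "topspace (seminorm_topology A P) = carrier A"
proof -
  have "openin (seminorm_topology A P) (carrier A)"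
    unfolding openin_seminorm_topology by (auto intro!: exI[of _ "{}"] exI[of _ 1])
  moreover have "topspace (seminorm_topology A P) \<subseteq> carrier A"
    using openin_topspace[of "seminorm_topology A P"] unfolding openin_seminorm_topology by blast
  ultimately show ?thesis by (simp add: openin_subset subset_antisym)
qed

lemma openin_seminorm_ball:
  assumes "star_algebra A" "seminorm_on A p" "p \<in> P" "a \<in> carrier A"
  shows "openin (seminorm_topology A P) {y \<in> carrier A. p (diff A y a) < e}"
proof -
  interpret seminormed_star_algebra A p
    using assms by (simp add: seminormed_star_algebra_def seminormed_star_algebra_axioms_def)
  have "{y \<in> carrier A. p (diff A y x) < e - p (diff A x a)} \<subseteq> {y \<in> carrier A. p (diff A y a) < e}"
    if "x \<in> carrier A" for x
    using p_diff_triangle[of _ x a] that assms by (auto simp: less_diff_eq intro: le_less_trans)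
  then show ?thesis
    unfolding openin_seminorm_topology
    using assms by (auto intro!: exI[of _ "{p}"] exI[of _ "e - p (diff A _ a)"])
qed

lemma continuous_map_into_seminormI:
  assumes "\<And>x. x \<in> topspace X \<Longrightarrow> f x \<in> carrier B"
    and "\<And>x p e. \<lbrakk>x \<in> topspace X; p \<in> Q; e > 0\<rbrakk>
      \<Longrightarrow> \<exists>V. openin X V \<and> x \<in> V \<and> (\<forall>y\<in>V. p (diff B (f y) (f x)) < e)"
  shows "continuous_map X (seminorm_topology B Q) f"
  unfolding continuous_map_def
proof (intro conjI allI impI)
  show "f \<in> topspace X \<rightarrow> topspace (seminorm_topology B Q)" using assms(1) by auto
next
  fix U assume U: "openin (seminorm_topology B Q) U"
  show "openin X {x \<in> topspace X. f x \<in> U}"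
  proof (subst openin_subopen, intro ballI)
    fix x assume "x \<in> {x \<in> topspace X. f x \<in> U}"
    then have x: "x \<in> topspace X" "f x \<in> U" by auto
    obtain F e where F: "finite F" "F \<subseteq> Q" "e > 0" "{y \<in> carrier B. \<forall>p\<in>F. p (diff B y (f x)) < e} \<subseteq> U"
      using U x(2) unfolding openin_seminorm_topology by blast
    have "\<forall>p\<in>F. \<exists>V. openin X V \<and> x \<in> V \<and> (\<forall>y\<in>V. p (diff B (f y) (f x)) < e)"
      using assms(2)[OF x(1)] F by blast
    then obtain V where V: "\<And>p. p \<in> F \<Longrightarrow> openin X (V p) \<and> x \<in> V p \<and> (\<forall>y\<in>V p. p (diff B (f y) (f x)) < e)"
      by metis
    \<comment> \<open>The factor \<open>topspace X\<close> keeps the set open when \<open>F\<close>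
      is empty, where the intersection over \<open>F\<close> is everything.\<close>
    have "openin X (topspace X \<inter> \<Inter>(V ` F))"
      using openin_INT[of F X V] F(1) V by (simp add: Int_commute)
    moreover have "topspace X \<inter> \<Inter>(V ` F) \<subseteq> {x \<in> topspace X. f x \<in> U}"
      using F(4) V assms(1) by auto
    ultimately show "\<exists>T. openin X T \<and> x \<in> T \<and> T \<subseteq> {x \<in> topspace X. f x \<in> U}"
      using x V by (intro exI[of _ "topspace X \<inter> \<Inter>(V ` F)"]) auto
  qed
qed

lemma continuous_map_into_seminormD:
  assumes "star_algebra B" "seminorm_on B p" "p \<in> Q" "continuous_map X (seminorm_topology B Q) f"
    "x \<in> topspace X" "e > 0"
  shows "\<exists>V. openin X V \<and> x \<in> V \<and> (\<forall>y\<in>V. p (diff B (f y) (f x)) < e)"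
proof -
  interpret seminormed_star_algebra B p
    using assms by (simp add: seminormed_star_algebra_def seminormed_star_algebra_axioms_def)
  have fx: "f x \<in> carrier B"
    using assms(4,5) by (auto simp: continuous_map_def)
  have "openin X {y \<in> topspace X. f y \<in> {z \<in> carrier B. p (diff B z (f x)) < e}}"
    using assms(4) openin_seminorm_ball[OF assms(1-3) fx] unfolding continuous_map by blast
  then show ?thesis
    using assms(5,6) fx by (intro exI[of _ "{y \<in> topspace X. f y \<in> {z \<in> carrier B. p (diff B z (f x)) < e}}"]) auto
qed

lemma continuous_map_seminorm_topologyI:
  assumes "\<And>x. x \<in> carrier A \<Longrightarrow> f x \<in> carrier B"
    and "\<And>x p e. \<lbrakk>x \<in> carrier A; p \<in> Q; e > 0\<rbrakk> \<Longrightarrow> \<exists>F d. finite F \<and> F \<subseteq> P \<and> d > 0 \<and>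
      (\<forall>y\<in>carrier A. (\<forall>r\<in>F. r (diff A y x) < d) \<longrightarrow> p (diff B (f y) (f x)) < e)"
  shows "continuous_map (seminorm_topology A P) (seminorm_topology B Q) f"
  unfolding continuous_map_def
proof (intro conjI allI impI)
  show "f \<in> topspace (seminorm_topology A P) \<rightarrow> topspace (seminorm_topology B Q)"
    using assms(1) by auto
next
  fix U assume U: "openin (seminorm_topology B Q) U"
  have "\<exists>F d. finite F \<and> F \<subseteq> P \<and> d > 0 \<and> {y \<in> carrier A. \<forall>p\<in>F. p (diff A y x) < d}
      \<subseteq> {x \<in> carrier A. f x \<in> U}" if x: "x \<in> carrier A" "f x \<in> U" for x
  proof -
    obtain F e where F: "finite F" "F \<subseteq> Q" "e > 0" "{y \<in> carrier B. \<forall>p\<in>F. p (diff B y (f x)) < e} \<subseteq> U"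
      using U x(2) unfolding openin_seminorm_topology by blast
    have "\<forall>p\<in>F. \<exists>F' d. finite F' \<and> F' \<subseteq> P \<and> d > 0 \<and>
      (\<forall>y\<in>carrier A. (\<forall>r\<in>F'. r (diff A y x) < d) \<longrightarrow> p (diff B (f y) (f x)) < e)"
      using assms(2)[OF x(1)] F by blast
    then obtain F' d where F': "\<And>p. p \<in> F \<Longrightarrow> finite (F' p) \<and> F' p \<subseteq> P \<and> d p > 0 \<and>
      (\<forall>y\<in>carrier A. (\<forall>r\<in>F' p. r (diff A y x) < d p) \<longrightarrow> p (diff B (f y) (f x)) < e)"
      by metis
    \<comment> \<open>The extra 1 gives \<open>Min\<close> a nonempty argument when \<open>F\<close>
      is empty.\<close>
    define d0 where "d0 = Min (insert 1 (d ` F))"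
    have d0: "d0 > 0" "\<And>p. p \<in> F \<Longrightarrow> d0 \<le> d p"
      using F(1) F' by (auto simp: d0_def)
    have "f y \<in> U" if y: "y \<in> carrier A" "\<forall>p\<in>\<Union>(F' ` F). p (diff A y x) < d0" for y
    proof -
      have "p (diff B (f y) (f x)) < e" if "p \<in> F" for p
        using F'[OF that] y d0(2)[OF that] that by fastforce
      then show ?thesis using F(4) assms(1) y by blast
    qed
    then show ?thesis
      using F(1) F' d0(1) by (intro exI[of _ "\<Union>(F' ` F)"] exI[of _ d0]) auto
  qed
  then show "openin (seminorm_topology A P) {x \<in> topspace (seminorm_topology A P). f x \<in> U}"
    unfolding openin_seminorm_topology by auto
qed

lemma limitin_seminorm_topologyI:
  assumes "l \<in> carrier A" "eventually (\<lambda>x. f x \<in> carrier A) F"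
    and "\<And>p e. \<lbrakk>p \<in> P; e > 0\<rbrakk> \<Longrightarrow> eventually (\<lambda>x. p (diff A (f x) l) < e) F"
  shows "limitin (seminorm_topology A P) f l F"
  unfolding limitin_def
proof (intro conjI allI impI)
  show "l \<in> topspace (seminorm_topology A P)" using assms by simp
next
  fix U assume "openin (seminorm_topology A P) U \<and> l \<in> U"
  then obtain F' e where F: "finite F'" "F' \<subseteq> P" "e > 0" "{y \<in> carrier A. \<forall>p\<in>F'. p (diff A y l) < e} \<subseteq> U"
    unfolding openin_seminorm_topology by blast
  have "eventually (\<lambda>x. \<forall>p\<in>F'. p (diff A (f x) l) < e) F"
    using F assms(3) by (auto simp: eventually_ball_finite_distrib)
  with assms(2) show "eventually (\<lambda>x. f x \<in> U) F"
    by eventually_elim (use F(4) in blast)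
qed

lemma limitin_seminorm_topologyD:
  assumes "star_algebra A" "seminorm_on A p" "p \<in> P" "limitin (seminorm_topology A P) f l F" "e > 0"
  shows "eventually (\<lambda>x. p (diff A (f x) l) < e) F"
proof -
  interpret seminormed_star_algebra A p
    using assms by (simp add: seminormed_star_algebra_def seminormed_star_algebra_axioms_def)
  have l: "l \<in> carrier A" using assms(4) by (simp add: limitin_def)
  have "eventually (\<lambda>x. f x \<in> {y \<in> carrier A. p (diff A y l) < e}) F"
    using assms(4,5) openin_seminorm_ball[OF assms(1-3) l, of e] l unfolding limitin_def by fastforce
  then show ?thesis by eventually_elim auto
qed

text \<open>Both topologies are invariant under translation, so comparing the two families near zero
  makes the identity map continuous in both directions.\<close>

lemma seminorm_topology_eqI:
  assumes "star_algebra A"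
    and "\<And>p e. \<lbrakk>p \<in> P; e > 0\<rbrakk> \<Longrightarrow> \<exists>F d. finite F \<and> F \<subseteq> Q \<and> d > 0 \<and>
      (\<forall>x\<in>carrier A. (\<forall>r\<in>F. r x < d) \<longrightarrow> p x < e)"
    and "\<And>p e. \<lbrakk>p \<in> Q; e > 0\<rbrakk> \<Longrightarrow> \<exists>F d. finite F \<and> F \<subseteq> P \<and> d > 0 \<and>
      (\<forall>x\<in>carrier A. (\<forall>r\<in>F. r x < d) \<longrightarrow> p x < e)"
  shows "seminorm_topology A P = seminorm_topology A Q"
proof -
  interpret star_algebra A by fact
  have cm: "continuous_map (seminorm_topology A P') (seminorm_topology A Q') (\<lambda>x. x)"
    if *: "\<And>p e. \<lbrakk>p \<in> Q'; e > 0\<rbrakk> \<Longrightarrow> \<exists>F d. finite F \<and> F \<subseteq> P' \<and> d > 0 \<and>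
      (\<forall>x\<in>carrier A. (\<forall>r\<in>F. r x < d) \<longrightarrow> p x < e)" for P' Q'
  proof (rule continuous_map_seminorm_topologyI)
    fix x p and e :: real assume "x \<in> carrier A" "p \<in> Q'" "e > 0"
    then show "\<exists>F d. finite F \<and> F \<subseteq> P' \<and> d > 0 \<and>
      (\<forall>y\<in>carrier A. (\<forall>r\<in>F. r (diff A y x) < d) \<longrightarrow> p (diff A y x) < e)"
      using *[of p e] by (meson diff_closed)
  qed
  have "openin (seminorm_topology A P') U"
    if "continuous_map (seminorm_topology A P') (seminorm_topology A Q') (\<lambda>x. x)"
       "openin (seminorm_topology A Q') U" for P' Q' U
  proof -
    have "{x \<in> carrier A. x \<in> U} = U" using openin_subset[OF that(2)] by auto
    then show ?thesis using that unfolding continuous_map by auto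
  qed
  then show ?thesis
    using cm[OF assms(2)] cm[OF assms(3)] by (metis topology_eq)
qed

section \<open>Star homomorphisms and continuous C*-seminorms\<close>

definition star_hom :: "('a, 'm) talg_scheme \<Rightarrow> ('b, 'n) talg_scheme \<Rightarrow> ('a \<Rightarrow> 'b) \<Rightarrow> bool" where
  "star_hom A B \<phi> \<longleftrightarrow>
    \<phi> \<in> carrier A \<rightarrow> carrier B \<and>
    (\<forall>x\<in>carrier A. \<forall>y\<in>carrier A. \<phi> (x \<oplus>\<^bsub>A\<^esub> y) = \<phi> x \<oplus>\<^bsub>B\<^esub> \<phi> y) \<and>
    (\<forall>c. \<forall>x\<in>carrier A. \<phi> (scale A c x) = scale B c (\<phi> x)) \<and>
    (\<forall>x\<in>carrier A. \<forall>y\<in>carrier A. \<phi> (x \<cdot>\<^bsub>A\<^esub> y) = \<phi> x \<cdot>\<^bsub>B\<^esub> \<phi> y) \<and>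
    (\<forall>x\<in>carrier A. \<phi> (star A x) = star B (\<phi> x))"

lemma morphism_iff: "morphism A B \<phi> \<longleftrightarrow> star_hom A B \<phi> \<and> continuous_map (topo A) (topo B) \<phi>"
  by (auto simp: morphism_def star_hom_def)

lemma star_homI:
  assumes "\<And>x. x \<in> carrier A \<Longrightarrow> \<phi> x \<in> carrier B"
    and "\<And>x y. \<lbrakk>x \<in> carrier A; y \<in> carrier A\<rbrakk> \<Longrightarrow> \<phi> (x \<oplus>\<^bsub>A\<^esub> y) = \<phi> x \<oplus>\<^bsub>B\<^esub> \<phi> y"
    and "\<And>c x. x \<in> carrier A \<Longrightarrow> \<phi> (scale A c x) = scale B c (\<phi> x)"
    and "\<And>x y. \<lbrakk>x \<in> carrier A; y \<in> carrier A\<rbrakk> \<Longrightarrow> \<phi> (x \<cdot>\<^bsub>A\<^esub> y) = \<phi> x \<cdot>\<^bsub>B\<^esub> \<phi> y"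
    and "\<And>x. x \<in> carrier A \<Longrightarrow> \<phi> (star A x) = star B (\<phi> x)"
  shows "star_hom A B \<phi>"
  using assms by (auto simp: star_hom_def)

lemma star_homD:
  assumes "star_hom A B \<phi>"
  shows star_hom_closed: "x \<in> carrier A \<Longrightarrow> \<phi> x \<in> carrier B"
    and star_hom_add: "\<lbrakk>x \<in> carrier A; y \<in> carrier A\<rbrakk> \<Longrightarrow> \<phi> (x \<oplus>\<^bsub>A\<^esub> y) = \<phi> x \<oplus>\<^bsub>B\<^esub> \<phi> y"
    and star_hom_scale: "x \<in> carrier A \<Longrightarrow> \<phi> (scale A c x) = scale B c (\<phi> x)"
    and star_hom_mult: "\<lbrakk>x \<in> carrier A; y \<in> carrier A\<rbrakk> \<Longrightarrow> \<phi> (x \<cdot>\<^bsub>A\<^esub> y) = \<phi> x \<cdot>\<^bsub>B\<^esub> \<phi> y"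
    and star_hom_star: "x \<in> carrier A \<Longrightarrow> \<phi> (star A x) = star B (\<phi> x)"
  using assms by (auto simp: star_hom_def)

lemma star_hom_diff:
  assumes "star_hom A B \<phi>" "star_algebra A" "x \<in> carrier A" "y \<in> carrier A"
  shows "\<phi> (diff A x y) = diff B (\<phi> x) (\<phi> y)"
  using assms by (simp add: diff_def star_hom_add star_hom_scale star_algebra.scale_closed)

lemma star_hom_comp: "\<lbrakk>star_hom A B f; star_hom B C g\<rbrakk> \<Longrightarrow> star_hom A C (g \<circ> f)"
  by (intro star_homI) (simp_all add: star_homD[of A B f] star_homD[of B C g])

lemma morphism_comp: "\<lbrakk>morphism A B f; morphism B C g\<rbrakk> \<Longrightarrow> morphism A C (g \<circ> f)"
  unfolding morphism_iff using star_hom_comp continuous_map_compose by blast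

lemma star_hom_zero:
  assumes "star_hom A B \<phi>" "star_algebra A" "star_algebra B"
  shows "\<phi> (zero A) = zero B"
  by (metis assms star_algebra.scale_zero_left star_algebra.zero_closed star_hom_closed star_hom_scale)

lemma cstar_seminorm_pullback:
  assumes "star_hom A B \<phi>" "star_algebra A" "cstar_seminorm B p"
  shows "cstar_seminorm A (p \<circ> \<phi>)"
  using assms(3) unfolding cstar_seminorm_def o_def
  by (simp add: star_homD[OF assms(1)] star_algebra.closed[OF assms(2)])

lemma cont_seminorm_pullback:
  assumes "morphism A B \<phi>" "star_algebra A" "p \<in> cont_seminorms B"
  shows "p \<circ> \<phi> \<in> cont_seminorms A"
  using assms cstar_seminorm_pullback[of A B \<phi> p] continuous_map_compose
  unfolding cont_seminorms_def morphism_iff by blast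

lemma cstar_seminorm_zero: "star_algebra A \<Longrightarrow> cstar_seminorm A (\<lambda>_. 0)"
  by (simp add: cstar_seminorm_def)

text \<open>Source of directedness: a maximum, unlike a sum, keeps the C*-identity, because squaring
  is monotone on nonnegative numbers.\<close>

lemma cstar_seminorm_max:
  assumes "star_algebra A" "cstar_seminorm A p" "cstar_seminorm A q"
  shows "cstar_seminorm A (\<lambda>x. max (p x) (q x))"
proof -
  interpret P: cstar_seminormed A p using assms by (simp add: cstar_seminormed_def cstar_seminormed_axioms_def)
  interpret Q: cstar_seminormed A q using assms by (simp add: cstar_seminormed_def cstar_seminormed_axioms_def)
  have mult: "max (p (x \<cdot>\<^bsub>A\<^esub> y)) (q (x \<cdot>\<^bsub>A\<^esub> y)) \<le> max (p x) (q x) * max (p y) (q y)"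
    if "x \<in> carrier A" "y \<in> carrier A" for x y
  proof (rule max.boundedI)
    show "p (x \<cdot>\<^bsub>A\<^esub> y) \<le> max (p x) (q x) * max (p y) (q y)"
      by (rule order_trans[OF P.submult mult_mono]) (use that in \<open>auto simp: le_max_iff_disj\<close>)
    show "q (x \<cdot>\<^bsub>A\<^esub> y) \<le> max (p x) (q x) * max (p y) (q y)"
      by (rule order_trans[OF Q.submult mult_mono]) (use that in \<open>auto simp: le_max_iff_disj\<close>)
  qed
  have sq: "max (a\<^sup>2) (b\<^sup>2) = (max a b)\<^sup>2" if "a \<ge> 0" "b \<ge> 0" for a b :: real
    using that by (auto simp: max_def power_mono)
  have add: "max (p (x \<oplus>\<^bsub>A\<^esub> y)) (q (x \<oplus>\<^bsub>A\<^esub> y)) \<le> max (p x) (q x) + max (p y) (q y)"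
    if "x \<in> carrier A" "y \<in> carrier A" for x y
    using P.subadd[OF that] Q.subadd[OF that] by linarith
  show ?thesis
    unfolding cstar_seminorm_def
    using mult add by (auto simp: P.homog Q.homog max_mult_distrib_left P.cstar_eq Q.cstar_eq sq le_max_iff_disj)
qed

lemma cont_seminorms_max:
  assumes "star_algebra A" "p \<in> cont_seminorms A" "q \<in> cont_seminorms A"
  shows "(\<lambda>x. max (p x) (q x)) \<in> cont_seminorms A"
  using assms by (simp add: cont_seminorms_def cstar_seminorm_max continuous_map_real_max)

lemma cont_seminorms_zero: "star_algebra A \<Longrightarrow> (\<lambda>_. 0) \<in> cont_seminorms A"
  by (simp add: cont_seminorms_def cstar_seminorm_zero)

text \<open>The zero seminorm serves the empty family, maxima do the rest. Pointwise maxima give the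
  bound on the whole type, so it can be applied without membership conditions.\<close>

lemma cont_seminorms_finite_bound:
  assumes "star_algebra A" "finite F" "F \<subseteq> cont_seminorms A"
  shows "\<exists>r\<in>cont_seminorms A. \<forall>p\<in>F. \<forall>x. p x \<le> r x"
  using assms(2,3)
proof (induction F)
  case empty
  then show ?case using cont_seminorms_zero[OF assms(1)] by blast
next
  case (insert p F)
  then obtain r where "r \<in> cont_seminorms A" "\<forall>p\<in>F. \<forall>x. p x \<le> r x" by auto
  then show ?case
    using cont_seminorms_max[OF assms(1), of p r] insert.prems
    by (intro bexI[of _ "\<lambda>x. max (p x) (r x)"]) (auto simp: le_max_iff_disj)
qed

text \<open>By the reverse triangle inequality, continuity at zero carries over to every point, so
  smallness of p on a basic neighbourhood of zero is enough.\<close>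

lemma cont_seminormI:
  assumes "star_algebra A" "cstar_seminorm A p" "topo A = seminorm_topology A P"
    and "\<And>e. e > 0 \<Longrightarrow> \<exists>F d. finite F \<and> F \<subseteq> P \<and> d > 0 \<and> (\<forall>x\<in>carrier A. (\<forall>r\<in>F. r x < d) \<longrightarrow> p x < e)"
  shows "p \<in> cont_seminorms A"
proof -
  interpret cstar_seminormed A p using assms by (simp add: cstar_seminormed_def cstar_seminormed_axioms_def)
  have "openin (seminorm_topology A P) {x \<in> carrier A. p x \<in> U}" if U: "open U" for U
    unfolding openin_seminorm_topology
  proof (intro conjI ballI)
    fix x assume x: "x \<in> {x \<in> carrier A. p x \<in> U}"
    then obtain e where e: "e > 0" "\<And>y. dist y (p x) < e \<Longrightarrow> y \<in> U"
      using U by (force simp: open_dist)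
    obtain F d where F: "finite F" "F \<subseteq> P" "d > 0" "\<forall>x\<in>carrier A. (\<forall>r\<in>F. r x < d) \<longrightarrow> p x < e"
      using assms(4)[OF e(1)] by blast
    have "p y \<in> U" if "y \<in> carrier A" "\<forall>r\<in>F. r (diff A y x) < d" for y
      using e(2)[of "p y"] F(4) that x abs_p_diff[of y x] by (force simp: dist_real_def)
    then show "\<exists>F e. finite F \<and> F \<subseteq> P \<and> 0 < e \<and>
      {y \<in> carrier A. \<forall>p\<in>F. p (diff A y x) < e} \<subseteq> {x \<in> carrier A. p x \<in> U}"
      using F by (intro exI[of _ F] exI[of _ d]) auto
  qed auto
  then show ?thesis
    using assms(2,3) by (auto simp: cont_seminorms_def continuous_map_def)
qed

lemma cont_seminormD:
  assumes "star_algebra A" "topo A = seminorm_topology A P" "p \<in> cont_seminorms A" "e > 0"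
  shows "\<exists>F d. finite F \<and> F \<subseteq> P \<and> d > 0 \<and> (\<forall>x\<in>carrier A. (\<forall>r\<in>F. r x < d) \<longrightarrow> p x < e)"
proof -
  interpret cstar_seminormed A p using assms by (simp add: cstar_seminormed_cont)
  have "openin (topo A) {x \<in> topspace (topo A). p x \<in> {..<e}}"
  proof -
    have "\<forall>U. open U \<longrightarrow> openin (topo A) {x \<in> topspace (topo A). p x \<in> U}"
      using assms(3) by (simp add: cont_seminorms_def continuous_map_def)
    then show ?thesis by (rule allE[where x = "{..<e}"]) simp
  qed
  then have "openin (seminorm_topology A P) {x \<in> carrier A. p x < e}"
    using assms(2) by simp
  moreover have "zero A \<in> {x \<in> carrier A. p x < e}" using assms(4) by simp
  ultimately obtain F d where F: "finite F" "F \<subseteq> P" "d > 0"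
      "{y \<in> carrier A. \<forall>p\<in>F. p (diff A y (zero A)) < d} \<subseteq> {x \<in> carrier A. p x < e}"
    unfolding openin_seminorm_topology by blast
  then show ?thesis by (intro exI[of _ F] exI[of _ d]) auto
qed

text \<open>The family of all continuous C*-seminorms replaces whatever generating family is given:
  it is determined by the algebra and closed under maxima. Completeness and separation stay outside
  the locale, so C(X, A) and its iterate qualify through their seminorms alone.\<close>

locale lc_star_algebra = star_algebra +
  assumes topo_eq: "topo A = seminorm_topology A (cont_seminorms A)"
begin

lemma topspace_topo [simp]: "topspace (topo A) = carrier A"
  by (simp add: topo_eq)

lemma cont_seminormed: "p \<in> cont_seminorms A \<Longrightarrow> cstar_seminormed A p"
  by (simp add: cstar_seminormed_cont star_algebra_axioms)

lemma cont_seminorm_on: "p \<in> cont_seminorms A \<Longrightarrow> seminorm_on A p"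
  by (simp add: cont_seminorms_def cstar_imp_seminorm)

lemma cont_seminorm_topology:
  assumes "p \<in> cont_seminorms A" "topo A = seminorm_topology A P" "e > 0"
  shows "\<exists>F d. finite F \<and> F \<subseteq> P \<and> d > 0 \<and> (\<forall>x\<in>carrier A. (\<forall>r\<in>F. r x < d) \<longrightarrow> p x < e)"
  using cont_seminormD star_algebra_axioms assms by blast

text \<open>Limits along \<open>nhds x\<close> include the point itself, where the expression is p 0
  = 0. They compose with arbitrary limits of the argument, which is what functions of two variables
  and substitutions in the group require.\<close>

lemma continuous_map_euclidean_iff:
  "continuous_map euclidean (topo A) f \<longleftrightarrow> (\<forall>x. f x \<in> carrier A) \<and>
    (\<forall>p\<in>cont_seminorms A. \<forall>x. ((\<lambda>y. p (diff A (f y) (f x))) \<longlongrightarrow> 0) (nhds x))"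
    (is "?L \<longleftrightarrow> ?R")
proof
  assume L: ?L
  then have f: "f x \<in> carrier A" for x by (auto simp: continuous_map_def)
  have "((\<lambda>y. p (diff A (f y) (f x))) \<longlongrightarrow> 0) (nhds x)" if p: "p \<in> cont_seminorms A" for p x
  proof -
    interpret cstar_seminormed A p using p by (rule cont_seminormed)
    show ?thesis
    proof (rule tendstoI)
      fix e :: real assume "e > 0"
      then obtain V where "open V" "x \<in> V" "\<forall>y\<in>V. p (diff A (f y) (f x)) < e"
        using continuous_map_into_seminormD[OF star_algebra_axioms seminorm p, of euclidean f x e] L
        by (auto simp: topo_eq)
      then show "\<forall>\<^sub>F y in nhds x. dist (p (diff A (f y) (f x))) 0 < e"
        using f by (auto simp: eventually_nhds dist_real_def)
    qed
  qed
  with f show ?R by blast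
next
  assume R: ?R
  show ?L unfolding topo_eq
  proof (rule continuous_map_into_seminormI)
    fix x p and e :: real assume "p \<in> cont_seminorms A" "e > 0"
    then have "\<forall>\<^sub>F y in nhds x. p (diff A (f y) (f x)) < e"
      using R by (auto dest: order_tendstoD)
    then show "\<exists>V. openin euclidean V \<and> x \<in> V \<and> (\<forall>y\<in>V. p (diff A (f y) (f x)) < e)"
      by (simp add: eventually_nhds)
  qed (use R in auto)
qed

end

lemma lc_star_algebraI:
  assumes "star_algebra A" "\<And>p. p \<in> P \<Longrightarrow> cstar_seminorm A p" "topo A = seminorm_topology A P"
  shows "lc_star_algebra A" and "P \<subseteq> cont_seminorms A"
proof -
  show sub: "P \<subseteq> cont_seminorms A"
  proof
    fix p assume "p \<in> P"
    then show "p \<in> cont_seminorms A"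
      by (intro cont_seminormI[OF assms(1) assms(2) assms(3)]) (auto intro!: exI[of _ "{p}"])
  qed
  have "seminorm_topology A P = seminorm_topology A (cont_seminorms A)"
  proof (rule seminorm_topology_eqI[OF assms(1)])
    show "\<exists>F d. finite F \<and> F \<subseteq> cont_seminorms A \<and> d > 0 \<and> (\<forall>x\<in>carrier A. (\<forall>r\<in>F. r x < d) \<longrightarrow> p x < e)"
      if "p \<in> P" "e > 0" for p and e :: real
      using sub that by (intro exI[of _ "{p}"] exI[of _ e]) auto
    show "\<exists>F d. finite F \<and> F \<subseteq> P \<and> d > 0 \<and> (\<forall>x\<in>carrier A. (\<forall>r\<in>F. r x < d) \<longrightarrow> p x < e)"
      if "p \<in> cont_seminorms A" "e > 0" for p and e :: real
      using cont_seminormD[OF assms(1,3) that] .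
  qed
  then show "lc_star_algebra A"
    using assms(1,3) by (simp add: lc_star_algebra_def lc_star_algebra_axioms_def)
qed

text \<open>A C*-algebra up to completeness and separation. One seminorm p generates the topology,
  but \<open>cont_seminorms\<close> may contain others, and the multiplier topologies refer to all
  of them; they have to be compared with p.\<close>

locale normed_star_algebra = cstar_seminormed +
  assumes topo_norm: "topo A = seminorm_topology A {p}"

sublocale normed_star_algebra \<subseteq> lc_star_algebra
  by (rule lc_star_algebraI(1)[where P = "{p}"]) (auto simp: topo_norm cstar star_algebra_axioms)

context normed_star_algebra
begin

lemma norm_cont: "p \<in> cont_seminorms A"
  using lc_star_algebraI(2)[where P = "{p}" and A = A] by (simp add: topo_norm cstar star_algebra_axioms)

lemma cont_seminorm_small:
  assumes "r \<in> cont_seminorms A" "e > 0"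
  shows "\<exists>d>0. \<forall>x\<in>carrier A. p x < d \<longrightarrow> r x < e"
proof -
  obtain F d where F: "finite F" "F \<subseteq> {p}" "d > 0" "\<forall>x\<in>carrier A. (\<forall>r\<in>F. r x < d) \<longrightarrow> r x < e"
    using cont_seminorm_topology[OF assms(1) topo_norm assms(2)] by blast
  then show ?thesis by (intro exI[of _ d]) auto
qed

lemma cont_seminorm_le:
  assumes r: "r \<in> cont_seminorms A"
  shows "\<exists>C\<ge>0. \<forall>x\<in>carrier A. r x \<le> C * p x"
proof -
  interpret R: cstar_seminormed A r using r by (rule cont_seminormed)
  obtain d where d: "d > 0" "\<forall>x\<in>carrier A. p x < d \<longrightarrow> r x < 1"
    using cont_seminorm_small[OF r, of 1] by auto
  have scaled: "k * r x < 1" if "x \<in> carrier A" "k > 0" "k * p x < d" for k x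
    using d(2) that by (metis R.homog abs_of_pos homog norm_of_real scale_closed)
  \<comment> \<open>Rescaling x to p-value d/2 rather than d keeps it strictly inside the ball on
    which r < 1; hence the factor 2.\<close>
  have "r x \<le> 2 / d * p x" if x: "x \<in> carrier A" for x
  proof (cases "p x = 0")
    case True
    \<comment> \<open>All multiples of x have p-value zero and lie in the ball; the multiple with
      r-value 1 would contradict r < 1 there.\<close>
    have "r x = 0"
    proof (rule ccontr)
      assume "r x \<noteq> 0"
      then have "r x > 0" using R.nonneg[OF x] by linarith
      then show False using scaled[OF x, of "1 / r x"] True d(1) by simp
    qed
    then show ?thesis by (simp add: True)
  next
    case False
    then have "p x > 0" using nonneg[OF x] by linarith
    then have "d / (2 * p x) * r x < 1" using scaled[OF x, of "d / (2 * p x)"] d(1) by simp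
    then show ?thesis using \<open>p x > 0\<close> d(1) by (simp add: field_simps)
  qed
  then show ?thesis using d(1) by (intro exI[of _ "2 / d"]) auto
qed

lemma continuous_map_norm_iff:
  "continuous_map euclidean (topo A) f \<longleftrightarrow> (\<forall>x. f x \<in> carrier A) \<and>
    (\<forall>x. ((\<lambda>y. p (diff A (f y) (f x))) \<longlongrightarrow> 0) (nhds x))"
proof -
  have "((\<lambda>y. r (diff A (f y) (f x))) \<longlongrightarrow> 0) (nhds x)"
    if "\<forall>x. f x \<in> carrier A" "((\<lambda>y. p (diff A (f y) (f x))) \<longlongrightarrow> 0) (nhds x)" "r \<in> cont_seminorms A" for r x
  proof -
    interpret R: cstar_seminormed A r using that by (simp add: cont_seminormed)
    have "\<exists>C. \<forall>x\<in>carrier A. r x \<le> C * p x" using cont_seminorm_le[OF that(3)] by blast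
    then obtain C where C: "\<forall>x\<in>carrier A. r x \<le> C * p x" ..
    show ?thesis
    proof (rule tendsto_sandwich[OF _ _ tendsto_const])
      show "((\<lambda>y. C * p (diff A (f y) (f x))) \<longlongrightarrow> 0) (nhds x)"
        using tendsto_mult_right_zero[OF that(2)] .
    qed (use C that(1) in auto)
  qed
  then show ?thesis
    unfolding continuous_map_euclidean_iff using norm_cont by blast
qed

end

lemma normed_star_algebra_iff:
  "normed_star_algebra A q \<longleftrightarrow> star_algebra A \<and> cstar_seminorm A q \<and> topo A = seminorm_topology A {q}"
  by (auto simp: normed_star_algebra_def normed_star_algebra_axioms_def cstar_seminormed_def cstar_seminormed_axioms_def)

section \<open>Functions on a compact space\<close>

lemma tensor_C0_simps [simp]:
  "carrier (tensor_C0 A) = C0_carrier A"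
  "add (tensor_C0 A) g h = (\<lambda>x. g x \<oplus>\<^bsub>A\<^esub> h x)"
  "zero (tensor_C0 A) = (\<lambda>x. zero A)"
  "scale (tensor_C0 A) c h = (\<lambda>x. scale A c (h x))"
  "mult (tensor_C0 A) g h = (\<lambda>x. g x \<cdot>\<^bsub>A\<^esub> h x)"
  "star (tensor_C0 A) h = (\<lambda>x. star A (h x))"
  "diff (tensor_C0 A) g h = (\<lambda>x. diff A (g x) (h x))"
  by (simp_all add: tensor_C0_def C0_algebra0_def diff_def)

text \<open>A seminorm topology sees only carrier, addition and scaling, so the placeholder topology
  drops out and the topology can be described by the finished algebra itself.\<close>

lemma topo_tensor_C0:
  "topo (tensor_C0 A) = seminorm_topology (tensor_C0 A) (sup_seminorm ` cont_seminorms A)"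
  by (simp add: tensor_C0_def C0_algebra0_def seminorm_topology_def diff_def)

text \<open>On a compact space vanishing at infinity is witnessed by \<open>K = UNIV\<close>, and
  only continuity remains.\<close>

lemma C0_carrier_compact:
  assumes "compact (UNIV :: 'x::topological_space set)" "lc_star_algebra A"
  shows "C0_carrier A = {h :: 'x \<Rightarrow> 'a. continuous_map euclidean (topo A) h}"
proof -
  interpret lc_star_algebra A by fact
  show ?thesis
    using assms(1) by (auto simp: C0_carrier_def continuous_map_def intro!: exI[of _ UNIV])
qed

lemma C0_carrierD: "h \<in> C0_carrier A \<Longrightarrow> h x \<in> carrier A"
  by (auto simp: C0_carrier_def)

lemma tendsto_0_le:
  fixes f g :: "'a \<Rightarrow> real"
  assumes "(g \<longlongrightarrow> 0) F" "\<And>x. 0 \<le> f x" "\<And>x. f x \<le> g x"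
  shows "(f \<longlongrightarrow> 0) F"
  by (rule tendsto_sandwich[OF _ _ tendsto_const assms(1)]) (use assms in auto)

context lc_star_algebra
begin

lemma C0_carrier_iff:
  assumes "compact (UNIV :: 'x::topological_space set)"
  shows "h \<in> C0_carrier A \<longleftrightarrow> (\<forall>x::'x. h x \<in> carrier A) \<and>
    (\<forall>p\<in>cont_seminorms A. \<forall>x. ((\<lambda>y. p (diff A (h y) (h x))) \<longlongrightarrow> 0) (nhds x))"
  by (simp add: C0_carrier_compact[OF assms lc_star_algebra_axioms] continuous_map_euclidean_iff)

lemma C0_carrier_continuous:
  fixes h :: "'x::topological_space \<Rightarrow> 'a"
  assumes "h \<in> C0_carrier A" "p \<in> cont_seminorms A"
  shows "continuous_on UNIV (\<lambda>x. p (h x))"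
proof -
  have "continuous_map euclidean (topo A) h" "continuous_map (topo A) euclideanreal p"
    using assms by (auto simp: C0_carrier_def cont_seminorms_def)
  from continuous_map_compose[OF this] show ?thesis by (simp add: o_def)
qed

context
  assumes compact_UNIV: "compact (UNIV :: 'x::topological_space set)"
begin

lemma C0_carrier_bounded:
  fixes h :: "'x \<Rightarrow> 'a"
  assumes "h \<in> C0_carrier A" "p \<in> cont_seminorms A"
  shows "bdd_above (range (\<lambda>x. p (h x)))"
  by (rule bounded_imp_bdd_above[OF compact_imp_bounded[OF compact_continuous_image]])
     (use C0_carrier_continuous[OF assms] compact_UNIV in auto)

lemma le_sup_seminorm:
  fixes h :: "'x \<Rightarrow> 'a"
  assumes "h \<in> C0_carrier A" "p \<in> cont_seminorms A"
  shows "p (h x) \<le> sup_seminorm p h"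
  unfolding sup_seminorm_def by (rule cSUP_upper[OF _ C0_carrier_bounded[OF assms]]) simp

lemma tensor_C0_star_algebra: "star_algebra (tensor_C0 A :: ('x \<Rightarrow> 'a) talg)"
proof -
  have iff: "h \<in> C0_carrier A \<longleftrightarrow> (\<forall>x::'x. h x \<in> carrier A) \<and>
    (\<forall>p\<in>cont_seminorms A. \<forall>x. ((\<lambda>y. p (diff A (h y) (h x))) \<longlongrightarrow> 0) (nhds x))" for h
    by (rule C0_carrier_iff[OF compact_UNIV])
  have lim: "((\<lambda>y. p (diff A (h y) (h x))) \<longlongrightarrow> 0) (nhds x)"
    if "h \<in> C0_carrier A" "p \<in> cont_seminorms A" for h p and x :: 'x
    using that iff by blast
  have lim': "((\<lambda>y. p (h y)) \<longlongrightarrow> p (h x)) (nhds x)"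
    if "h \<in> C0_carrier A" "p \<in> cont_seminorms A" for h p and x :: 'x
  proof -
    have "((\<lambda>x. p (h x)) \<longlongrightarrow> p (h x)) (at x)"
      using C0_carrier_continuous[OF that] by (simp add: continuous_on_def)
    then show ?thesis by (simp add: tendsto_nhds_iff)
  qed
  have add: "(\<lambda>x. g x \<oplus> h x) \<in> C0_carrier A" if "g \<in> C0_carrier A" "h \<in> C0_carrier A" for g h :: "'x \<Rightarrow> 'a"
    unfolding iff
  proof (intro conjI allI ballI)
    fix p x assume p: "p \<in> cont_seminorms A"
    interpret cstar_seminormed A p using p by (rule cont_seminormed)
    show "((\<lambda>y. p (diff A (g y \<oplus> h y) (g x \<oplus> h x))) \<longlongrightarrow> 0) (nhds x)"
      by (rule tendsto_0_le[OF tendsto_add_zero[OF lim[OF that(1) p] lim[OF that(2) p]]])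
        (use C0_carrierD[OF that(1)] C0_carrierD[OF that(2)] in \<open>auto simp: diff_add intro!: subadd\<close>)
  qed (use C0_carrierD[OF that(1)] C0_carrierD[OF that(2)] in auto)
  have scale: "(\<lambda>x. scale A c (h x)) \<in> C0_carrier A" if "h \<in> C0_carrier A" for c and h :: "'x \<Rightarrow> 'a"
    unfolding iff
  proof (intro conjI allI ballI)
    fix p x assume p: "p \<in> cont_seminorms A"
    interpret cstar_seminormed A p using p by (rule cont_seminormed)
    show "((\<lambda>y. p (diff A (scale A c (h y)) (scale A c (h x)))) \<longlongrightarrow> 0) (nhds x)"
      by (rule tendsto_0_le[OF tendsto_mult_right_zero[OF lim[OF that p], of "cmod c"]])
        (use C0_carrierD[OF that] in \<open>auto simp: diff_scale homog\<close>)
  qed (use C0_carrierD[OF that] in auto)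
  have mult: "(\<lambda>x. g x \<cdot> h x) \<in> C0_carrier A" if "g \<in> C0_carrier A" "h \<in> C0_carrier A" for g h :: "'x \<Rightarrow> 'a"
    unfolding iff
  proof (intro conjI allI ballI)
    fix p x assume p: "p \<in> cont_seminorms A"
    interpret cstar_seminormed A p using p by (rule cont_seminormed)
    have "((\<lambda>y. p (diff A (g y) (g x)) * p (h y) + p (g x) * p (diff A (h y) (h x)))
        \<longlongrightarrow> 0 * p (h x) + p (g x) * 0) (nhds x)"
      by (intro tendsto_intros lim lim' that p)
    then show "((\<lambda>y. p (diff A (g y \<cdot> h y) (g x \<cdot> h x))) \<longlongrightarrow> 0) (nhds x)"
      by (intro tendsto_0_le[where f = "\<lambda>y. p (diff A (g y \<cdot> h y) (g x \<cdot> h x))"])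
        (use C0_carrierD[OF that(1)] C0_carrierD[OF that(2)] in \<open>auto intro!: diff_mult_bound\<close>)
  qed (use C0_carrierD[OF that(1)] C0_carrierD[OF that(2)] in auto)
  have star: "(\<lambda>x. star A (h x)) \<in> C0_carrier A" if "h \<in> C0_carrier A" for h :: "'x \<Rightarrow> 'a"
    unfolding iff
  proof (intro conjI allI ballI)
    fix p x assume p: "p \<in> cont_seminorms A"
    interpret cstar_seminormed A p using p by (rule cont_seminormed)
    show "((\<lambda>y. p (diff A (star A (h y)) (star A (h x)))) \<longlongrightarrow> 0) (nhds x)"
      using lim[OF that p] that C0_carrierD[of h A] by (simp add: diff_star)
  qed (use C0_carrierD[OF that] in auto)
  have zero: "(\<lambda>x::'x. \<zero>) \<in> C0_carrier A"
    unfolding iff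
  proof (intro conjI allI ballI)
    fix p x assume p: "p \<in> cont_seminorms A"
    interpret cstar_seminormed A p using p by (rule cont_seminormed)
    show "((\<lambda>y. p (diff A \<zero> \<zero>)) \<longlongrightarrow> 0) (nhds x)" by simp
  qed auto
  show ?thesis
    by unfold_locales (auto simp: add zero scale mult star add_assoc add_zero add_neg scale_one scale_scale
      scale_add_left scale_add_right mult_assoc distrib_left distrib_right scale_mult_left scale_mult_right
      star_add star_scale star_mult star_star C0_carrierD intro!: ext add_comm)
qed

lemma const_C0: "a \<in> carrier A \<Longrightarrow> (\<lambda>x::'x. a) \<in> C0_carrier A"
  by (simp add: C0_carrier_compact[OF compact_UNIV lc_star_algebra_axioms])

text \<open>Compactness makes the suprema finite. The C*-identity survives because squaring commutes
  with suprema of nonnegative numbers.\<close>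

lemma sup_seminorm_cstar:
  assumes p: "p \<in> cont_seminorms A"
  shows "cstar_seminorm (tensor_C0 A :: ('x \<Rightarrow> 'a) talg) (sup_seminorm p)"
proof -
  interpret cstar_seminormed A p using p by (rule cont_seminormed)
  interpret T: star_algebra "tensor_C0 A :: ('x \<Rightarrow> 'a) talg" by (rule tensor_C0_star_algebra)
  note le = le_sup_seminorm[OF _ p]
  have least: "sup_seminorm p h \<le> c" if "\<And>x. p (h x) \<le> c" for h :: "'x \<Rightarrow> 'a" and c
    unfolding sup_seminorm_def by (rule cSUP_least) (use that in auto)
  have nonneg: "0 \<le> sup_seminorm p h" if "h \<in> C0_carrier A" for h :: "'x \<Rightarrow> 'a"
    using le[OF that, of undefined] C0_carrierD[OF that, of undefined] by (meson nonneg order_trans)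
  have scale: "sup_seminorm p (\<lambda>x. scale A c (h x)) \<le> cmod c * sup_seminorm p h"
    if "h \<in> C0_carrier A" for h :: "'x \<Rightarrow> 'a" and c
    using that C0_carrierD[OF that] le[OF that] by (intro least) (simp add: homog mult_left_mono)
  show ?thesis
    unfolding cstar_seminorm_def tensor_C0_simps
  proof (intro conjI ballI allI)
    fix g h :: "'x \<Rightarrow> 'a" assume g: "g \<in> C0_carrier A" and h: "h \<in> C0_carrier A"
    have gc: "g x \<in> carrier A" and hc: "h x \<in> carrier A" for x using g h by (simp_all add: C0_carrierD)
    show "sup_seminorm p (\<lambda>x. g x \<oplus> h x) \<le> sup_seminorm p g + sup_seminorm p h"
      by (intro least order_trans[OF subadd[OF gc hc]] add_mono le g h)
    show "sup_seminorm p (\<lambda>x. g x \<cdot> h x) \<le> sup_seminorm p g * sup_seminorm p h"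
      by (intro least order_trans[OF submult[OF gc hc]] mult_mono le g h nonneg) (simp add: hc)
  next
    fix c and h :: "'x \<Rightarrow> 'a" assume h: "h \<in> C0_carrier A"
    show "sup_seminorm p (\<lambda>x. scale A c (h x)) = cmod c * sup_seminorm p h"
    proof (cases "c = 0")
      case True
      have "(\<lambda>x. scale A c (h x)) = (\<lambda>x. \<zero>)" using True C0_carrierD[OF h] by simp
      then show ?thesis by (simp add: True sup_seminorm_def)
    next
      case False
      have sc: "(\<lambda>x. scale A c (h x)) \<in> C0_carrier A" using T.scale_closed[of h c] h by simp
      \<comment> \<open>The inequality already shown, applied to the inverse scalar, yields the
        converse one.\<close>
      have "sup_seminorm p (\<lambda>x. scale A (1/c) (scale A c (h x))) \<le> cmod (1/c) * sup_seminorm p (\<lambda>x. scale A c (h x))"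
        by (rule scale[OF sc])
      then have "sup_seminorm p h \<le> sup_seminorm p (\<lambda>x. scale A c (h x)) / cmod c"
        using False C0_carrierD[OF h] by (simp add: scale_scale scale_one norm_divide)
      then show ?thesis using False scale[OF h, of c] by (simp add: field_simps)
    qed
  next
    fix h :: "'x \<Rightarrow> 'a" assume h: "h \<in> C0_carrier A"
    have hc: "h x \<in> carrier A" for x using h by (simp add: C0_carrierD)
    show "0 \<le> sup_seminorm p h" by (rule nonneg[OF h])
    have sh: "(\<lambda>x. star A (h x) \<cdot> h x) \<in> C0_carrier A"
      using T.mult_closed[OF T.star_closed, of h h] h by simp
    show "sup_seminorm p (\<lambda>x. star A (h x) \<cdot> h x) = (sup_seminorm p h)\<^sup>2"
    proof (rule antisym)
      show "sup_seminorm p (\<lambda>x. star A (h x) \<cdot> h x) \<le> (sup_seminorm p h)\<^sup>2"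
        by (rule least) (simp add: cstar_eq hc power_mono le[OF h])
      have "p (h x) \<le> sqrt (sup_seminorm p (\<lambda>x. star A (h x) \<cdot> h x))" for x
        using le[OF sh, of x] by (simp add: cstar_eq hc real_le_rsqrt)
      then have "sup_seminorm p h \<le> sqrt (sup_seminorm p (\<lambda>x. star A (h x) \<cdot> h x))"
        by (rule least)
      then show "(sup_seminorm p h)\<^sup>2 \<le> sup_seminorm p (\<lambda>x. star A (h x) \<cdot> h x)"
        using nonneg[OF h] nonneg[OF sh] by (metis power_mono real_sqrt_pow2)
    qed
  qed
qed

lemma sup_seminorm_le:
  fixes h :: "'x \<Rightarrow> 'a"
  shows "(\<And>x. p (h x) \<le> c) \<Longrightarrow> sup_seminorm p h \<le> c"
  unfolding sup_seminorm_def by (rule cSUP_least) auto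

lemma tensor_C0_lc: "lc_star_algebra (tensor_C0 A :: ('x \<Rightarrow> 'a) talg)"
  and sup_seminorm_cont: "p \<in> cont_seminorms A
    \<Longrightarrow> sup_seminorm p \<in> cont_seminorms (tensor_C0 A :: ('x \<Rightarrow> 'a) talg)"
proof -
  have *: "\<And>p. p \<in> sup_seminorm ` cont_seminorms A \<Longrightarrow> cstar_seminorm (tensor_C0 A :: ('x \<Rightarrow> 'a) talg) p"
    using sup_seminorm_cstar by auto
  note I = lc_star_algebraI[OF tensor_C0_star_algebra * topo_tensor_C0]
  show "lc_star_algebra (tensor_C0 A :: ('x \<Rightarrow> 'a) talg)" by (rule I(1))
  show "p \<in> cont_seminorms A \<Longrightarrow> sup_seminorm p \<in> cont_seminorms (tensor_C0 A :: ('x \<Rightarrow> 'a) talg)"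
    using I(2) by blast
qed

end
end

lemma tensor_C0_normed:
  assumes "compact (UNIV :: 'x::topological_space set)" "normed_star_algebra A q"
  shows "normed_star_algebra (tensor_C0 A :: ('x \<Rightarrow> 'a) talg) (sup_seminorm q)"
proof -
  interpret normed_star_algebra A q by fact
  interpret T: lc_star_algebra "tensor_C0 A :: ('x \<Rightarrow> 'a) talg" by (rule tensor_C0_lc[OF assms(1)])
  have "seminorm_topology (tensor_C0 A :: ('x \<Rightarrow> 'a) talg) (sup_seminorm ` cont_seminorms A) =
        seminorm_topology (tensor_C0 A) {sup_seminorm q}"
  proof (rule seminorm_topology_eqI[OF T.star_algebra_axioms])
    fix P :: "('x \<Rightarrow> 'a) \<Rightarrow> real" and e :: real assume P: "P \<in> sup_seminorm ` cont_seminorms A" and e: "e > 0"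
    then obtain p where p: "p \<in> cont_seminorms A" "P = sup_seminorm p" by blast
    \<comment> \<open>Half of \<open>e\<close>, since a strict bound at every point is only a weak
      bound for the supremum.\<close>
    obtain d where d: "d > 0" "\<forall>x\<in>carrier A. q x < d \<longrightarrow> p x < e / 2"
      using cont_seminorm_small[OF p(1), of "e / 2"] e by auto
    have "sup_seminorm p h < e" if h: "h \<in> C0_carrier A" "sup_seminorm q h < d" for h :: "'x \<Rightarrow> 'a"
    proof -
      have "q (h x) < d" for x
        using le_sup_seminorm[OF assms(1) h(1) norm_cont, of x] h(2) by simp
      then have "sup_seminorm p h \<le> e / 2"
        using d(2) C0_carrierD[OF h(1)] by (intro sup_seminorm_le[OF assms(1)]) (simp add: less_imp_le)
      then show ?thesis using e by simp
    qed
    then show "\<exists>F d. finite F \<and> F \<subseteq> {sup_seminorm q} \<and> 0 < d \<and>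
        (\<forall>x\<in>carrier (tensor_C0 A). (\<forall>r\<in>F. r x < d) \<longrightarrow> P x < e)"
      using d(1) p by (intro exI[of _ "{sup_seminorm q}"] exI[of _ d]) simp
  next
    fix P :: "('x \<Rightarrow> 'a) \<Rightarrow> real" and e :: real assume "P \<in> {sup_seminorm q}" "e > 0"
    then show "\<exists>F d. finite F \<and> F \<subseteq> sup_seminorm ` cont_seminorms A \<and> 0 < d \<and>
        (\<forall>x\<in>carrier (tensor_C0 A). (\<forall>r\<in>F. r x < d) \<longrightarrow> P x < e)"
      using norm_cont by (intro exI[of _ "{P}"] exI[of _ e]) auto
  qed
  then show ?thesis
    using T.star_algebra_axioms sup_seminorm_cstar[OF assms(1) norm_cont]
    by (simp add: normed_star_algebra_iff topo_tensor_C0)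
qed

section \<open>Multipliers\<close>

lemma mult_algebra_simps [simp]:
  "carrier (mult_algebra A) = multipliers A"
  "add (mult_algebra A) m n = (\<lambda>a\<in>carrier A. fst m a \<oplus>\<^bsub>A\<^esub> fst n a, \<lambda>a\<in>carrier A. snd m a \<oplus>\<^bsub>A\<^esub> snd n a)"
  "zero (mult_algebra A) = (\<lambda>a\<in>carrier A. zero A, \<lambda>a\<in>carrier A. zero A)"
  "scale (mult_algebra A) c m = (\<lambda>a\<in>carrier A. scale A c (fst m a), \<lambda>a\<in>carrier A. scale A c (snd m a))"
  "mult (mult_algebra A) m n = (\<lambda>a\<in>carrier A. fst m (fst n a), \<lambda>a\<in>carrier A. snd n (snd m a))"
  "star (mult_algebra A) m = (\<lambda>a\<in>carrier A. star A (snd m (star A a)), \<lambda>a\<in>carrier A. star A (fst m (star A a)))"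
  by (simp_all add: mult_algebra_def mult_algebra0_def)

lemma topo_mult_algebra:
  "topo (mult_algebra A) = seminorm_topology (mult_algebra A) (mult_seminorm A ` cont_seminorms A)"
  by (simp add: mult_algebra_def mult_algebra0_def seminorm_topology_def diff_def)

lemma diff_mult_algebra:
  "diff (mult_algebra A) m n = (\<lambda>a\<in>carrier A. diff A (fst m a) (fst n a), \<lambda>a\<in>carrier A. diff A (snd m a) (snd n a))"
  by (auto simp: diff_def)

text \<open>The algebraic half of \<open>multipliers\<close>. Keeping boundedness apart lets a
  single norm estimate for the left action supply all bounds over a normed algebra.\<close>

definition double_centralizers :: "('a, 'm) talg_scheme \<Rightarrow> 'a multiplier set" where
  "double_centralizers A = {(l, r).
    l \<in> carrier A \<rightarrow>\<^sub>E carrier A \<and> r \<in> carrier A \<rightarrow>\<^sub>E carrier A \<and>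
    linear_on A l \<and> linear_on A r \<and>
    (\<forall>a\<in>carrier A. \<forall>b\<in>carrier A.
      l (a \<cdot>\<^bsub>A\<^esub> b) = l a \<cdot>\<^bsub>A\<^esub> b \<and> r (a \<cdot>\<^bsub>A\<^esub> b) = a \<cdot>\<^bsub>A\<^esub> r b \<and> a \<cdot>\<^bsub>A\<^esub> l b = r a \<cdot>\<^bsub>A\<^esub> b)}"

lemma multipliers_iff:
  "m \<in> multipliers A \<longleftrightarrow> m \<in> double_centralizers A \<and>
    (\<forall>p\<in>cont_seminorms A. \<exists>C. \<forall>a\<in>carrier A. p (fst m a) \<le> C * p a \<and> p (snd m a) \<le> C * p a)"
  by (cases m) (simp add: multipliers_def double_centralizers_def)

lemma double_centralizersI:
  assumes "\<And>a. a \<in> carrier A \<Longrightarrow> l a \<in> carrier A" "\<And>a. a \<in> carrier A \<Longrightarrow> r a \<in> carrier A"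
    and "\<And>a b. \<lbrakk>a \<in> carrier A; b \<in> carrier A\<rbrakk> \<Longrightarrow> l (a \<oplus>\<^bsub>A\<^esub> b) = l a \<oplus>\<^bsub>A\<^esub> l b"
    and "\<And>a b. \<lbrakk>a \<in> carrier A; b \<in> carrier A\<rbrakk> \<Longrightarrow> r (a \<oplus>\<^bsub>A\<^esub> b) = r a \<oplus>\<^bsub>A\<^esub> r b"
    and "\<And>a c. a \<in> carrier A \<Longrightarrow> l (scale A c a) = scale A c (l a)"
    and "\<And>a c. a \<in> carrier A \<Longrightarrow> r (scale A c a) = scale A c (r a)"
    and "\<And>a b. \<lbrakk>a \<in> carrier A; b \<in> carrier A\<rbrakk> \<Longrightarrow> l (a \<cdot>\<^bsub>A\<^esub> b) = l a \<cdot>\<^bsub>A\<^esub> b"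
    and "\<And>a b. \<lbrakk>a \<in> carrier A; b \<in> carrier A\<rbrakk> \<Longrightarrow> r (a \<cdot>\<^bsub>A\<^esub> b) = a \<cdot>\<^bsub>A\<^esub> r b"
    and "\<And>a b. \<lbrakk>a \<in> carrier A; b \<in> carrier A\<rbrakk> \<Longrightarrow> a \<cdot>\<^bsub>A\<^esub> l b = r a \<cdot>\<^bsub>A\<^esub> b"
    and "star_algebra A"
  shows "(\<lambda>a\<in>carrier A. l a, \<lambda>a\<in>carrier A. r a) \<in> double_centralizers A"
  using assms by (auto simp: double_centralizers_def linear_on_def star_algebra.closed)

lemma double_centralizerD:
  assumes "m \<in> double_centralizers A" "a \<in> carrier A"
  shows dc_fst_closed: "fst m a \<in> carrier A" and dc_snd_closed: "snd m a \<in> carrier A"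
    and dc_fst_scale: "fst m (scale A c a) = scale A c (fst m a)"
    and dc_snd_scale: "snd m (scale A c a) = scale A c (snd m a)"
    and dc_fst_add: "b \<in> carrier A \<Longrightarrow> fst m (a \<oplus>\<^bsub>A\<^esub> b) = fst m a \<oplus>\<^bsub>A\<^esub> fst m b"
    and dc_snd_add: "b \<in> carrier A \<Longrightarrow> snd m (a \<oplus>\<^bsub>A\<^esub> b) = snd m a \<oplus>\<^bsub>A\<^esub> snd m b"
    and dc_fst_mult: "b \<in> carrier A \<Longrightarrow> fst m (a \<cdot>\<^bsub>A\<^esub> b) = fst m a \<cdot>\<^bsub>A\<^esub> b"
    and dc_snd_mult: "b \<in> carrier A \<Longrightarrow> snd m (a \<cdot>\<^bsub>A\<^esub> b) = a \<cdot>\<^bsub>A\<^esub> snd m b"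
  using assms by (auto simp: double_centralizers_def linear_on_def)

lemma dc_swap:
  assumes "m \<in> double_centralizers A" "a \<in> carrier A" "b \<in> carrier A"
  shows "a \<cdot>\<^bsub>A\<^esub> fst m b = snd m a \<cdot>\<^bsub>A\<^esub> b"
  using assms by (auto simp: double_centralizers_def)

lemma dc_fst_extensional: "m \<in> double_centralizers A \<Longrightarrow> fst m \<in> extensional (carrier A)"
  and dc_snd_extensional: "m \<in> double_centralizers A \<Longrightarrow> snd m \<in> extensional (carrier A)"
  by (auto simp: double_centralizers_def PiE_def)

lemma dc_diff:
  assumes "m \<in> double_centralizers A" "star_algebra A" "a \<in> carrier A" "b \<in> carrier A"
  shows dc_fst_diff: "fst m (diff A a b) = diff A (fst m a) (fst m b)"
    and dc_snd_diff: "snd m (diff A a b) = diff A (snd m a) (snd m b)"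
  using assms
  by (simp_all add: diff_def double_centralizerD[OF assms(1)] star_algebra.scale_closed)

lemma multiplier_dc: "m \<in> multipliers A \<Longrightarrow> m \<in> double_centralizers A"
  by (simp add: multipliers_iff)

lemmas multiplier_fst_closed = dc_fst_closed[OF multiplier_dc]
  and multiplier_snd_closed = dc_snd_closed[OF multiplier_dc]

section \<open>Operator seminorms on multipliers\<close>

context lc_star_algebra
begin

lemma multiplier_bound:
  assumes "m \<in> multipliers A" "p \<in> cont_seminorms A"
  shows "\<exists>C\<ge>0. \<forall>a\<in>carrier A. p (fst m a) \<le> C * p a \<and> p (snd m a) \<le> C * p a"
proof -
  interpret cstar_seminormed A p using assms(2) by (rule cont_seminormed)
  obtain C where C: "\<forall>a\<in>carrier A. p (fst m a) \<le> C * p a \<and> p (snd m a) \<le> C * p a"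
    using assms multipliers_iff by meson
  have "C * p a \<le> \<bar>C\<bar> * p a" if "a \<in> carrier A" for a
    using that by (intro mult_right_mono) auto
  then show ?thesis using C by (intro exI[of _ "\<bar>C\<bar>"]) (meson abs_ge_zero order_trans)
qed

lemma mult_seminorm_bdd:
  assumes "m \<in> multipliers A" "p \<in> cont_seminorms A"
  shows "bdd_above ((\<lambda>a. p (fst m a)) ` {a \<in> carrier A. p a \<le> 1})"
proof -
  obtain C where C: "C \<ge> 0" "\<And>a. a \<in> carrier A \<Longrightarrow> p (fst m a) \<le> C * p a"
    using multiplier_bound[OF assms] by meson
  have "p (fst m a) \<le> C" if "a \<in> carrier A" "p a \<le> 1" for a
    using C(2)[OF that(1)] mult_left_mono[OF that(2) C(1)] by simp
  then show ?thesis by (intro bdd_aboveI2[of _ _ C]) auto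
qed

text \<open>Normalizing a reduces the claim to the unit ball when p a > 0. On the kernel of p this
  is impossible, and there the boundedness clause forces p to vanish at the image as well.\<close>

lemma mult_seminorm_bound:
  assumes m: "m \<in> multipliers A" and p: "p \<in> cont_seminorms A" and a: "a \<in> carrier A"
  shows "p (fst m a) \<le> mult_seminorm A p m * p a"
proof -
  interpret cstar_seminormed A p using p by (rule cont_seminormed)
  note dc = double_centralizerD[OF multiplier_dc[OF m]]
  obtain C where C: "C \<ge> 0" "\<And>a. a \<in> carrier A \<Longrightarrow> p (fst m a) \<le> C * p a"
    using multiplier_bound[OF m p] by meson
  show ?thesis
  proof (cases "p a = 0")
    case True then show ?thesis using C(2)[OF a] by simp
  next
    case False
    then have pos: "p a > 0" using nonneg[OF a] by linarith
    let ?b = "scale A (complex_of_real (1 / p a)) a"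
    have b: "?b \<in> carrier A" "p ?b \<le> 1" using a pos by (simp_all add: homog norm_divide)
    have "p (fst m ?b) \<le> mult_seminorm A p m"
      unfolding mult_seminorm_def by (rule cSUP_upper[OF _ mult_seminorm_bdd[OF m p]]) (use b in simp)
    then show ?thesis using pos a by (simp add: dc homog norm_divide field_simps)
  qed
qed

lemma mult_seminorm_le:
  assumes p: "p \<in> cont_seminorms A" and C: "C \<ge> 0" "\<And>a. a \<in> carrier A \<Longrightarrow> p (fst m a) \<le> C * p a"
  shows "mult_seminorm A p m \<le> C"
  unfolding mult_seminorm_def
proof (rule cSUP_least)
  interpret cstar_seminormed A p using p by (rule cont_seminormed)
  have "\<zero> \<in> {a \<in> carrier A. p a \<le> 1}" by simp
  then show "{a \<in> carrier A. p a \<le> 1} \<noteq> {}" by blast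
  fix a assume "a \<in> {a \<in> carrier A. p a \<le> 1}"
  then show "p (fst m a) \<le> C" using C(2)[of a] mult_left_mono[of "p a" 1 C] C(1) by simp
qed

lemma mult_seminorm_nonneg:
  assumes m: "m \<in> multipliers A" and p: "p \<in> cont_seminorms A"
  shows "0 \<le> mult_seminorm A p m"
proof -
  interpret cstar_seminormed A p using p by (rule cont_seminormed)
  have "p (fst m \<zero>) \<le> mult_seminorm A p m"
    unfolding mult_seminorm_def by (rule cSUP_upper[OF _ mult_seminorm_bdd[OF m p]]) simp
  then show ?thesis using multiplier_fst_closed[OF m zero_closed] nonneg order_trans by blast
qed

lemma dc_star:
  assumes "m \<in> double_centralizers A"
  shows "star (mult_algebra A) m \<in> double_centralizers A"
  unfolding mult_algebra_simps
proof (rule double_centralizersI)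
  fix a b assume ab: "a \<in> carrier A" "b \<in> carrier A"
  note dc = double_centralizerD[OF assms]
  show "star A (snd m (star A (a \<cdot> b))) = star A (snd m (star A a)) \<cdot> b"
    using ab by (simp add: star_mult dc star_star)
  show "star A (fst m (star A (a \<cdot> b))) = a \<cdot> star A (fst m (star A b))"
    using ab by (simp add: star_mult dc star_star)
  show "a \<cdot> star A (snd m (star A b)) = star A (fst m (star A a)) \<cdot> b"
  proof -
    have "a \<cdot> star A (snd m (star A b)) = star A (snd m (star A b) \<cdot> star A a)"
      using ab by (simp add: star_mult dc star_star)
    also have "\<dots> = star A (star A b \<cdot> fst m (star A a))"
      using ab dc_swap[OF assms, of "star A b" "star A a"] by simp
    also have "\<dots> = star A (fst m (star A a)) \<cdot> b"
      using ab by (simp add: star_mult dc star_star)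
    finally show ?thesis .
  qed
qed (use assms in \<open>auto simp: double_centralizerD star_add star_scale star_algebra_axioms\<close>)

lemma mult_one_in: "mult_one A \<in> multipliers A"
proof -
  have "mult_one A \<in> double_centralizers A"
    unfolding mult_one_def by (rule double_centralizersI) (auto simp: star_algebra_axioms)
  then show ?thesis
    by (auto simp: multipliers_iff mult_one_def intro!: exI[of _ 1])
qed

lemma mult_embed_in:
  assumes a: "a \<in> carrier A"
  shows "mult_embed A a \<in> multipliers A"
proof -
  have "mult_embed A a \<in> double_centralizers A"
    unfolding mult_embed_def
    by (rule double_centralizersI)
      (auto simp: star_algebra_axioms a distrib_left distrib_right scale_mult_left scale_mult_right mult_assoc)
  moreover have "\<exists>C. \<forall>b\<in>carrier A. p (a \<cdot> b) \<le> C * p b \<and> p (b \<cdot> a) \<le> C * p b"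
    if p: "p \<in> cont_seminorms A" for p
  proof -
    interpret cstar_seminormed A p using p by (rule cont_seminormed)
    show ?thesis using a submult[of a] submult[of _ a] by (intro exI[of _ "p a"]) (auto simp: mult.commute)
  qed
  ultimately show ?thesis by (simp add: multipliers_iff mult_embed_def)
qed

lemma mult_embed_star_hom: "star_hom A (mult_algebra A) (mult_embed A)"
  by (rule star_homI)
    (auto simp: mult_embed_in, auto simp: mult_embed_def restrict_def fun_eq_iff distrib_left distrib_right
      scale_mult_left scale_mult_right mult_assoc star_mult star_star)

lemma mult_seminorm_embed_le:
  assumes "a \<in> carrier A" "p \<in> cont_seminorms A"
  shows "mult_seminorm A p (mult_embed A a) \<le> p a"
proof -
  interpret cstar_seminormed A p using assms(2) by (rule cont_seminormed)
  show ?thesis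
    by (rule mult_seminorm_le[OF assms(2)]) (use assms in \<open>auto simp: mult_embed_def submult\<close>)
qed

lemma continuous_map_mult_algebraI:
  assumes "lc_star_algebra B" "star_algebra C" "star_hom C (mult_algebra B) \<phi>"
    and "topo C = seminorm_topology C P"
    and "\<And>p. p \<in> cont_seminorms B \<Longrightarrow> \<exists>r\<in>P. \<forall>x\<in>carrier C. mult_seminorm B p (\<phi> x) \<le> r x"
  shows "continuous_map (topo C) (topo (mult_algebra B)) \<phi>"
  unfolding assms(4) topo_mult_algebra
proof (rule continuous_map_seminorm_topologyI)
  fix x p and e :: real assume x: "x \<in> carrier C" and p: "p \<in> mult_seminorm B ` cont_seminorms B" and e: "e > 0"
  obtain r where r: "r \<in> P" "\<forall>x\<in>carrier C. p (\<phi> x) \<le> r x" using assms(5) p by blast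
  show "\<exists>F d. finite F \<and> F \<subseteq> P \<and> 0 < d \<and>
      (\<forall>y\<in>carrier C. (\<forall>r\<in>F. r (diff C y x) < d) \<longrightarrow> p (diff (mult_algebra B) (\<phi> y) (\<phi> x)) < e)"
  proof (intro exI[of _ "{r}"] exI[of _ e] conjI ballI impI)
    fix y assume "y \<in> carrier C" "\<forall>r\<in>{r}. r (diff C y x) < e"
    then show "p (diff (mult_algebra B) (\<phi> y) (\<phi> x)) < e"
      using r x star_algebra.diff_closed[OF assms(2)]
      by (simp flip: star_hom_diff[OF assms(3,2)]) (meson order_le_less_trans)
  qed (use r e in auto)
qed (use star_hom_closed[OF assms(3)] in simp)

lemma mult_embed_morphism: "morphism A (mult_algebra A) (mult_embed A)"
  unfolding morphism_iff
  using mult_embed_star_hom continuous_map_mult_algebraI[OF lc_star_algebra_axioms star_algebra_axioms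
      mult_embed_star_hom topo_eq] mult_seminorm_embed_le by blast

text \<open>For x = a - b the test element e = x* gives x x* = 0, and by the C*-identity every
  continuous seminorm vanishes at x. Elements are recovered from their products in this way, without
  approximate units.\<close>

lemma mult_embed_inj:
  assumes faithful: "\<And>x. \<lbrakk>x \<in> carrier A; \<forall>p\<in>cont_seminorms A. p x = 0\<rbrakk> \<Longrightarrow> x = \<zero>"
    and "\<And>e. e \<in> carrier A \<Longrightarrow> a \<cdot> e = b \<cdot> e" "a \<in> carrier A" "b \<in> carrier A"
  shows "a = b"
proof -
  let ?x = "diff A a b"
  have "p ?x = 0" if p: "p \<in> cont_seminorms A" for p
  proof -
    interpret cstar_seminormed A p using p by (rule cont_seminormed)
    have "?x \<cdot> star A ?x = \<zero>"
      using assms by (simp flip: diff_mult_right)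
    then have "(p (star A ?x))\<^sup>2 = 0"
      using cstar_eq[of "star A ?x"] assms by (simp add: star_star)
    then show ?thesis using assms by simp
  qed
  then have "?x = \<zero>" using assms(3,4) by (intro faithful) auto
  then show ?thesis using assms(3,4) by (rule diff_eq_zeroD)
qed

end

text \<open>The sequence \<open>u\<close> is log-convex, so its growth rate is at least \<open>u 1 / u 0\<close>.\<close>

lemma log_convex_first_step:
  fixes u :: "nat \<Rightarrow> real"
  assumes nonneg: "\<And>n. 0 \<le> u n" and conv: "\<And>n. (u (Suc n))\<^sup>2 \<le> u n * u (Suc (Suc n))"
    and bound: "\<And>n. u n \<le> M * L ^ n" and L: "L \<ge> 0"
  shows "u 1 \<le> L * u 0"
proof (rule ccontr)
  assume "\<not> ?thesis"
  then have gt: "u 1 > L * u 0" by simp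
  then have u1: "u 1 > 0" using nonneg[of 0] L by (meson le_less_trans mult_nonneg_nonneg)
  have "u 0 \<noteq> 0"
  proof
    assume "u 0 = 0"
    then show False using conv[of 0] u1 by simp
  qed
  then have u0: "u 0 > 0" using nonneg[of 0] by linarith
  define \<rho> where "\<rho> = u 1 / u 0"
  have \<rho>: "\<rho> > L" "\<rho> > 0" using gt u0 u1 by (simp_all add: \<rho>_def field_simps)
  have step: "u n > 0 \<and> u (Suc n) \<ge> \<rho> * u n" for n
  proof (induction n)
    case 0 then show ?case using u0 by (simp add: \<rho>_def)
  next
    case (Suc n)
    then have pos: "u (Suc n) > 0" using \<rho>(2) by (meson less_le_trans mult_pos_pos)
    have "\<rho> * u (Suc n) * u n \<le> (u (Suc n))\<^sup>2"
      using Suc pos by (simp add: power2_eq_square mult_ac)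
    also have "\<dots> \<le> u (Suc (Suc n)) * u n" using conv[of n] by (simp add: mult.commute)
    finally have "\<rho> * u (Suc n) \<le> u (Suc (Suc n))" using Suc by simp
    then show ?case using pos by simp
  qed
  have low: "\<rho> ^ n * u 0 \<le> u n" for n
  proof (induction n)
    case (Suc n)
    have "\<rho> ^ Suc n * u 0 \<le> \<rho> * u n" using Suc \<rho>(2) by simp
    then show ?case using step[of n] by linarith
  qed simp
  show False
  proof (cases "L = 0")
    case True
    then show False using bound[of 1] u1 by simp
  next
    case False
    then have Lpos: "L > 0" using L by simp
    obtain n where "M / u 0 < (\<rho> / L) ^ n"
      using real_arch_pow[of "\<rho> / L" "M / u 0"] \<rho>(1) Lpos by auto
    then have "M * L ^ n < \<rho> ^ n * u 0" using u0 Lpos by (simp add: power_divide field_simps)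
    then show False using low[of n] bound[of n] by simp
  qed
qed

section \<open>Bounds for multipliers of a normed algebra\<close>

context normed_star_algebra
begin

text \<open>Put b = (a m)*. Then b* b = (a m) b = a (m b), so the square of p b is at most p a times
  K p b, and a factor p b cancels.\<close>

lemma dc_bound_snd:
  assumes m: "m \<in> double_centralizers A" and K: "K \<ge> 0"
    and b: "\<And>a. a \<in> carrier A \<Longrightarrow> p (fst m a) \<le> K * p a" and a: "a \<in> carrier A"
  shows "p (snd m a) \<le> K * p a"
proof -
  note dc = double_centralizerD[OF m]
  let ?b = "star A (snd m a)"
  have c: "?b \<in> carrier A" "snd m a \<in> carrier A" using a by (auto simp: dc)
  have "(p ?b)\<^sup>2 = p (snd m a \<cdot> ?b)"
    using cstar_eq[of ?b] c by (simp add: star_star)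
  also have "snd m a \<cdot> ?b = a \<cdot> fst m ?b" using a c by (simp add: dc_swap[OF m])
  also have "p \<dots> \<le> p a * (K * p ?b)"
    by (rule order_trans[OF submult]) (use a c b in \<open>auto simp: dc intro!: mult_left_mono simp del: p_star\<close>)
  finally have "p (snd m a) * p (snd m a) \<le> (K * p a) * p (snd m a)"
    using c by (simp add: power2_eq_square mult_ac)
  then show ?thesis using c nonneg[OF c(2)] K nonneg[OF a]
    by (cases "p (snd m a) = 0") auto
qed

text \<open>For a continuous C*-seminorm \<open>r\<close> only \<open>r \<le> C p\<close> is known; passing to the powers of \<open>m* m\<close> removes
  the constant \<open>C\<close>.\<close>

lemma dc_bound_fst:
  assumes m: "m \<in> double_centralizers A" and K: "K \<ge> 0"
    and b: "\<And>a. a \<in> carrier A \<Longrightarrow> p (fst m a) \<le> K * p a"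
    and r: "r \<in> cont_seminorms A" and a: "a \<in> carrier A"
  shows "r (fst m a) \<le> K * r a"
proof -
  interpret R: cstar_seminormed A r using r by (rule cont_seminormed)
  note dc = double_centralizerD[OF m]
  \<comment> \<open>\<open>T\<close> is x \<mapsto> m* m x, the left action of m* being y \<mapsto>
    (y* m)*.\<close>
  define T where "T x = star A (snd m (star A (fst m x)))" for x
  have T: "T x \<in> carrier A" if "x \<in> carrier A" for x using that by (simp add: T_def dc)
  \<comment> \<open>With the inner product <x, z> = x* z this is <m x, m z> = <x, T z>.\<close>
  have key: "star A (fst m x) \<cdot> fst m z = star A x \<cdot> T z" if "x \<in> carrier A" "z \<in> carrier A" for x z
  proof -
    have "star A x \<cdot> T z = star A (snd m (star A (fst m z)) \<cdot> x)"
      using that by (simp add: T_def star_mult dc)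
    also have "\<dots> = star A (star A (fst m z) \<cdot> fst m x)"
      using that by (simp add: dc_swap[OF m] dc)
    also have "\<dots> = star A (fst m x) \<cdot> fst m z"
      using that by (simp add: star_mult dc star_star)
    finally show ?thesis by simp
  qed
  \<comment> \<open>Self-adjointness of \<open>T\<close>: <T x, T x> = <x, T T x>.
    Submultiplicativity of r, in the role of Cauchy-Schwarz, turns it into log-convexity of
    \<open>u\<close>.\<close>
  have key2: "star A (T x) \<cdot> T x = star A x \<cdot> T (T x)" if "x \<in> carrier A" for x
  proof -
    have "star A (T x) \<cdot> T x = snd m (star A (fst m x)) \<cdot> T x"
      using that by (simp add: T_def star_star dc)
    also have "\<dots> = star A (fst m x) \<cdot> fst m (T x)"
      using that T by (simp add: dc_swap[OF m] dc)
    also have "\<dots> = star A x \<cdot> T (T x)" using key that T by simp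
    finally show ?thesis .
  qed
  define u where "u n = r ((T ^^ n) a)" for n
  have Tn: "(T ^^ n) a \<in> carrier A" for n using a T by (induction n) auto
  have conv: "(u (Suc n))\<^sup>2 \<le> u n * u (Suc (Suc n))" for n
  proof -
    let ?x = "(T ^^ n) a"
    have "(r (T ?x))\<^sup>2 = r (star A ?x \<cdot> T (T ?x))"
      using R.cstar_eq[of "T ?x"] T Tn key2 by simp
    also have "\<dots> \<le> r ?x * r (T (T ?x))" using R.submult[of "star A ?x" "T (T ?x)"] T Tn by simp
    finally show ?thesis by (simp add: u_def)
  qed
  have pT: "p (T x) \<le> K\<^sup>2 * p x" if x: "x \<in> carrier A" for x
  proof -
    have "p (T x) \<le> K * p (star A (fst m x))"
      using dc_bound_snd[OF m K b, of "star A (fst m x)"] x by (simp add: T_def dc)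
    also have "\<dots> \<le> K * (K * p x)" using x b[OF x] K by (simp add: dc mult_left_mono)
    finally show ?thesis by (simp add: power2_eq_square mult_ac)
  qed
  have pTn: "p ((T ^^ n) a) \<le> (K\<^sup>2) ^ n * p a" for n
  proof (induction n)
    case (Suc n)
    have "p ((T ^^ Suc n) a) \<le> K\<^sup>2 * p ((T ^^ n) a)" using pT[OF Tn[of n]] by simp
    also have "\<dots> \<le> K\<^sup>2 * ((K\<^sup>2) ^ n * p a)" using Suc by (intro mult_left_mono) auto
    finally show ?case by (simp add: mult_ac)
  qed simp
  obtain C where C: "C \<ge> 0" "\<forall>x\<in>carrier A. r x \<le> C * p x" using cont_seminorm_le[OF r] by blast
  \<comment> \<open>Growth along the powers of \<open>T\<close> is known for p. Passing to r costs
    the factor C once for all n, so it does not affect the growth rate.\<close>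
  have "u n \<le> (C * p a) * (K\<^sup>2) ^ n" for n
  proof -
    have "u n \<le> C * p ((T ^^ n) a)" using C Tn by (simp add: u_def)
    also have "\<dots> \<le> C * ((K\<^sup>2) ^ n * p a)" using C pTn by (intro mult_left_mono) auto
    finally show ?thesis by (simp add: mult_ac)
  qed
  then have "u 1 \<le> K\<^sup>2 * u 0"
    by (intro log_convex_first_step[where u = u, OF _ conv]) (auto simp: u_def Tn)
  then have T1: "r (T a) \<le> K\<^sup>2 * r a" by (simp add: u_def)
  have "(r (fst m a))\<^sup>2 = r (star A a \<cdot> T a)"
    using R.cstar_eq[of "fst m a"] key[of a a] a by (simp add: dc)
  also have "\<dots> \<le> r a * r (T a)" using R.submult[of "star A a" "T a"] a T by simp
  also have "\<dots> \<le> r a * (K\<^sup>2 * r a)" using T1 a by (intro mult_left_mono) auto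
  also have "\<dots> = (K * r a)\<^sup>2" by (simp add: power2_eq_square mult_ac)
  finally have sq: "(r (fst m a))\<^sup>2 \<le> (K * r a)\<^sup>2" .
  show ?thesis by (rule power2_le_imp_le[OF sq]) (use K a in simp)
qed

text \<open>Up to the isometric involution, the right action of m is the left action of m*, and
  \<open>dc_bound_snd\<close> gives m* the same norm bound.\<close>

lemma dc_bound_snd':
  assumes m: "m \<in> double_centralizers A" and K: "K \<ge> 0"
    and b: "\<And>a. a \<in> carrier A \<Longrightarrow> p (fst m a) \<le> K * p a"
    and r: "r \<in> cont_seminorms A" and a: "a \<in> carrier A"
  shows "r (snd m a) \<le> K * r a"
proof -
  interpret R: cstar_seminormed A r using r by (rule cont_seminormed)
  note dc = double_centralizerD[OF m]
  let ?m = "star (mult_algebra A) m"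
  have "p (fst ?m x) \<le> K * p x" if "x \<in> carrier A" for x
    using dc_bound_snd[OF m K b, of "star A x"] that by (simp add: dc)
  from dc_bound_fst[OF dc_star[OF m] K this r, of "star A a"] show ?thesis
    using a by (simp add: dc star_star)
qed

text \<open>Membership for \<open>pointwise_mult\<close> rests on this: one estimate of the left
  action in one norm replaces two estimates for every continuous seminorm.\<close>

lemma multiplier_normI:
  assumes "m \<in> double_centralizers A" "K \<ge> 0" "\<And>a. a \<in> carrier A \<Longrightarrow> p (fst m a) \<le> K * p a"
  shows "m \<in> multipliers A"
  unfolding multipliers_iff using assms(1) dc_bound_fst[OF assms] dc_bound_snd'[OF assms] by blast

lemma mult_seminorm_le_norm:
  assumes "m \<in> multipliers A" "r \<in> cont_seminorms A"
  shows "mult_seminorm A r m \<le> mult_seminorm A p m"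
  by (rule mult_seminorm_le[OF assms(2) mult_seminorm_nonneg[OF assms(1) norm_cont]])
    (rule dc_bound_fst[OF multiplier_dc[OF assms(1)] mult_seminorm_nonneg[OF assms(1) norm_cont]
       mult_seminorm_bound[OF assms(1) norm_cont] assms(2)])

end

section \<open>The multiplier algebra as a star algebra\<close>

context lc_star_algebra
begin

lemma mult_algebra_star_algebra: "star_algebra (mult_algebra A)"
proof -
  have add: "m \<oplus>\<^bsub>mult_algebra A\<^esub> n \<in> multipliers A" if m: "m \<in> multipliers A" and n: "n \<in> multipliers A" for m n
  proof -
    note dc = double_centralizerD[OF multiplier_dc[OF m]] double_centralizerD[OF multiplier_dc[OF n]]
    note sw = dc_swap[OF multiplier_dc[OF m]] dc_swap[OF multiplier_dc[OF n]]
    have "m \<oplus>\<^bsub>mult_algebra A\<^esub> n \<in> double_centralizers A"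
      unfolding mult_algebra_simps
      by (rule double_centralizersI)
        (auto simp: star_algebra_axioms dc sw add_ac scale_add_right distrib_left distrib_right)
    moreover have "\<exists>C. \<forall>a\<in>carrier A. p (fst m a \<oplus> fst n a) \<le> C * p a \<and> p (snd m a \<oplus> snd n a) \<le> C * p a"
      if p: "p \<in> cont_seminorms A" for p
    proof -
      interpret cstar_seminormed A p using p by (rule cont_seminormed)
      obtain C where C: "\<forall>a\<in>carrier A. p (fst m a) \<le> C * p a \<and> p (snd m a) \<le> C * p a"
        using multiplier_bound[OF m p] by meson
      obtain D where D: "\<forall>a\<in>carrier A. p (fst n a) \<le> D * p a \<and> p (snd n a) \<le> D * p a"
        using multiplier_bound[OF n p] by meson
      have "p (fst m a \<oplus> fst n a) \<le> (C + D) * p a \<and> p (snd m a \<oplus> snd n a) \<le> (C + D) * p a"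
        if a: "a \<in> carrier A" for a
        using subadd[of "fst m a" "fst n a"] subadd[of "snd m a" "snd n a"] bspec[OF C a] bspec[OF D a] a
        by (simp add: dc semiring_class.distrib_right)
      then show ?thesis by blast
    qed
    ultimately show ?thesis by (simp add: multipliers_iff)
  qed
  have scale: "scale (mult_algebra A) c m \<in> multipliers A" if m: "m \<in> multipliers A" for m c
  proof -
    note dc = double_centralizerD[OF multiplier_dc[OF m]]
    note sw = dc_swap[OF multiplier_dc[OF m]]
    have "scale (mult_algebra A) c m \<in> double_centralizers A"
      unfolding mult_algebra_simps
      by (rule double_centralizersI)
        (auto simp: star_algebra_axioms dc sw scale_add_right scale_scale scale_mult_left scale_mult_right mult.commute)
    moreover have "\<exists>C. \<forall>a\<in>carrier A. p (scale A c (fst m a)) \<le> C * p a \<and> p (scale A c (snd m a)) \<le> C * p a"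
      if p: "p \<in> cont_seminorms A" for p
    proof -
      interpret cstar_seminormed A p using p by (rule cont_seminormed)
      obtain C where C: "\<forall>a\<in>carrier A. p (fst m a) \<le> C * p a \<and> p (snd m a) \<le> C * p a"
        using multiplier_bound[OF m p] by meson
      have "p (scale A c (fst m a)) \<le> (cmod c * C) * p a \<and> p (scale A c (snd m a)) \<le> (cmod c * C) * p a"
        if a: "a \<in> carrier A" for a
        using C a by (simp add: dc homog mult_left_mono mult.assoc)
      then show ?thesis by blast
    qed
    ultimately show ?thesis by (simp add: multipliers_iff)
  qed
  have mult: "m \<cdot>\<^bsub>mult_algebra A\<^esub> n \<in> multipliers A" if m: "m \<in> multipliers A" and n: "n \<in> multipliers A" for m n
  proof -
    note dc = double_centralizerD[OF multiplier_dc[OF m]] double_centralizerD[OF multiplier_dc[OF n]]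
    note sw = dc_swap[OF multiplier_dc[OF m]] dc_swap[OF multiplier_dc[OF n]]
    have "m \<cdot>\<^bsub>mult_algebra A\<^esub> n \<in> double_centralizers A"
      unfolding mult_algebra_simps
      by (rule double_centralizersI) (auto simp: star_algebra_axioms dc sw)
    moreover have "\<exists>C. \<forall>a\<in>carrier A. p (fst m (fst n a)) \<le> C * p a \<and> p (snd n (snd m a)) \<le> C * p a"
      if p: "p \<in> cont_seminorms A" for p
    proof -
      obtain C where C: "C \<ge> 0" "\<forall>a\<in>carrier A. p (fst m a) \<le> C * p a \<and> p (snd m a) \<le> C * p a"
        using multiplier_bound[OF m p] by meson
      obtain D where D: "D \<ge> 0" "\<forall>a\<in>carrier A. p (fst n a) \<le> D * p a \<and> p (snd n a) \<le> D * p a"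
        using multiplier_bound[OF n p] by meson
      have "p (fst m (fst n a)) \<le> (C * D) * p a \<and> p (snd n (snd m a)) \<le> (C * D) * p a"
        if a: "a \<in> carrier A" for a
      proof
        have "p (fst m (fst n a)) \<le> C * p (fst n a)" using C(2) a by (simp add: dc)
        also have "\<dots> \<le> C * (D * p a)" using C(1) D(2) a by (intro mult_left_mono) auto
        finally show "p (fst m (fst n a)) \<le> (C * D) * p a" by (simp add: mult.assoc)
        have "p (snd n (snd m a)) \<le> D * p (snd m a)" using D(2) a by (simp add: dc)
        also have "\<dots> \<le> D * (C * p a)" using D(1) C(2) a by (intro mult_left_mono) auto
        finally show "p (snd n (snd m a)) \<le> (C * D) * p a" by (simp add: mult_ac)
      qed
      then show ?thesis by blast
    qed
    ultimately show ?thesis by (simp add: multipliers_iff)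
  qed
  have star: "star (mult_algebra A) m \<in> multipliers A" if m: "m \<in> multipliers A" for m
  proof -
    note dc = double_centralizerD[OF multiplier_dc[OF m]]
    have "\<exists>C. \<forall>a\<in>carrier A. p (star A (snd m (star A a))) \<le> C * p a \<and> p (star A (fst m (star A a))) \<le> C * p a"
      if p: "p \<in> cont_seminorms A" for p
    proof -
      interpret cstar_seminormed A p using p by (rule cont_seminormed)
      obtain C where C: "\<forall>a\<in>carrier A. p (fst m a) \<le> C * p a \<and> p (snd m a) \<le> C * p a"
        using multiplier_bound[OF m p] by meson
      have "p (star A (snd m (star A a))) \<le> C * p a \<and> p (star A (fst m (star A a))) \<le> C * p a"
        if a: "a \<in> carrier A" for a
        using C[THEN bspec, of "star A a"] a by (simp add: dc)
      then show ?thesis by blast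
    qed
    then show ?thesis using dc_star[OF multiplier_dc[OF m]] by (simp add: multipliers_iff)
  qed
  have zero: "zero (mult_algebra A) \<in> multipliers A"
  proof -
    \<comment> \<open>As 0 times the unit multiplier, zero is covered by closure under
      scaling.\<close>
    have eq: "zero (mult_algebra A) = scale (mult_algebra A) 0 (mult_one A)"
      by (auto simp: mult_one_def)
    show ?thesis unfolding eq by (rule scale[OF mult_one_in])
  qed
  note clo = add scale mult star zero
  note closed' = multiplier_fst_closed multiplier_snd_closed
  show ?thesis
  proof
    fix x y z and c d :: complex
    assume x: "x \<in> carrier (mult_algebra A)"
    note dx = double_centralizerD[OF multiplier_dc[OF x[simplified]]]
    \<comment> \<open>The axioms that return \<open>x\<close> itself need this: operations produce
      restricted functions, and the components of a multiplier are extensional.\<close>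
    have ex: "(\<lambda>a\<in>carrier A. fst x a, \<lambda>a\<in>carrier A. snd x a) = x"
      using dc_fst_extensional[OF multiplier_dc[OF x[simplified]]] dc_snd_extensional[OF multiplier_dc[OF x[simplified]]]
      by (simp add: extensional_restrict)
    show "x \<oplus>\<^bsub>mult_algebra A\<^esub> scale (mult_algebra A) (-1) x = zero (mult_algebra A)"
      and "x \<oplus>\<^bsub>mult_algebra A\<^esub> zero (mult_algebra A) = x"
      and "scale (mult_algebra A) 1 x = x"
      and "scale (mult_algebra A) c (scale (mult_algebra A) d x) = scale (mult_algebra A) (c * d) x"
      and "scale (mult_algebra A) (c + d) x = scale (mult_algebra A) c x \<oplus>\<^bsub>mult_algebra A\<^esub> scale (mult_algebra A) d x"
      and "star (mult_algebra A) (star (mult_algebra A) x) = x"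
      and "star (mult_algebra A) (scale (mult_algebra A) c x) = scale (mult_algebra A) (cnj c) (star (mult_algebra A) x)"
      using ex by (simp_all add: dx add_neg add_zero scale_one scale_scale scale_add_left star_star star_scale
        cong: restrict_cong)
    show "scale (mult_algebra A) c x \<in> carrier (mult_algebra A)" "star (mult_algebra A) x \<in> carrier (mult_algebra A)"
      using clo x by simp_all
    assume y: "y \<in> carrier (mult_algebra A)"
    note dy = double_centralizerD[OF multiplier_dc[OF y[simplified]]]
    show "x \<oplus>\<^bsub>mult_algebra A\<^esub> y \<in> carrier (mult_algebra A)" "x \<cdot>\<^bsub>mult_algebra A\<^esub> y \<in> carrier (mult_algebra A)"
      using clo x y by simp_all
    show "x \<oplus>\<^bsub>mult_algebra A\<^esub> y = y \<oplus>\<^bsub>mult_algebra A\<^esub> x"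
      and "scale (mult_algebra A) c (x \<oplus>\<^bsub>mult_algebra A\<^esub> y) = scale (mult_algebra A) c x \<oplus>\<^bsub>mult_algebra A\<^esub> scale (mult_algebra A) c y"
      and "scale (mult_algebra A) c x \<cdot>\<^bsub>mult_algebra A\<^esub> y = scale (mult_algebra A) c (x \<cdot>\<^bsub>mult_algebra A\<^esub> y)"
      and "x \<cdot>\<^bsub>mult_algebra A\<^esub> scale (mult_algebra A) c y = scale (mult_algebra A) c (x \<cdot>\<^bsub>mult_algebra A\<^esub> y)"
      and "star (mult_algebra A) (x \<oplus>\<^bsub>mult_algebra A\<^esub> y) = star (mult_algebra A) x \<oplus>\<^bsub>mult_algebra A\<^esub> star (mult_algebra A) y"
      and "star (mult_algebra A) (x \<cdot>\<^bsub>mult_algebra A\<^esub> y) = star (mult_algebra A) y \<cdot>\<^bsub>mult_algebra A\<^esub> star (mult_algebra A) x"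
      by (simp_all add: dx dy add_comm scale_add_right star_add star_star cong: restrict_cong)
    assume z: "z \<in> carrier (mult_algebra A)"
    note dz = double_centralizerD[OF multiplier_dc[OF z[simplified]]]
    show "x \<oplus>\<^bsub>mult_algebra A\<^esub> y \<oplus>\<^bsub>mult_algebra A\<^esub> z = x \<oplus>\<^bsub>mult_algebra A\<^esub> (y \<oplus>\<^bsub>mult_algebra A\<^esub> z)"
      and "x \<cdot>\<^bsub>mult_algebra A\<^esub> y \<cdot>\<^bsub>mult_algebra A\<^esub> z = x \<cdot>\<^bsub>mult_algebra A\<^esub> (y \<cdot>\<^bsub>mult_algebra A\<^esub> z)"
      and "x \<cdot>\<^bsub>mult_algebra A\<^esub> (y \<oplus>\<^bsub>mult_algebra A\<^esub> z) = x \<cdot>\<^bsub>mult_algebra A\<^esub> y \<oplus>\<^bsub>mult_algebra A\<^esub> x \<cdot>\<^bsub>mult_algebra A\<^esub> z"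
      and "(x \<oplus>\<^bsub>mult_algebra A\<^esub> y) \<cdot>\<^bsub>mult_algebra A\<^esub> z = x \<cdot>\<^bsub>mult_algebra A\<^esub> z \<oplus>\<^bsub>mult_algebra A\<^esub> y \<cdot>\<^bsub>mult_algebra A\<^esub> z"
      by (simp_all add: dx dy dz add_assoc cong: restrict_cong)
  qed (use clo in auto)
qed

end

section \<open>Morphisms between multiplier algebras\<close>

lemma normed_morphismI:
  assumes "normed_star_algebra A p" "normed_star_algebra B q" "star_hom A B \<phi>"
    and le: "\<And>x. x \<in> carrier A \<Longrightarrow> q (\<phi> x) \<le> p x"
  shows "morphism A B \<phi>"
proof -
  interpret A: normed_star_algebra A p by fact
  interpret B: normed_star_algebra B q by fact
  have "continuous_map (seminorm_topology A {p}) (seminorm_topology B {q}) \<phi>"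
  proof (rule continuous_map_seminorm_topologyI)
    fix x r and e :: real assume "x \<in> carrier A" "r \<in> {q}" "e > 0"
    moreover have "q (diff B (\<phi> y) (\<phi> x)) \<le> p (diff A y x)" if "y \<in> carrier A" "x \<in> carrier A" for y x
      using le[of "diff A y x"] that
      by (simp add: star_hom_diff[OF assms(3) A.star_algebra_axioms])
    ultimately show "\<exists>F d. finite F \<and> F \<subseteq> {p} \<and> 0 < d \<and>
       (\<forall>y\<in>carrier A. (\<forall>r\<in>F. r (diff A y x) < d) \<longrightarrow> r (diff B (\<phi> y) (\<phi> x)) < e)"
      by (intro exI[of _ "{p}"] exI[of _ e]) (auto intro: le_less_trans)
  qed (use star_hom_closed[OF assms(3)] in simp)
  then show ?thesis using assms(3) by (simp add: morphism_iff A.topo_norm B.topo_norm)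
qed

text \<open>Transport of a multiplier along an isomorphism \<open>\<phi>\<close>, whose inverse is
  to be supplied as \<open>\<psi>\<close>.\<close>

definition conj_mult :: "('b, 'n) talg_scheme \<Rightarrow> ('a \<Rightarrow> 'b) \<Rightarrow> ('b \<Rightarrow> 'a) \<Rightarrow> 'a multiplier \<Rightarrow> 'b multiplier" where
  "conj_mult B \<phi> \<psi> m = (\<lambda>b\<in>carrier B. \<phi> (fst m (\<psi> b)), \<lambda>b\<in>carrier B. \<phi> (snd m (\<psi> b)))"

text \<open>A continuous seminorm on B and its pullback along \<open>\<phi>\<close> correspond under
  the isomorphism. The operator seminorm of the conjugate is therefore bounded by that of m for the
  pullback, which gives continuity.\<close>

lemma conj_mult_morphism:
  assumes "lc_star_algebra A" "lc_star_algebra B" "morphism A B \<phi>" "morphism B A \<psi>"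
    and inv: "\<And>x. x \<in> carrier A \<Longrightarrow> \<psi> (\<phi> x) = x" "\<And>y. y \<in> carrier B \<Longrightarrow> \<phi> (\<psi> y) = y"
  shows "morphism (mult_algebra A) (mult_algebra B) (conj_mult B \<phi> \<psi>)"
proof -
  interpret A: lc_star_algebra A by fact
  interpret B: lc_star_algebra B by fact
  have h: "star_hom A B \<phi>" "star_hom B A \<psi>" using assms by (auto simp: morphism_iff)
  note hom = star_homD[OF h(1)] star_homD[OF h(2)]
  have in_mult: "conj_mult B \<phi> \<psi> m \<in> multipliers B" if m: "m \<in> multipliers A" for m
  proof -
    note dc = double_centralizerD[OF multiplier_dc[OF m]]
    have sw: "a \<cdot>\<^bsub>B\<^esub> \<phi> (fst m (\<psi> b)) = \<phi> (snd m (\<psi> a)) \<cdot>\<^bsub>B\<^esub> b" if "a \<in> carrier B" "b \<in> carrier B" for a b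
    proof -
      have "a \<cdot>\<^bsub>B\<^esub> \<phi> (fst m (\<psi> b)) = \<phi> (\<psi> a \<cdot>\<^bsub>A\<^esub> fst m (\<psi> b))"
        using that by (simp add: hom dc inv)
      also have "\<dots> = \<phi> (snd m (\<psi> a) \<cdot>\<^bsub>A\<^esub> \<psi> b)"
        using that by (simp add: hom dc_swap[OF multiplier_dc[OF m]])
      also have "\<dots> = \<phi> (snd m (\<psi> a)) \<cdot>\<^bsub>B\<^esub> b"
        using that by (simp add: hom dc inv)
      finally show ?thesis .
    qed
    have "conj_mult B \<phi> \<psi> m \<in> double_centralizers B"
      unfolding conj_mult_def
      by (rule double_centralizersI) (auto simp: B.star_algebra_axioms hom dc inv sw)
    moreover have "\<exists>C. \<forall>b\<in>carrier B. p (\<phi> (fst m (\<psi> b))) \<le> C * p b \<and> p (\<phi> (snd m (\<psi> b))) \<le> C * p b"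
      if p: "p \<in> cont_seminorms B" for p
    proof -
      have "p \<circ> \<phi> \<in> cont_seminorms A"
        using cont_seminorm_pullback[OF assms(3) A.star_algebra_axioms p] .
      then obtain C where "\<forall>a\<in>carrier A. (p \<circ> \<phi>) (fst m a) \<le> C * (p \<circ> \<phi>) a \<and> (p \<circ> \<phi>) (snd m a) \<le> C * (p \<circ> \<phi>) a"
        using A.multiplier_bound[OF m] by meson
      then have "\<forall>b\<in>carrier B. p (\<phi> (fst m (\<psi> b))) \<le> C * p b \<and> p (\<phi> (snd m (\<psi> b))) \<le> C * p b"
        using inv hom by fastforce
      then show ?thesis by blast
    qed
    ultimately show ?thesis by (simp add: multipliers_iff conj_mult_def)
  qed
  have sh: "star_hom (mult_algebra A) (mult_algebra B) (conj_mult B \<phi> \<psi>)"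
    by (rule star_homI, simp add: in_mult)
      (auto simp: conj_mult_def hom inv multiplier_fst_closed multiplier_snd_closed cong: restrict_cong)
  have "mult_seminorm B p (conj_mult B \<phi> \<psi> m) \<le> mult_seminorm A (p \<circ> \<phi>) m"
    if m: "m \<in> multipliers A" and p: "p \<in> cont_seminorms B" for m p
  proof (rule B.mult_seminorm_le[OF p])
    have p': "p \<circ> \<phi> \<in> cont_seminorms A"
      using cont_seminorm_pullback[OF assms(3) A.star_algebra_axioms p] .
    show "0 \<le> mult_seminorm A (p \<circ> \<phi>) m" by (rule A.mult_seminorm_nonneg[OF m p'])
    fix b assume "b \<in> carrier B"
    then show "p (fst (conj_mult B \<phi> \<psi> m) b) \<le> mult_seminorm A (p \<circ> \<phi>) m * p b"
      using A.mult_seminorm_bound[OF m p', of "\<psi> b"] by (simp add: conj_mult_def hom inv)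
  qed
  then have "\<exists>r\<in>mult_seminorm A ` cont_seminorms A. \<forall>m\<in>carrier (mult_algebra A). mult_seminorm B p (conj_mult B \<phi> \<psi> m) \<le> r m"
    if p: "p \<in> cont_seminorms B" for p
    using cont_seminorm_pullback[OF assms(3) A.star_algebra_axioms p] p
    by (intro bexI[of _ "mult_seminorm A (p \<circ> \<phi>)"]) auto
  then have "continuous_map (topo (mult_algebra A)) (topo (mult_algebra B)) (conj_mult B \<phi> \<psi>)"
    by (rule A.continuous_map_mult_algebraI[OF assms(2) A.mult_algebra_star_algebra sh topo_mult_algebra])
  with sh show ?thesis by (simp add: morphism_iff)
qed

text \<open>The amplification m \<mapsto> m \<otimes> 1 from M(A) to M(A \<otimes> C(X)).\<close>

definition pointwise_mult :: "('a, 'm) talg_scheme \<Rightarrow> 'a multiplier \<Rightarrow> ('x::topological_space \<Rightarrow> 'a) multiplier" where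
  "pointwise_mult A m = (\<lambda>h\<in>C0_carrier A. \<lambda>x. fst m (h x), \<lambda>h\<in>C0_carrier A. \<lambda>x. snd m (h x))"

lemma pointwise_mult_morphism:
  assumes cpt: "compact (UNIV :: 'x::topological_space set)" and "normed_star_algebra A p"
  shows "morphism (mult_algebra A) (mult_algebra (tensor_C0 A)) (pointwise_mult A :: _ \<Rightarrow> ('x \<Rightarrow> 'a) multiplier)"
proof -
  interpret normed_star_algebra A p by fact
  interpret T: normed_star_algebra "tensor_C0 A :: ('x \<Rightarrow> 'a) talg" "sup_seminorm p"
    by (rule tensor_C0_normed[OF assms])
  let ?E = "pointwise_mult A :: _ \<Rightarrow> ('x \<Rightarrow> 'a) multiplier"
  note le = le_sup_seminorm[OF cpt _ norm_cont]
  \<comment> \<open>A norm-bounded map that respects differences preserves continuity of h; both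
    components of a multiplier are of this kind.\<close>
  have comp: "(\<lambda>x. l (h x)) \<in> C0_carrier A"
    if h: "h \<in> C0_carrier A" and K: "\<And>a. a \<in> carrier A \<Longrightarrow> p (l a) \<le> K * p a"
      and cl: "\<And>a. a \<in> carrier A \<Longrightarrow> l a \<in> carrier A"
      and df: "\<And>a b. \<lbrakk>a \<in> carrier A; b \<in> carrier A\<rbrakk> \<Longrightarrow> l (diff A a b) = diff A (l a) (l b)" for l K and h :: "'x \<Rightarrow> 'a"
  proof -
    have hc: "h x \<in> carrier A" for x using h by (rule C0_carrierD)
    have "((\<lambda>y. p (diff A (l (h y)) (l (h x)))) \<longlongrightarrow> 0) (nhds x)" for x
    proof (rule tendsto_0_le)
      have "((\<lambda>y. p (diff A (h y) (h x))) \<longlongrightarrow> 0) (nhds x)"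
        using h by (simp add: C0_carrier_compact[OF cpt lc_star_algebra_axioms] continuous_map_norm_iff)
      then show "((\<lambda>y. K * p (diff A (h y) (h x))) \<longlongrightarrow> 0) (nhds x)"
        by (rule tendsto_mult_right_zero)
      show "p (diff A (l (h y)) (l (h x))) \<le> K * p (diff A (h y) (h x))" for y
        using K[of "diff A (h y) (h x)"] hc by (simp add: df)
    qed (simp add: cl hc)
    then show ?thesis
      using cl hc by (simp add: C0_carrier_compact[OF cpt lc_star_algebra_axioms] continuous_map_norm_iff)
  qed
  have c1: "(\<lambda>x. fst m (h x)) \<in> C0_carrier A" and c2: "(\<lambda>x. snd m (h x)) \<in> C0_carrier A"
    if m: "m \<in> multipliers A" and h: "h \<in> C0_carrier A" for m and h :: "'x \<Rightarrow> 'a"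
  proof -
    note dcm = multiplier_dc[OF m]
    note dc = double_centralizerD[OF dcm]
    have K: "mult_seminorm A p m \<ge> 0" by (rule mult_seminorm_nonneg[OF m norm_cont])
    note b1 = mult_seminorm_bound[OF m norm_cont]
    note b2 = dc_bound_snd[OF dcm K b1]
    show "(\<lambda>x. fst m (h x)) \<in> C0_carrier A" "(\<lambda>x. snd m (h x)) \<in> C0_carrier A"
      using comp[OF h b1] comp[OF h b2] dc dc_diff[OF dcm star_algebra_axioms] by auto
  qed
  have in_mult: "?E m \<in> multipliers (tensor_C0 A)"
    and bnd: "\<forall>h\<in>C0_carrier A. sup_seminorm p (fst (?E m) h) \<le> mult_seminorm A p m * sup_seminorm p h"
    if m: "m \<in> multipliers A" for m
  proof -
    note dcm = multiplier_dc[OF m]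
    note dc = double_centralizerD[OF dcm]
    let ?K = "mult_seminorm A p m"
    have K: "?K \<ge> 0" by (rule mult_seminorm_nonneg[OF m norm_cont])
    note b1 = mult_seminorm_bound[OF m norm_cont]
    have D: "?E m \<in> double_centralizers (tensor_C0 A)"
      unfolding pointwise_mult_def tensor_C0_simps(1)[symmetric]
      by (rule double_centralizersI)
        (auto simp: c1[OF m] c2[OF m] C0_carrierD dc dc_swap[OF dcm] T.star_algebra_axioms)
    show B: "\<forall>h\<in>C0_carrier A. sup_seminorm p (fst (?E m) h) \<le> ?K * sup_seminorm p h"
    proof
      fix h :: "'x \<Rightarrow> 'a" assume h: "h \<in> C0_carrier A"
      have "p (fst m (h x)) \<le> ?K * sup_seminorm p h" for x
        by (rule order_trans[OF b1[OF C0_carrierD[OF h]] mult_left_mono[OF le[OF h] K]])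
      then show "sup_seminorm p (fst (?E m) h) \<le> ?K * sup_seminorm p h"
        using h by (auto simp: pointwise_mult_def intro: sup_seminorm_le[OF cpt])
    qed
    show "?E m \<in> multipliers (tensor_C0 A)"
      by (rule T.multiplier_normI[OF D K]) (use B in simp)
  qed
  have sh: "star_hom (mult_algebra A) (mult_algebra (tensor_C0 A)) ?E"
    by (rule star_homI, simp add: in_mult)
      (use T.star_closed T.mult_closed in \<open>auto simp: pointwise_mult_def c1 c2 C0_carrierD multiplier_fst_closed multiplier_snd_closed cong: restrict_cong\<close>)
  have "mult_seminorm (tensor_C0 A) r (?E m) \<le> mult_seminorm A p m"
    if m: "m \<in> multipliers A" and r: "r \<in> cont_seminorms (tensor_C0 A)" for m r
    by (rule order_trans[OF T.mult_seminorm_le_norm[OF in_mult[OF m] r]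
          T.mult_seminorm_le[OF T.norm_cont mult_seminorm_nonneg[OF m norm_cont]]])
      (use bnd[OF m] in simp)
  then have "\<exists>s\<in>mult_seminorm A ` cont_seminorms A. \<forall>m\<in>carrier (mult_algebra A). mult_seminorm (tensor_C0 A) r (?E m) \<le> s m"
    if r: "r \<in> cont_seminorms (tensor_C0 A)" for r
    using norm_cont r by (intro bexI[of _ "mult_seminorm A p"]) auto
  then have "continuous_map (topo (mult_algebra A)) (topo (mult_algebra (tensor_C0 A))) ?E"
    by (rule continuous_map_mult_algebraI[OF T.lc_star_algebra_axioms mult_algebra_star_algebra sh topo_mult_algebra])
  with sh show ?thesis by (simp add: morphism_iff)
qed

section \<open>Functions of two variables\<close>

lemma tendsto_fst_nhds: "((\<lambda>z. fst z) \<longlongrightarrow> t) (nhds (t, s))"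
  and tendsto_snd_nhds: "((\<lambda>z. snd z) \<longlongrightarrow> s) (nhds (t, s))"
  by (auto simp: nhds_prod filterlim_fst filterlim_snd)

lemmas tendsto_pair_intros = tendsto_fst_nhds tendsto_snd_nhds tendsto_Pair tendsto_add tendsto_minus tendsto_uminus_nhds

context normed_star_algebra
begin

definition jointly_continuous :: "('x::topological_space \<Rightarrow> 'y::topological_space \<Rightarrow> 'a) \<Rightarrow> bool" where
  "jointly_continuous H \<longleftrightarrow> (\<forall>t s. H t s \<in> carrier A) \<and>
    (\<forall>t\<^sub>0 s\<^sub>0. ((\<lambda>z. p (diff A (H (fst z) (snd z)) (H t\<^sub>0 s\<^sub>0))) \<longlongrightarrow> 0) (nhds (t\<^sub>0, s\<^sub>0)))"

lemma C0_norm_iff: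
  assumes "compact (UNIV :: 'x::topological_space set)"
  shows "h \<in> C0_carrier A \<longleftrightarrow> (\<forall>x::'x. h x \<in> carrier A) \<and>
    (\<forall>x. ((\<lambda>y. p (diff A (h y) (h x))) \<longlongrightarrow> 0) (nhds x))"
  by (simp add: C0_carrier_compact[OF assms lc_star_algebra_axioms] continuous_map_norm_iff)

text \<open>Currying over compact spaces. From left to right, the triangle inequality passes through
  the value of \<open>H t\<^sub>0\<close> at the moving second argument. The converse needs
  compactness of the inner space, which makes the closeness of \<open>H t\<close> to
  \<open>H t\<^sub>0\<close> uniform in the second argument.\<close>

lemma C0_tensor_iff:
  fixes H :: "'x::topological_space \<Rightarrow> 'y::topological_space \<Rightarrow> 'a"
  assumes X: "compact (UNIV :: 'x set)" and Y: "compact (UNIV :: 'y set)"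
  shows "H \<in> C0_carrier (tensor_C0 A) \<longleftrightarrow> jointly_continuous H"
proof -
  interpret T: normed_star_algebra "tensor_C0 A :: ('y \<Rightarrow> 'a) talg" "sup_seminorm p"
    by (rule tensor_C0_normed[OF Y normed_star_algebra_axioms])
  note C0 = C0_norm_iff[OF Y]
  show ?thesis
  proof
    assume H: "H \<in> C0_carrier (tensor_C0 A)"
    then have Ht: "H t \<in> C0_carrier A" for t using C0_carrierD by fastforce
    then have c: "H t s \<in> carrier A" for t s by (rule C0_carrierD)
    have "((\<lambda>z. p (diff A (H (fst z) (snd z)) (H t\<^sub>0 s\<^sub>0))) \<longlongrightarrow> 0) (nhds (t\<^sub>0, s\<^sub>0))" for t\<^sub>0 s\<^sub>0
    proof (rule tendsto_0_le)
      have 1: "((\<lambda>t. sup_seminorm p (diff (tensor_C0 A) (H t) (H t\<^sub>0))) \<longlongrightarrow> 0) (nhds t\<^sub>0)"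
        using H T.C0_norm_iff[OF X] by blast
      have 2: "((\<lambda>s. p (diff A (H t\<^sub>0 s) (H t\<^sub>0 s\<^sub>0))) \<longlongrightarrow> 0) (nhds s\<^sub>0)"
        using Ht C0 by blast
      have f: "filterlim fst (nhds t\<^sub>0) (nhds (t\<^sub>0, s\<^sub>0))" "filterlim snd (nhds s\<^sub>0) (nhds (t\<^sub>0, s\<^sub>0))"
        by (auto simp: nhds_prod filterlim_fst filterlim_snd)
      show "((\<lambda>z. sup_seminorm p (diff (tensor_C0 A) (H (fst z)) (H t\<^sub>0)) + p (diff A (H t\<^sub>0 (snd z)) (H t\<^sub>0 s\<^sub>0))) \<longlongrightarrow> 0) (nhds (t\<^sub>0, s\<^sub>0))"
        by (rule tendsto_add_zero[OF filterlim_compose[OF 1 f(1)] filterlim_compose[OF 2 f(2)]])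
      fix z :: "'x \<times> 'y"
      have "diff (tensor_C0 A) (H (fst z)) (H t\<^sub>0) \<in> C0_carrier A"
        using T.diff_closed[of "H (fst z)" "H t\<^sub>0"] Ht by simp
      from le_sup_seminorm[OF Y this norm_cont, of "snd z"]
      show "p (diff A (H (fst z) (snd z)) (H t\<^sub>0 s\<^sub>0)) \<le>
        sup_seminorm p (diff (tensor_C0 A) (H (fst z)) (H t\<^sub>0)) + p (diff A (H t\<^sub>0 (snd z)) (H t\<^sub>0 s\<^sub>0))"
        using p_diff_triangle[of "H (fst z) (snd z)" "H t\<^sub>0 (snd z)" "H t\<^sub>0 s\<^sub>0"] c by simp
    qed (use c in auto)
    with c show "jointly_continuous H" by (simp add: jointly_continuous_def)
  next
    assume H: "jointly_continuous H"
    then have c: "H t s \<in> carrier A" for t s by (simp add: jointly_continuous_def)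
    have lim: "((\<lambda>z. p (diff A (H (fst z) (snd z)) (H t s))) \<longlongrightarrow> 0) (nhds (t, s))" for t s
      using H by (simp add: jointly_continuous_def)
    have f: "filterlim (\<lambda>s. (t, s)) (nhds (t, s\<^sub>0)) (nhds s\<^sub>0)" for t :: 'x and s\<^sub>0 :: 'y
      by (intro tendsto_intros filterlim_ident)
    have Ht: "H t \<in> C0_carrier A" for t
      unfolding C0 using c filterlim_compose[OF lim f] by auto
    have "((\<lambda>t. sup_seminorm p (diff (tensor_C0 A) (H t) (H t\<^sub>0))) \<longlongrightarrow> 0) (nhds t\<^sub>0)" for t\<^sub>0
    proof (rule tendstoI)
      fix e :: real assume e: "e > 0"
      \<comment> \<open>A real function to which the tube argument applies: it is continuous and
        vanishes on the slice over \<open>t\<^sub>0\<close>, so near that slice it stays below e/2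
        uniformly in the second variable.\<close>
      define fx where "fx z = p (diff A (H (fst z) (snd z)) (H t\<^sub>0 (snd z)))" for z
      have "(fx \<longlongrightarrow> fx (t, s)) (nhds (t, s))" for t s
      proof (rule Lim_null[THEN iffD2], rule Lim_null_comparison[OF always_eventually])
        have f2: "filterlim (\<lambda>z. (t\<^sub>0, snd z)) (nhds (t\<^sub>0, s)) (nhds (t, s))"
          using filterlim_compose[OF f filterlim_snd, of t\<^sub>0 s "nhds t"] by (simp add: nhds_prod)
        show "((\<lambda>z. p (diff A (H (fst z) (snd z)) (H t s)) + p (diff A (H t\<^sub>0 (snd z)) (H t\<^sub>0 s))) \<longlongrightarrow> 0) (nhds (t, s))"
          using tendsto_add_zero[OF lim filterlim_compose[OF lim f2]] by simp
        show "\<forall>z. norm (fx z - fx (t, s)) \<le> p (diff A (H (fst z) (snd z)) (H t s)) + p (diff A (H t\<^sub>0 (snd z)) (H t\<^sub>0 s))"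
        proof
          fix z :: "'x \<times> 'y"
          let ?a = "H (fst z) (snd z)" and ?b = "H t\<^sub>0 (snd z)" and ?c = "H t s" and ?d = "H t\<^sub>0 s"
          have "p (diff A ?a ?b) \<le> p (diff A ?a ?c) + p (diff A ?c ?d) + p (diff A ?d ?b)"
            using p_diff_triangle[of ?a ?c ?b] p_diff_triangle[of ?c ?d ?b] c by simp
          moreover have "p (diff A ?c ?d) \<le> p (diff A ?c ?a) + p (diff A ?a ?b) + p (diff A ?b ?d)"
            using p_diff_triangle[of ?c ?a ?d] p_diff_triangle[of ?a ?b ?d] c by simp
          ultimately show "norm (fx z - fx (t, s)) \<le> p (diff A ?a ?c) + p (diff A ?b ?d)"
            using p_diff_commute[of ?c ?a] p_diff_commute[of ?d ?b] c by (simp add: fx_def abs_le_iff)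
        qed
      qed
      then have "(fx \<longlongrightarrow> fx z) (at z within UNIV \<times> UNIV)" for z
        by (cases z) (metis UNIV_Times_UNIV tendsto_nhds_iff)
      then have cont: "continuous_on (UNIV \<times> UNIV) fx"
        unfolding continuous_on_def by blast
      obtain X0 where X0: "t\<^sub>0 \<in> X0" "open X0" "\<forall>x\<in>X0 \<inter> UNIV. \<forall>t\<in>UNIV. dist (fx (x, t)) (fx (t\<^sub>0, t)) \<le> e / 2"
        by (rule continuous_on_prod_compactE[OF cont Y UNIV_I, of "e / 2" t\<^sub>0]) (use e in simp)
      have "dist (sup_seminorm p (diff (tensor_C0 A) (H t) (H t\<^sub>0))) 0 < e" if t: "t \<in> X0" for t
      proof -
        have "dist (fx (t, s)) (fx (t\<^sub>0, s)) \<le> e / 2" for s using X0(3) t by blast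
        then have "p (diff A (H t s) (H t\<^sub>0 s)) \<le> e / 2" for s
          using c by (simp add: fx_def dist_real_def)
        then have "sup_seminorm p (diff (tensor_C0 A) (H t) (H t\<^sub>0)) \<le> e / 2"
          by (intro sup_seminorm_le[OF Y]) simp
        moreover have "0 \<le> sup_seminorm p (diff (tensor_C0 A) (H t) (H t\<^sub>0))"
          by (rule T.nonneg, rule T.diff_closed) (use Ht in auto)
        ultimately show ?thesis using e by simp
      qed
      then show "\<forall>\<^sub>F t in nhds t\<^sub>0. dist (sup_seminorm p (diff (tensor_C0 A) (H t) (H t\<^sub>0))) 0 < e"
        unfolding eventually_nhds using X0 by blast
    qed
    with Ht show "H \<in> C0_carrier (tensor_C0 A)"
      unfolding T.C0_norm_iff[OF X] by simp
  qed
qed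

lemma jointly_continuous_comp:
  assumes "jointly_continuous H" "\<And>t s. filterlim f (nhds (f (t, s))) (nhds (t, s))"
  shows "jointly_continuous (\<lambda>t s. H (fst (f (t, s))) (snd (f (t, s))))"
  unfolding jointly_continuous_def
proof (intro conjI allI)
  show "H (fst (f (t, s))) (snd (f (t, s))) \<in> carrier A" for t s
    using assms(1) by (simp add: jointly_continuous_def)
  fix t s
  have "((\<lambda>z. p (diff A (H (fst z) (snd z)) (H (fst (f (t, s))) (snd (f (t, s)))))) \<longlongrightarrow> 0)
      (nhds (fst (f (t, s)), snd (f (t, s))))"
    using assms(1) unfolding jointly_continuous_def by blast
  then show "((\<lambda>z. p (diff A (H (fst (f (fst z, snd z))) (snd (f (fst z, snd z))))
      (H (fst (f (t, s))) (snd (f (t, s)))))) \<longlongrightarrow> 0) (nhds (t, s))"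
    using filterlim_compose[OF _ assms(2)] by simp
qed

end

section \<open>Actions by isometric automorphisms\<close>

lemma carrier_C0_iff:
  assumes "compact (UNIV :: 'x::topological_space set)"
  shows "f \<in> carrier C0 \<longleftrightarrow> continuous_on UNIV (f :: 'x \<Rightarrow> complex)"
  using assms by (auto simp: C0_carrier_def complex_talg_def intro!: exI[of _ UNIV])

section \<open>Functions in C(X, A) as multipliers\<close>

context lc_star_algebra
begin

lemma C0_carrier_scale:
  assumes cpt: "compact (UNIV :: 'x::topological_space set)"
    and h: "h \<in> C0_carrier A" and f: "f \<in> carrier C0"
  shows "(\<lambda>x::'x. scale A (f x) (h x)) \<in> C0_carrier A"
  unfolding C0_carrier_iff[OF cpt]
proof (intro conjI allI ballI)
  have c: "h x \<in> carrier A" for x using h by (rule C0_carrierD)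
  then show "scale A (f x) (h x) \<in> carrier A" for x by simp
  fix p x assume p: "p \<in> cont_seminorms A"
  interpret cstar_seminormed A p using p by (rule cont_seminormed)
  have lf: "(f \<longlongrightarrow> f x) (nhds x)"
    using f carrier_C0_iff[OF cpt] by (simp add: continuous_on_def tendsto_nhds_iff)
  have lh: "((\<lambda>x. p (h x)) \<longlongrightarrow> p (h x)) (nhds x)"
    using C0_carrier_continuous[OF h p] by (simp add: continuous_on_def tendsto_nhds_iff)
  have l: "((\<lambda>y. p (diff A (h y) (h x))) \<longlongrightarrow> 0) (nhds x)"
    using h p C0_carrier_iff[OF cpt] by blast
  show "((\<lambda>y. p (diff A (scale A (f y) (h y)) (scale A (f x) (h x)))) \<longlongrightarrow> 0) (nhds x)"
  proof (rule tendsto_0_le)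
    have "((\<lambda>y. cmod (f y - f x) * p (h y) + cmod (f x) * p (diff A (h y) (h x))) \<longlongrightarrow>
      cmod (f x - f x) * p (h x) + cmod (f x) * 0) (nhds x)"
      by (intro tendsto_intros lf lh l)
    then show "((\<lambda>y. cmod (f y - f x) * p (h y) + cmod (f x) * p (diff A (h y) (h x))) \<longlongrightarrow> 0) (nhds x)"
      by simp
    fix y
    show "p (diff A (scale A (f y) (h y)) (scale A (f x) (h x))) \<le> cmod (f y - f x) * p (h y) + cmod (f x) * p (diff A (h y) (h x))"
      using p_diff_triangle[of "scale A (f y) (h y)" "scale A (f x) (h y)" "scale A (f x) (h x)"] c
      by (simp add: diff_scale diff_scale_left homog)
  qed (use c in auto)
qed

lemma elem_tensor_C0:
  assumes "compact (UNIV :: 'x::topological_space set)" "a \<in> carrier A" "f \<in> carrier C0"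
  shows "(elem_tensor A a f :: 'x \<Rightarrow> 'a) \<in> C0_carrier A"
  unfolding elem_tensor_def by (rule C0_carrier_scale[OF assms(1) const_C0[OF assms(1,2)] assms(3)])

text \<open>Both multipliers are tested on constant functions, which are available on a compact
  space. Evaluation at t leaves a question about products in A, settled by
  \<open>mult_embed_inj\<close>.\<close>

lemma tensor_embed_inj:
  assumes cpt: "compact (UNIV :: 'x::topological_space set)"
    and faithful: "\<And>x. \<lbrakk>x \<in> carrier A; \<forall>p\<in>cont_seminorms A. p x = 0\<rbrakk> \<Longrightarrow> x = \<zero>"
    and g: "g \<in> C0_carrier A" and h: "h \<in> C0_carrier A"
    and eq: "mult_embed (tensor_C0 A) g = mult_embed (tensor_C0 A) (h :: 'x \<Rightarrow> 'a)"
  shows "g = h"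
proof
  fix t
  have "g t \<cdot> e = h t \<cdot> e" if "e \<in> carrier A" for e
    using fun_cong[OF fun_cong[OF arg_cong[OF eq, of fst], of "\<lambda>_. e"], of t] const_C0[OF cpt that]
    by (simp add: mult_embed_def)
  then show "g t = h t"
    using C0_carrierD[OF g] C0_carrierD[OF h]
    by (rule mult_embed_inj[rotated]) (assumption | rule faithful)+
qed

lemma embed_mult_tensor:
  assumes cpt: "compact (UNIV :: 'x::topological_space set)"
    and h: "h \<in> C0_carrier A" and f: "f \<in> carrier C0"
  shows "mult_embed (tensor_C0 A) h \<cdot>\<^bsub>mult_algebra (tensor_C0 A)\<^esub> mult_tensor A (mult_one A) f
      = mult_embed (tensor_C0 A) (\<lambda>x::'x. scale A (f x) (h x))"
    and "mult_tensor A (mult_one A) f \<cdot>\<^bsub>mult_algebra (tensor_C0 A)\<^esub> mult_embed (tensor_C0 A) h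
      = mult_embed (tensor_C0 A) (\<lambda>x::'x. scale A (f x) (h x))"
proof -
  interpret T: star_algebra "tensor_C0 A :: ('x \<Rightarrow> 'a) talg" by (rule tensor_C0_star_algebra[OF cpt])
  have m: "(\<lambda>x. g x \<cdot> h x) \<in> C0_carrier A" "(\<lambda>x. h x \<cdot> g x) \<in> C0_carrier A" if "g \<in> C0_carrier A" for g :: "'x \<Rightarrow> 'a"
    using T.mult_closed[of g h] T.mult_closed[of h g] that h by simp_all
  show "mult_embed (tensor_C0 A) h \<cdot>\<^bsub>mult_algebra (tensor_C0 A)\<^esub> mult_tensor A (mult_one A) f
      = mult_embed (tensor_C0 A) (\<lambda>x::'x. scale A (f x) (h x))"
    and "mult_tensor A (mult_one A) f \<cdot>\<^bsub>mult_algebra (tensor_C0 A)\<^esub> mult_embed (tensor_C0 A) h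
      = mult_embed (tensor_C0 A) (\<lambda>x::'x. scale A (f x) (h x))"
    using h by (auto simp: mult_embed_def mult_tensor_def mult_one_def C0_carrierD m C0_carrier_scale[OF cpt _ f]
        scale_mult_left scale_mult_right cong: restrict_cong)
qed

lemma mult_embed_in_mult_rel:
  assumes cpt: "compact (UNIV :: 'x::topological_space set)" and h: "h \<in> C0_carrier A"
  shows "mult_embed (tensor_C0 A) (h :: 'x \<Rightarrow> 'a) \<in> mult_rel A"
proof -
  interpret T: lc_star_algebra "tensor_C0 A :: ('x \<Rightarrow> 'a) talg" by (rule tensor_C0_lc[OF cpt])
  show ?thesis
    unfolding mult_rel_def
    using T.mult_embed_in[of h] h embed_mult_tensor[OF cpt h] C0_carrier_scale[OF cpt h] by simp
qed

end

text \<open>The structure that a completion at an invariant seminorm inherits.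
  \<open>\<beta> s\<close> after \<open>\<beta> t\<close> is \<open>\<beta> (t + s)\<close>, in this
  order, because the flip exchanges the arguments of the comultiplication; G may be
  noncommutative.\<close>

locale isometric_action = normed_star_algebra +
  fixes \<beta> :: "'g::topological_group_add \<Rightarrow> 'a \<Rightarrow> 'a"
  assumes compact_group: "compact (UNIV :: 'g set)"
    and hom: "star_hom A A (\<beta> t)"
    and act_zero: "a \<in> carrier A \<Longrightarrow> \<beta> 0 a = a"
    and act_act: "a \<in> carrier A \<Longrightarrow> \<beta> s (\<beta> t a) = \<beta> (t + s) a"
    and isometric: "a \<in> carrier A \<Longrightarrow> p (\<beta> t a) = p a"
    and act_continuous: "a \<in> carrier A \<Longrightarrow> ((\<lambda>y. p (diff A (\<beta> y a) (\<beta> x a))) \<longlongrightarrow> 0) (nhds x)"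
    and definite: "\<lbrakk>a \<in> carrier A; p a = 0\<rbrakk> \<Longrightarrow> a = \<zero>"
begin

abbreviation "X \<equiv> tensor_C0 A :: ('g \<Rightarrow> 'a) talg"
abbreviation "Y \<equiv> tensor_C0 (tensor_C0 A) :: ('g \<Rightarrow> 'g \<Rightarrow> 'a) talg"

lemma normX: "normed_star_algebra X (sup_seminorm p)"
  by (rule tensor_C0_normed[OF compact_group normed_star_algebra_axioms])

sublocale X: normed_star_algebra X "sup_seminorm p" by (rule normX)

lemma normY: "normed_star_algebra Y (sup_seminorm (sup_seminorm p))"
  by (rule tensor_C0_normed[OF compact_group normX])

sublocale Y: normed_star_algebra Y "sup_seminorm (sup_seminorm p)" by (rule normY)

lemmas act_hom = star_homD[OF hom]

lemma act_inv: "a \<in> carrier A \<Longrightarrow> \<beta> t (\<beta> (- t) a) = a" "a \<in> carrier A \<Longrightarrow> \<beta> (- t) (\<beta> t a) = a"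
  by (simp_all add: act_act act_zero)

lemma act_diff: "\<lbrakk>a \<in> carrier A; b \<in> carrier A\<rbrakk> \<Longrightarrow> \<beta> t (diff A a b) = diff A (\<beta> t a) (\<beta> t b)"
  by (rule star_hom_diff[OF hom star_algebra_axioms])

text \<open>Isometry frees the first term from t. Continuity of the orbit of one element then
  suffices for continuity in the group variable and the algebra variable together.\<close>

lemma act_diff_bound:
  assumes "a \<in> carrier A" "b \<in> carrier A"
  shows "p (diff A (\<beta> t a) (\<beta> s b)) \<le> p (diff A a b) + p (diff A (\<beta> t b) (\<beta> s b))"
proof -
  have "p (diff A (\<beta> t a) (\<beta> s b)) \<le> p (diff A (\<beta> t a) (\<beta> t b)) + p (diff A (\<beta> t b) (\<beta> s b))"
    using assms by (intro p_diff_triangle) (auto simp: act_hom)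
  then show ?thesis using assms by (simp add: act_diff[symmetric] isometric)
qed

definition orbit :: "'a \<Rightarrow> 'g \<Rightarrow> 'a" where "orbit a = (\<lambda>t. \<beta> t a)"

lemma orbit_in: "a \<in> carrier A \<Longrightarrow> orbit a \<in> C0_carrier A"
  by (simp add: C0_norm_iff[OF compact_group] orbit_def act_hom act_continuous)

lemma orbit_morphism: "morphism A X orbit"
proof (rule normed_morphismI[OF normed_star_algebra_axioms normX])
  show "star_hom A X orbit"
    by (rule star_homI) (auto simp: orbit_in, auto simp: orbit_def act_hom)
  show "sup_seminorm p (orbit x) \<le> p x" if "x \<in> carrier A" for x
    using that by (intro sup_seminorm_le[OF compact_group]) (simp add: orbit_def isometric)
qed

definition coaction :: "'a \<Rightarrow> ('g \<Rightarrow> 'a) multiplier" where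
  "coaction = mult_embed X \<circ> orbit"

lemma coaction_morphism: "morphism A (mult_algebra X) coaction"
  unfolding coaction_def by (rule morphism_comp[OF orbit_morphism X.mult_embed_morphism])

text \<open>Automorphisms of \<open>C(G, C(G, A))\<close>; conjugating the multiplication in one variable by them gives
  the extensions of \<open>\<alpha> \<otimes> id\<close> and \<open>id \<otimes> (\<sigma> \<circ> d)\<close> to multipliers.\<close>

definition twist :: "('g \<Rightarrow> 'g \<Rightarrow> 'a) \<Rightarrow> 'g \<Rightarrow> 'g \<Rightarrow> 'a" where
  "twist K = (\<lambda>t s. \<beta> s (K s t))"

definition untwist :: "('g \<Rightarrow> 'g \<Rightarrow> 'a) \<Rightarrow> 'g \<Rightarrow> 'g \<Rightarrow> 'a" where
  "untwist H = (\<lambda>s t. \<beta> (- s) (H t s))"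

definition shear :: "('g \<Rightarrow> 'g \<Rightarrow> 'a) \<Rightarrow> 'g \<Rightarrow> 'g \<Rightarrow> 'a" where
  "shear K = (\<lambda>t s. K s (t + s))"

definition unshear :: "('g \<Rightarrow> 'g \<Rightarrow> 'a) \<Rightarrow> 'g \<Rightarrow> 'g \<Rightarrow> 'a" where
  "unshear H = (\<lambda>s u. H (u - s) s)"

lemma C0_carrier_Y: "H \<in> C0_carrier X \<longleftrightarrow> jointly_continuous (H :: 'g \<Rightarrow> 'g \<Rightarrow> 'a)"
  by (rule C0_tensor_iff[OF compact_group compact_group])

lemma Y_section: "(H :: 'g \<Rightarrow> 'g \<Rightarrow> 'a) \<in> C0_carrier X \<Longrightarrow> H t \<in> C0_carrier A"
  using C0_carrierD[of H X t] by simp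

lemma Y_value: "(H :: 'g \<Rightarrow> 'g \<Rightarrow> 'a) \<in> C0_carrier X \<Longrightarrow> H t s \<in> carrier A"
  using C0_carrierD[OF Y_section] .

lemma Y_norm_le: "(\<And>t s. p (H t s) \<le> c) \<Longrightarrow> sup_seminorm (sup_seminorm p) (H :: 'g \<Rightarrow> 'g \<Rightarrow> 'a) \<le> c"
  by (intro X.sup_seminorm_le[OF compact_group] sup_seminorm_le[OF compact_group])

lemma Y_le_norm:
  assumes "(H :: 'g \<Rightarrow> 'g \<Rightarrow> 'a) \<in> C0_carrier X" shows "p (H t s) \<le> sup_seminorm (sup_seminorm p) H"
  by (rule order_trans[OF le_sup_seminorm[OF compact_group Y_section[OF assms] norm_cont]
        X.le_sup_seminorm[OF compact_group assms X.norm_cont]])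

lemma jointly_continuous_act:
  assumes H: "jointly_continuous (H :: 'g \<Rightarrow> 'g \<Rightarrow> 'a)" and f: "\<And>t s. filterlim f (nhds (f (t, s))) (nhds (t, s))"
  shows "jointly_continuous (\<lambda>t s. \<beta> (f (t, s)) (H t s))"
  unfolding jointly_continuous_def
proof (intro conjI allI)
  have c: "H t s \<in> carrier A" for t s using H by (simp add: jointly_continuous_def)
  then show "\<beta> (f (t, s)) (H t s) \<in> carrier A" for t s by (simp add: act_hom)
  fix t s
  have 1: "((\<lambda>z. p (diff A (H (fst z) (snd z)) (H t s))) \<longlongrightarrow> 0) (nhds (t, s))"
    using H by (simp add: jointly_continuous_def)
  have 2: "((\<lambda>z. p (diff A (\<beta> (f z) (H t s)) (\<beta> (f (t, s)) (H t s)))) \<longlongrightarrow> 0) (nhds (t, s))"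
    using filterlim_compose[OF act_continuous[OF c] f] .
  show "((\<lambda>z. p (diff A (\<beta> (f (fst z, snd z)) (H (fst z) (snd z))) (\<beta> (f (t, s)) (H t s)))) \<longlongrightarrow> 0) (nhds (t, s))"
    by (rule tendsto_0_le[OF tendsto_add_zero[OF 1 2]]) (auto simp: c act_hom intro!: act_diff_bound)
qed

text \<open>The four automorphisms share one shape: the point (t, s) is moved and a contractive
  endomorphism of A is applied to the value. Only the preservation of joint continuity has to be
  checked case by case.\<close>

lemma Y_morphismI:
  assumes "\<And>H. H \<in> C0_carrier X \<Longrightarrow> F H \<in> C0_carrier X"
    and "\<And>H t s. F H t s = \<gamma> t s (H (k t s) (l t s))"
    and "\<And>t s. star_hom A A (\<gamma> t s)" "\<And>t s a. a \<in> carrier A \<Longrightarrow> p (\<gamma> t s a) \<le> p a"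
  shows "morphism Y Y F"
proof (rule normed_morphismI[OF normY normY])
  show "star_hom Y Y F"
    by (rule star_homI) (auto simp: assms(1), auto simp: fun_eq_iff assms(2) star_homD[OF assms(3)] Y_value)
  show "sup_seminorm (sup_seminorm p) (F H) \<le> sup_seminorm (sup_seminorm p) H" if "H \<in> carrier Y" for H
  proof (rule Y_norm_le)
    have H: "H \<in> C0_carrier X" using that by simp
    show "p (F H t s) \<le> sup_seminorm (sup_seminorm p) H" for t s
      unfolding assms(2) by (rule order_trans[OF assms(4)[OF Y_value[OF H]] Y_le_norm[OF H]])
  qed
qed

lemma automorphisms:
  shows twist_morphism: "morphism Y Y twist" and untwist_morphism: "morphism Y Y untwist"
    and shear_morphism: "morphism Y Y shear" and unshear_morphism: "morphism Y Y unshear"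
proof -
  have id: "star_hom A A (\<lambda>a. a)" by (rule star_homI) auto
  have sw: "jointly_continuous (\<lambda>t s. H s t)" if "jointly_continuous H" for H :: "'g \<Rightarrow> 'g \<Rightarrow> 'a"
    using jointly_continuous_comp[OF that, of "\<lambda>z. (snd z, fst z)"] by (simp add: tendsto_pair_intros)
  have tw: "twist H \<in> C0_carrier X" if "H \<in> C0_carrier X" for H
    using that jointly_continuous_act[OF sw[of H], of snd] by (simp add: C0_carrier_Y twist_def tendsto_snd_nhds)
  show "morphism Y Y twist"
    by (rule Y_morphismI[where \<gamma> = "\<lambda>t. \<beta>" and k = "\<lambda>t s. s" and l = "\<lambda>t s. t"])
      (simp_all add: tw hom isometric, simp add: twist_def)
  have ut: "untwist H \<in> C0_carrier X" if "H \<in> C0_carrier X" for H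
    using that jointly_continuous_act[OF sw[of H], of "\<lambda>z. - fst z"]
    by (simp add: C0_carrier_Y untwist_def tendsto_pair_intros)
  show "morphism Y Y untwist"
    by (rule Y_morphismI[where \<gamma> = "\<lambda>t s. \<beta> (- t)" and k = "\<lambda>t s. s" and l = "\<lambda>t s. t"])
      (simp_all add: ut hom isometric, simp add: untwist_def)
  have sh: "shear H \<in> C0_carrier X" if "H \<in> C0_carrier X" for H
    using that jointly_continuous_comp[of H "\<lambda>z. (snd z, fst z + snd z)"]
    by (simp add: C0_carrier_Y shear_def tendsto_pair_intros)
  show "morphism Y Y shear"
    by (rule Y_morphismI[where \<gamma> = "\<lambda>t s a. a" and k = "\<lambda>t s. s" and l = "\<lambda>t s. t + s"])
      (simp_all add: sh id, simp add: shear_def)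
  have us: "unshear H \<in> C0_carrier X" if "H \<in> C0_carrier X" for H
    using that jointly_continuous_comp[of H "\<lambda>z. (snd z + - fst z, fst z)"]
    by (simp add: C0_carrier_Y unshear_def tendsto_pair_intros del: add_uminus_conv_diff)
      (simp add: tendsto_pair_intros)
  show "morphism Y Y unshear"
    by (rule Y_morphismI[where \<gamma> = "\<lambda>t s a. a" and k = "\<lambda>s u. u - s" and l = "\<lambda>s u. s"])
      (simp_all add: us id, simp add: unshear_def)
qed

end

section \<open>The extensions to multipliers and the resulting action\<close>

context isometric_action
begin

lemma inverses:
  assumes "H \<in> C0_carrier X"
  shows "untwist (twist H) = H" "twist (untwist H) = H" "unshear (shear H) = H" "shear (unshear H) = H"
  using Y_value[OF assms] by (simp_all add: twist_def untwist_def shear_def unshear_def act_inv)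

text \<open>For each s, the multiplier acts on t \<mapsto> \<open>\<beta> (- s) (H t s)\<close>, and
  \<open>\<beta> s\<close> moves the result back. The formula makes sense for every multiplier of
  C(G, A), not just for functions.\<close>

definition act_tensor_id :: "('g \<Rightarrow> 'a) multiplier \<Rightarrow> ('g \<Rightarrow> 'g \<Rightarrow> 'a) multiplier" where
  "act_tensor_id = conj_mult Y twist untwist \<circ> pointwise_mult X"

text \<open>For each s, the multiplier acts on u \<mapsto> \<open>H (u - s) s\<close>, and the
  result is read at u = t + s.\<close>

definition id_tensor_comult :: "('g \<Rightarrow> 'a) multiplier \<Rightarrow> ('g \<Rightarrow> 'g \<Rightarrow> 'a) multiplier" where
  "id_tensor_comult = conj_mult Y shear unshear \<circ> pointwise_mult X"

lemma extension_morphisms: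
  shows act_tensor_id_morphism: "morphism (mult_algebra X) (mult_algebra Y) act_tensor_id"
    and id_tensor_comult_morphism: "morphism (mult_algebra X) (mult_algebra Y) id_tensor_comult"
  unfolding act_tensor_id_def id_tensor_comult_def
  by (rule morphism_comp[OF pointwise_mult_morphism[OF compact_group normX]],
      rule conj_mult_morphism[OF Y.lc_star_algebra_axioms Y.lc_star_algebra_axioms];
      simp add: automorphisms inverses)+

lemma automorphisms_closed:
  assumes "H \<in> C0_carrier X"
  shows "untwist H \<in> C0_carrier X" "unshear H \<in> C0_carrier X"
  using star_hom_closed[of Y Y] untwist_morphism unshear_morphism assms by (auto simp: morphism_iff)

lemma act_tensor_id_embed:
  assumes h: "h \<in> C0_carrier A"
  shows "act_tensor_id (mult_embed X h) =
    (\<lambda>H\<in>C0_carrier X. \<lambda>t s. \<beta> s (h t) \<cdot> H t s, \<lambda>H\<in>C0_carrier X. \<lambda>t s. H t s \<cdot> \<beta> s (h t))"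
  using C0_carrierD[OF h]
  by (auto simp: act_tensor_id_def conj_mult_def pointwise_mult_def mult_embed_def automorphisms_closed
      Y_section fun_eq_iff restrict_def)
    (auto simp: twist_def untwist_def act_hom act_inv Y_value)

lemma id_tensor_comult_embed:
  assumes h: "h \<in> C0_carrier A"
  shows "id_tensor_comult (mult_embed X h) =
    (\<lambda>H\<in>C0_carrier X. \<lambda>t s. h (t + s) \<cdot> H t s, \<lambda>H\<in>C0_carrier X. \<lambda>t s. H t s \<cdot> h (t + s))"
  using C0_carrierD[OF h]
  by (auto simp: id_tensor_comult_def conj_mult_def pointwise_mult_def mult_embed_def automorphisms_closed
      Y_section fun_eq_iff restrict_def)
    (auto simp: shear_def unshear_def)

text \<open>The restriction to C(G, A) of the map on multipliers serves as \<alpha> \<otimes> id, so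
  the extension property will hold by construction. On elementary tensors, \<open>\<beta> s\<close>
  passes the scalar f t.\<close>

lemma alpha_tensor_id: "is_alpha_tensor_id A coaction (act_tensor_id \<circ> mult_embed X)"
  unfolding is_alpha_tensor_id_def
proof (intro conjI ballI)
  show "morphism X (mult_algebra Y) (act_tensor_id \<circ> mult_embed X)"
    by (rule morphism_comp[OF X.mult_embed_morphism act_tensor_id_morphism])
  fix a f assume a: "a \<in> carrier A" and f: "f \<in> carrier (C0 :: ('g \<Rightarrow> complex) talg)"
  show "(act_tensor_id \<circ> mult_embed X) (elem_tensor A a f) = mult_tensor X (coaction a) f"
    unfolding o_apply act_tensor_id_embed[OF elem_tensor_C0[OF compact_group a f]]
    using a by (auto simp: mult_tensor_def coaction_def
        mult_embed_def elem_tensor_def orbit_def Y_section restrict_def fun_eq_iff act_hom Y_value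
        scale_mult_left scale_mult_right)
qed

lemma id_tensor_flip_comult: "is_id_tensor_flip_comult A (id_tensor_comult \<circ> mult_embed X)"
  unfolding is_id_tensor_flip_comult_def
proof (intro conjI ballI)
  show "morphism X (mult_algebra Y) (id_tensor_comult \<circ> mult_embed X)"
    by (rule morphism_comp[OF X.mult_embed_morphism id_tensor_comult_morphism])
  fix a f assume a: "a \<in> carrier A" and f: "f \<in> carrier (C0 :: ('g \<Rightarrow> complex) talg)"
  show "(id_tensor_comult \<circ> mult_embed X) (elem_tensor A a f) = elem_tensor2 A a (tensor_flip (comult f))"
    unfolding o_apply id_tensor_comult_embed[OF elem_tensor_C0[OF compact_group a f]]
    using a by (auto simp: elem_tensor2_def
        elem_tensor_def tensor_flip_def comult_def restrict_def fun_eq_iff Y_value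
        scale_mult_left scale_mult_right)
qed

text \<open>One map multiplies \<open>H t s\<close> by \<open>\<beta> s (\<beta> t a)\<close>, the
  other by \<open>\<beta> (t + s) a\<close>; the action law identifies the factors.\<close>

lemma coaction_identity: "a \<in> carrier A \<Longrightarrow> act_tensor_id (coaction a) = id_tensor_comult (coaction a)"
  using orbit_in[of a]
  by (auto simp: coaction_def act_tensor_id_embed id_tensor_comult_embed orbit_def act_act cong: restrict_cong)

lemma faithful: "\<lbrakk>x \<in> carrier A; \<forall>r\<in>cont_seminorms A. r x = 0\<rbrakk> \<Longrightarrow> x = \<zero>"
  using norm_cont definite by blast

lemma coaction_inj: "inj_on coaction (carrier A)"
proof (rule inj_onI)
  fix a b assume ab: "a \<in> carrier A" "b \<in> carrier A" and eq: "coaction a = coaction b"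
  have "orbit a = orbit b"
    by (rule tensor_embed_inj[OF compact_group faithful orbit_in[OF ab(1)] orbit_in[OF ab(2)]])
      (use eq in \<open>simp_all add: coaction_def\<close>)
  then have "orbit a 0 = orbit b 0" by simp
  then show "a = b" using ab by (simp add: orbit_def act_zero)
qed

text \<open>Finitely many values of h approximate all of them within e/3. Convergence at these
  values spreads to the whole range because p u \<le> 1. The three thirds are the passage from h s
  to h t under multiplication by u, the convergence at h t, and the passage back.\<close>

lemma compact_uniform:
  fixes h :: "'g \<Rightarrow> 'a"
  assumes h: "h \<in> C0_carrier A" and e: "e > 0"
    and bound: "eventually (\<lambda>u. u \<in> carrier A \<and> p u \<le> 1) E"
    and lim: "\<And>a d. \<lbrakk>a \<in> carrier A; d > 0\<rbrakk> \<Longrightarrow>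
      eventually (\<lambda>u. p (diff A (u \<cdot> a) a) < d \<and> p (diff A (a \<cdot> u) a) < d) E"
  shows "eventually (\<lambda>u. \<forall>t. p (diff A (u \<cdot> h t) (h t)) \<le> e \<and> p (diff A (h t \<cdot> u) (h t)) \<le> e) E"
proof -
  have hc: "h t \<in> carrier A" for t using h by (rule C0_carrierD)
  have "\<exists>V. open V \<and> t \<in> V \<and> (\<forall>s\<in>V. p (diff A (h s) (h t)) < e / 3)" for t
  proof -
    have "((\<lambda>s. p (diff A (h s) (h t))) \<longlongrightarrow> 0) (nhds t)"
      using h C0_norm_iff[OF compact_group] by blast
    then have "eventually (\<lambda>s. p (diff A (h s) (h t)) < e / 3) (nhds t)"
      by (rule order_tendstoD) (use e in simp)
    then show ?thesis by (simp add: eventually_nhds)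
  qed
  then obtain V where V: "\<And>t. open (V t)" "\<And>t. t \<in> V t" "\<And>t s. s \<in> V t \<Longrightarrow> p (diff A (h s) (h t)) < e / 3"
    by metis
  obtain T where T: "finite T" "UNIV \<subseteq> (\<Union>t\<in>T. V t)"
    using compactE_image[OF compact_group, of UNIV V] V by (metis UNIV_I UN_I subsetI)
  have "eventually (\<lambda>u. \<forall>t\<in>T. p (diff A (u \<cdot> h t) (h t)) < e / 3 \<and> p (diff A (h t \<cdot> u) (h t)) < e / 3) E"
    using T(1) lim[OF hc, of "e / 3"] e by (simp add: eventually_ball_finite)
  with bound show ?thesis
  proof eventually_elim
    case (elim u)
    show ?case
    proof
      fix s
      obtain t where t: "t \<in> T" "s \<in> V t" using T(2) by blast
      have 0: "p (diff A (h s) (h t)) < e / 3" "p (diff A (h t) (h s)) < e / 3"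
        using V(3)[OF t(2)] p_diff_commute[OF hc hc, of s t] by auto
      have le1: "p u * p (diff A (h s) (h t)) \<le> p (diff A (h s) (h t))"
        using elim hc by (intro mult_left_le_one_le) auto
      have "p (diff A (u \<cdot> h s) (h s)) \<le> p (diff A (u \<cdot> h s) (u \<cdot> h t)) + p (diff A (u \<cdot> h t) (h t)) + p (diff A (h t) (h s))"
        using p_diff_triangle[of "u \<cdot> h s" "u \<cdot> h t" "h s"] p_diff_triangle[of "u \<cdot> h t" "h t" "h s"] elim hc by force
      moreover have "p (diff A (u \<cdot> h s) (u \<cdot> h t)) \<le> p (diff A (h s) (h t))"
        using submult[of u "diff A (h s) (h t)"] le1 elim hc by (simp add: diff_mult_left)
      moreover have "p (diff A (h s \<cdot> u) (h s)) \<le> p (diff A (h s \<cdot> u) (h t \<cdot> u)) + p (diff A (h t \<cdot> u) (h t)) + p (diff A (h t) (h s))"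
        using p_diff_triangle[of "h s \<cdot> u" "h t \<cdot> u" "h s"] p_diff_triangle[of "h t \<cdot> u" "h t" "h s"] elim hc by force
      moreover have "p (diff A (h s \<cdot> u) (h t \<cdot> u)) \<le> p (diff A (h s) (h t))"
        using submult[of "diff A (h s) (h t)" u] le1 elim hc by (simp add: diff_mult_right mult.commute)
      moreover have "p (diff A (u \<cdot> h t) (h t)) < e / 3" "p (diff A (h t \<cdot> u) (h t)) < e / 3"
        using elim t(1) by auto
      ultimately show "p (diff A (u \<cdot> h s) (h s)) \<le> e \<and> p (diff A (h s \<cdot> u) (h s)) \<le> e"
        using 0 by linarith
    qed
  qed
qed

text \<open>With k t = \<open>\<beta> (- t) (h t)\<close>, isometry turns the error of
  \<open>\<beta> t u\<close> on h t into the error of u on k t. A single element u then acts on the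
  continuous function k, where convergence is uniform.\<close>

lemma coaction_strict:
  assumes E: "approximate_unit A E"
  shows "limitin (strict_topology X) coaction (mult_one X) E"
  unfolding strict_topology_def
proof (rule limitin_seminorm_topologyI)
  show "mult_one X \<in> carrier (mult_algebra X)" by (simp add: X.mult_one_in)
  obtain R where R: "R \<subseteq> carrier A" "\<forall>e\<in>R. \<forall>r\<in>cont_seminorms A. r e \<le> 1" "eventually (\<lambda>e. e \<in> R) E"
    using E unfolding approximate_unit_def by blast
  have bound: "eventually (\<lambda>u. u \<in> carrier A \<and> p u \<le> 1) E"
    using R(3) by eventually_elim (use R(1,2) norm_cont in blast)
  have cl: "coaction u \<in> multipliers X" if "u \<in> carrier A" for u
    using that coaction_morphism star_hom_closed[of A "mult_algebra X" coaction] by (simp add: morphism_iff)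
  show "eventually (\<lambda>u. coaction u \<in> carrier (mult_algebra X)) E"
    using bound by eventually_elim (use cl in auto)
  have lim: "eventually (\<lambda>u. p (diff A (u \<cdot> a) a) < d \<and> p (diff A (a \<cdot> u) a) < d) E"
    if "a \<in> carrier A" "d > 0" for a d
  proof -
    have "limitin (topo A) (\<lambda>u. u \<cdot> a) a E" "limitin (topo A) (\<lambda>u. a \<cdot> u) a E"
      using E that unfolding approximate_unit_def by auto
    then show ?thesis
      unfolding topo_norm
      by (intro eventually_conj limitin_seminorm_topologyD[OF star_algebra_axioms seminorm _ _ that(2)]) auto
  qed
  fix Q and e :: real
  assume "Q \<in> {\<lambda>m. r (fst m h) + r (snd m h) | r h. r \<in> cont_seminorms X \<and> h \<in> carrier X}" and e: "e > 0"
  then obtain r h where r: "r \<in> cont_seminorms X" and h: "h \<in> C0_carrier A"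
    and Q: "Q = (\<lambda>m. r (fst m h) + r (snd m h))" by auto
  \<comment> \<open>The strict topology tests arbitrary continuous seminorms r of C(G, A). A norm
    below d puts each of the two summands of \<open>Q\<close> below e/2.\<close>
  obtain d where d: "d > 0" "\<forall>x\<in>carrier X. sup_seminorm p x < d \<longrightarrow> r x < e / 2"
    using X.cont_seminorm_small[OF r, of "e / 2"] e by auto
  define k where "k t = \<beta> (- t) (h t)" for t
  have hc: "h t \<in> carrier A" for t using h by (rule C0_carrierD)
  have k: "k \<in> C0_carrier A"
  proof -
    have "((\<lambda>t. p (diff A (k t) (k t\<^sub>0))) \<longlongrightarrow> 0) (nhds t\<^sub>0)" for t\<^sub>0
    proof (rule tendsto_0_le)
      have 1: "((\<lambda>t. p (diff A (h t) (h t\<^sub>0))) \<longlongrightarrow> 0) (nhds t\<^sub>0)"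
        using h C0_norm_iff[OF compact_group] by blast
      have 2: "((\<lambda>t. p (diff A (\<beta> (- t) (h t\<^sub>0)) (\<beta> (- t\<^sub>0) (h t\<^sub>0)))) \<longlongrightarrow> 0) (nhds t\<^sub>0)"
        by (rule filterlim_compose[OF act_continuous[OF hc] tendsto_uminus_nhds])
      show "((\<lambda>t. p (diff A (h t) (h t\<^sub>0)) + p (diff A (\<beta> (- t) (h t\<^sub>0)) (\<beta> (- t\<^sub>0) (h t\<^sub>0)))) \<longlongrightarrow> 0) (nhds t\<^sub>0)"
        by (rule tendsto_add_zero[OF 1 2])
      show "p (diff A (k t) (k t\<^sub>0)) \<le> p (diff A (h t) (h t\<^sub>0)) + p (diff A (\<beta> (- t) (h t\<^sub>0)) (\<beta> (- t\<^sub>0) (h t\<^sub>0)))" for t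
        unfolding k_def by (rule act_diff_bound[OF hc hc])
    qed (simp add: k_def hc act_hom)
    then show ?thesis by (simp add: C0_norm_iff[OF compact_group] k_def hc act_hom)
  qed
  have "eventually (\<lambda>u. \<forall>t. p (diff A (u \<cdot> k t) (k t)) \<le> d / 2 \<and> p (diff A (k t \<cdot> u) (k t)) \<le> d / 2) E"
    by (rule compact_uniform[OF k _ bound lim]) (use d(1) in auto)
  with bound show "eventually (\<lambda>u. Q (diff (mult_algebra X) (coaction u) (mult_one X)) < e) E"
  proof eventually_elim
    case (elim u)
    then have u: "u \<in> carrier A" by simp
    have kt: "\<beta> t (k t) = h t" "k t \<in> carrier A" for t using hc by (simp_all add: k_def act_inv act_hom)
    have ou: "orbit u \<in> C0_carrier A" by (rule orbit_in[OF u])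
    have c1: "diff X (orbit u \<cdot>\<^bsub>X\<^esub> h) h \<in> C0_carrier A" and c2: "diff X (h \<cdot>\<^bsub>X\<^esub> orbit u) h \<in> C0_carrier A"
      using X.diff_closed[of "orbit u \<cdot>\<^bsub>X\<^esub> h" h] X.diff_closed[of "h \<cdot>\<^bsub>X\<^esub> orbit u" h]
        X.mult_closed[of "orbit u" h] X.mult_closed[of h "orbit u"] ou h by simp_all
    have "p (diff A (\<beta> t u \<cdot> h t) (h t)) = p (\<beta> t (diff A (u \<cdot> k t) (k t)))"
         "p (diff A (h t \<cdot> \<beta> t u) (h t)) = p (\<beta> t (diff A (k t \<cdot> u) (k t)))" for t
      using u kt by (simp_all add: act_diff act_hom)
    then have "p (diff A (\<beta> t u \<cdot> h t) (h t)) \<le> d / 2" "p (diff A (h t \<cdot> \<beta> t u) (h t)) \<le> d / 2" for t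
      using elim u kt by (simp_all add: isometric)
    then have "sup_seminorm p (diff X (orbit u \<cdot>\<^bsub>X\<^esub> h) h) \<le> d / 2" "sup_seminorm p (diff X (h \<cdot>\<^bsub>X\<^esub> orbit u) h) \<le> d / 2"
      by (auto simp: orbit_def simp del: le_divide_eq_numeral1 intro!: sup_seminorm_le[OF compact_group])
    then have "r (diff X (orbit u \<cdot>\<^bsub>X\<^esub> h) h) < e / 2" "r (diff X (h \<cdot>\<^bsub>X\<^esub> orbit u) h) < e / 2"
      using d c1 c2 by auto
    moreover have "fst (diff (mult_algebra X) (coaction u) (mult_one X)) h = diff X (orbit u \<cdot>\<^bsub>X\<^esub> h) h"
      "snd (diff (mult_algebra X) (coaction u) (mult_one X)) h = diff X (h \<cdot>\<^bsub>X\<^esub> orbit u) h"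
      using h by (simp_all add: diff_mult_algebra coaction_def mult_embed_def mult_one_def)
    ultimately show "Q (diff (mult_algebra X) (coaction u) (mult_one X)) < e"
      by (simp add: Q)
  qed
qed

lemma kac_action_coaction: "kac_action A coaction"
  unfolding kac_action_def
proof (intro conjI exI)
  show "S_morphism A X coaction"
    using coaction_morphism coaction_strict by (simp add: S_morphism_def)
  show "coaction ` carrier A \<subseteq> mult_rel A"
    using mult_embed_in_mult_rel[OF compact_group orbit_in] by (auto simp: coaction_def)
  show "inj_on coaction (carrier A)" by (rule coaction_inj)
  show "is_alpha_tensor_id A coaction (act_tensor_id \<circ> mult_embed X)" by (rule alpha_tensor_id)
  show "mult_extension X Y (act_tensor_id \<circ> mult_embed X) act_tensor_id"
    by (simp add: mult_extension_def act_tensor_id_morphism)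
  show "is_id_tensor_flip_comult A (id_tensor_comult \<circ> mult_embed X)" by (rule id_tensor_flip_comult)
  show "mult_extension X Y (id_tensor_comult \<circ> mult_embed X) id_tensor_comult"
    by (simp add: mult_extension_def id_tensor_comult_morphism)
  show "\<forall>a\<in>carrier A. act_tensor_id (coaction a) = id_tensor_comult (coaction a)"
    using coaction_identity by blast
qed

theorem kac_action_isometric: "kac_action A (\<lambda>a. mult_embed X (\<lambda>t. \<beta> t a))"
  using kac_action_coaction by (simp add: coaction_def orbit_def o_def)

end

section \<open>Completion with respect to a C*-seminorm\<close>

text \<open>Sequences are enough because a single seminorm is involved. Passing to classes divides
  by its kernel and completes in one step.\<close>

definition cauchy_seqs :: "('a, 'm) talg_scheme \<Rightarrow> ('a \<Rightarrow> real) \<Rightarrow> (nat \<Rightarrow> 'a) set" where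
  "cauchy_seqs A p = {x. (\<forall>n. x n \<in> carrier A) \<and>
    (\<forall>e>0. \<exists>N. \<forall>m\<ge>N. \<forall>n\<ge>N. p (diff A (x m) (x n)) < e)}"

definition null_class :: "('a, 'm) talg_scheme \<Rightarrow> ('a \<Rightarrow> real) \<Rightarrow> (nat \<Rightarrow> 'a) \<Rightarrow> (nat \<Rightarrow> 'a) set" where
  "null_class A p x = {y \<in> cauchy_seqs A p. (\<lambda>n. p (diff A (x n) (y n))) \<longlonglongrightarrow> 0}"

text \<open>Operations on classes go through a chosen sequence; by \<open>rep_cls\<close> the choice
  matters only up to a null sequence.\<close>

definition rep :: "(nat \<Rightarrow> 'a) set \<Rightarrow> nat \<Rightarrow> 'a" where
  "rep X = (SOME x. x \<in> X)"

definition completion_norm :: "('a \<Rightarrow> real) \<Rightarrow> (nat \<Rightarrow> 'a) set \<Rightarrow> real" where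
  "completion_norm p X = lim (\<lambda>n. p (rep X n))"

definition completion0 :: "('a, 'm) talg_scheme \<Rightarrow> ('a \<Rightarrow> real) \<Rightarrow> (nat \<Rightarrow> 'a) set talg" where
  "completion0 A p = \<lparr>
    carrier = null_class A p ` cauchy_seqs A p,
    add = (\<lambda>X Y. null_class A p (\<lambda>n. rep X n \<oplus>\<^bsub>A\<^esub> rep Y n)),
    zero = null_class A p (\<lambda>n. zero A),
    scale = (\<lambda>c X. null_class A p (\<lambda>n. scale A c (rep X n))),
    mult = (\<lambda>X Y. null_class A p (\<lambda>n. rep X n \<cdot>\<^bsub>A\<^esub> rep Y n)),
    star = (\<lambda>X. null_class A p (\<lambda>n. star A (rep X n))),
    topo = discrete_topology UNIV\<rparr>"

definition completion :: "('a, 'm) talg_scheme \<Rightarrow> ('a \<Rightarrow> real) \<Rightarrow> (nat \<Rightarrow> 'a) set talg" where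
  "completion A p = completion0 A p \<lparr>topo := seminorm_topology (completion0 A p) {completion_norm p}\<rparr>"

text \<open>\<open>p\<close> is the seminorm of the target: the result is a class for
  \<open>p\<close>, while \<open>rep\<close> picks a sequence from the source class.\<close>

definition completion_map :: "('a, 'm) talg_scheme \<Rightarrow> ('a \<Rightarrow> real) \<Rightarrow> ('a \<Rightarrow> 'a) \<Rightarrow>
    (nat \<Rightarrow> 'a) set \<Rightarrow> (nat \<Rightarrow> 'a) set" where
  "completion_map A p \<phi> X = null_class A p (\<lambda>n. \<phi> (rep X n))"

lemma completion_simps:
  "carrier (completion A p) = null_class A p ` cauchy_seqs A p"
  "add (completion A p) X Y = null_class A p (\<lambda>n. rep X n \<oplus>\<^bsub>A\<^esub> rep Y n)"
  "zero (completion A p) = null_class A p (\<lambda>n. zero A)"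
  "scale (completion A p) c X = null_class A p (\<lambda>n. scale A c (rep X n))"
  "mult (completion A p) X Y = null_class A p (\<lambda>n. rep X n \<cdot>\<^bsub>A\<^esub> rep Y n)"
  "star (completion A p) X = null_class A p (\<lambda>n. star A (rep X n))"
  by (simp_all add: completion_def completion0_def)

lemma topo_completion: "topo (completion A p) = seminorm_topology (completion A p) {completion_norm p}"
  by (simp add: completion_def completion0_def seminorm_topology_def diff_def)

section \<open>Cauchy sequences, their classes and the completed algebra\<close>

context cstar_seminormed
begin

abbreviation "Cs \<equiv> cauchy_seqs A p"
abbreviation "cls \<equiv> null_class A p"
abbreviation "B \<equiv> completion A p"

lemma cauchy_closed: "x \<in> Cs \<Longrightarrow> x n \<in> carrier A"
  by (simp add: cauchy_seqs_def)

lemma cauchyD: "x \<in> Cs \<Longrightarrow> e > 0 \<Longrightarrow> \<exists>N. \<forall>m\<ge>N. \<forall>n\<ge>N. p (diff A (x m) (x n)) < e"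
  by (simp add: cauchy_seqs_def)

lemma cauchy_norm_convergent:
  assumes "x \<in> Cs" shows "convergent (\<lambda>n. p (x n))"
proof -
  have "Cauchy (\<lambda>n. p (x n))"
  proof (rule metric_CauchyI)
    fix e :: real assume "e > 0"
    then obtain N where N: "\<forall>m\<ge>N. \<forall>n\<ge>N. p (diff A (x m) (x n)) < e" using cauchyD[OF assms] by blast
    have "dist (p (x m)) (p (x n)) < e" if "m \<ge> N" "n \<ge> N" for m n
      using abs_p_diff[of "x m" "x n"] N that cauchy_closed[OF assms] by (simp add: dist_real_def) (meson order_le_less_trans)
    then show "\<exists>M. \<forall>m\<ge>M. \<forall>n\<ge>M. dist (p (x m)) (p (x n)) < e" by blast
  qed
  then show ?thesis by (rule Cauchy_convergent)
qed

lemma cauchy_bounded: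
  assumes "x \<in> Cs" shows "\<exists>M>0. \<forall>n. p (x n) \<le> M"
proof -
  have "Bseq (\<lambda>n. p (x n))"
    using cauchy_norm_convergent[OF assms] by (rule convergent_imp_Bseq)
  then obtain K where "K > 0" "\<forall>n. norm (p (x n)) \<le> K" by (rule BseqE)
  then show ?thesis using cauchy_closed[OF assms] by (intro exI[of _ K]) auto
qed

text \<open>A common criterion for all operations. It has two controlling sequences for the sake of
  sums and products; unary operations use one sequence twice.\<close>

lemma cauchyI:
  assumes "\<And>n. x n \<in> carrier A" "y \<in> Cs" "z \<in> Cs" "C \<ge> 0"
    "\<And>m n. p (diff A (x m) (x n)) \<le> C * (p (diff A (y m) (y n)) + p (diff A (z m) (z n)))"
  shows "x \<in> Cs"
proof -
  have "\<exists>N. \<forall>m\<ge>N. \<forall>n\<ge>N. p (diff A (x m) (x n)) < e" if e: "e > 0" for e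
  proof -
    \<comment> \<open>The 2 pays for the two controlling sequences, and adding 1 keeps the
      denominator positive for \<open>C = 0\<close>.\<close>
    define d where "d = e / (2 * (C + 1))"
    have d: "d > 0" using e assms(4) by (simp add: d_def)
    obtain N where N: "\<forall>m\<ge>N. \<forall>n\<ge>N. p (diff A (y m) (y n)) < d" using cauchyD[OF assms(2) d] by blast
    obtain M where M: "\<forall>m\<ge>M. \<forall>n\<ge>M. p (diff A (z m) (z n)) < d" using cauchyD[OF assms(3) d] by blast
    have "p (diff A (x m) (x n)) < e" if "m \<ge> max N M" "n \<ge> max N M" for m n
    proof -
      have "p (diff A (y m) (y n)) + p (diff A (z m) (z n)) \<le> 2 * d"
        using N[rule_format, of m n] M[rule_format, of m n] that by simp
      then have "p (diff A (x m) (x n)) \<le> C * (2 * d)"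
        by (rule order_trans[OF assms(5) mult_left_mono]) (rule assms(4))
      also have "\<dots> < (C + 1) * (2 * d)" using d by simp
      also have "\<dots> = e" using assms(4) by (simp add: d_def field_simps)
      finally show ?thesis .
    qed
    then show ?thesis by blast
  qed
  then show ?thesis using assms(1) by (simp add: cauchy_seqs_def)
qed

lemma cauchy_const: "a \<in> carrier A \<Longrightarrow> (\<lambda>n. a) \<in> Cs"
  by (simp add: cauchy_seqs_def)

lemma cauchy_add: "\<lbrakk>x \<in> Cs; y \<in> Cs\<rbrakk> \<Longrightarrow> (\<lambda>n. x n \<oplus> y n) \<in> Cs"
  by (rule cauchyI[of _ x y 1]) (auto simp: cauchy_closed diff_add intro!: subadd)

lemma cauchy_scale: "x \<in> Cs \<Longrightarrow> (\<lambda>n. scale A c (x n)) \<in> Cs"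
  by (rule cauchyI[of _ x x "cmod c"]) (auto simp: cauchy_closed diff_scale homog mult_left_mono)

lemma cauchy_star: "x \<in> Cs \<Longrightarrow> (\<lambda>n. star A (x n)) \<in> Cs"
  by (rule cauchyI[of _ x x 1]) (auto simp: cauchy_closed diff_star)

lemma cauchy_mult:
  assumes "x \<in> Cs" "y \<in> Cs" shows "(\<lambda>n. x n \<cdot> y n) \<in> Cs"
proof -
  obtain M where M: "M > 0" "\<forall>n. p (x n) \<le> M" using cauchy_bounded[OF assms(1)] by blast
  obtain L where L: "L > 0" "\<forall>n. p (y n) \<le> L" using cauchy_bounded[OF assms(2)] by blast
  note c = cauchy_closed[OF assms(1)] cauchy_closed[OF assms(2)]
  show ?thesis
  proof (rule cauchyI[of _ x y "L + M"])
    fix m n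
    have "p (diff A (x m \<cdot> y m) (x n \<cdot> y n)) \<le> p (diff A (x m) (x n)) * p (y m) + p (x n) * p (diff A (y m) (y n))"
      by (rule diff_mult_bound) (use c in auto)
    also have "\<dots> \<le> p (diff A (x m) (x n)) * (L + M) + (L + M) * p (diff A (y m) (y n))"
      using M L c by (intro add_mono mult_mono) (auto intro: add_increasing add_increasing2 less_imp_le)
    finally show "p (diff A (x m \<cdot> y m) (x n \<cdot> y n)) \<le> (L + M) * (p (diff A (x m) (x n)) + p (diff A (y m) (y n)))"
      by (simp add: field_simps)
  qed (use assms M L c in auto)
qed

lemma cauchy_diff: "\<lbrakk>x \<in> Cs; y \<in> Cs\<rbrakk> \<Longrightarrow> (\<lambda>n. diff A (x n) (y n)) \<in> Cs"
  unfolding diff_def by (intro cauchy_add cauchy_scale)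

lemma null_le:
  assumes "(\<lambda>n. p (diff A (x n) (y n))) \<longlonglongrightarrow> 0" "\<And>n. x' n \<in> carrier A" "\<And>n. y' n \<in> carrier A"
    and "\<And>n. p (diff A (x' n) (y' n)) \<le> C * p (diff A (x n) (y n))"
  shows "(\<lambda>n. p (diff A (x' n) (y' n))) \<longlonglongrightarrow> 0"
  by (rule tendsto_0_le[OF tendsto_mult_right_zero[OF assms(1), of C]]) (use assms in auto)

lemma null_trans:
  assumes "x \<in> Cs" "y \<in> Cs" "z \<in> Cs"
    and "(\<lambda>n. p (diff A (x n) (y n))) \<longlonglongrightarrow> 0" "(\<lambda>n. p (diff A (y n) (z n))) \<longlonglongrightarrow> 0"
  shows "(\<lambda>n. p (diff A (x n) (z n))) \<longlonglongrightarrow> 0"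
  by (rule tendsto_0_le[OF tendsto_add_zero[OF assms(4,5)]])
    (use cauchy_closed[OF assms(1)] cauchy_closed[OF assms(2)] cauchy_closed[OF assms(3)] in \<open>auto intro!: p_diff_triangle\<close>)

lemma null_sym:
  assumes "x \<in> Cs" "y \<in> Cs" "(\<lambda>n. p (diff A (x n) (y n))) \<longlonglongrightarrow> 0"
  shows "(\<lambda>n. p (diff A (y n) (x n))) \<longlonglongrightarrow> 0"
  using assms(3) p_diff_commute[OF cauchy_closed[OF assms(1)] cauchy_closed[OF assms(2)]] by simp

lemma cls_refl: "x \<in> Cs \<Longrightarrow> x \<in> cls x"
  by (simp add: null_class_def cauchy_closed)

lemma cls_eqI:
  assumes "x \<in> Cs" "y \<in> Cs" "(\<lambda>n. p (diff A (x n) (y n))) \<longlonglongrightarrow> 0"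
  shows "cls x = cls y"
  using null_trans null_sym assms unfolding null_class_def by blast

lemma rep_cls:
  assumes "x \<in> Cs"
  shows "rep (cls x) \<in> Cs" and "(\<lambda>n. p (diff A (rep (cls x) n) (x n))) \<longlonglongrightarrow> 0"
proof -
  have "rep (cls x) \<in> cls x" unfolding rep_def by (rule someI[of _ x]) (rule cls_refl[OF assms])
  then show "rep (cls x) \<in> Cs" "(\<lambda>n. p (diff A (rep (cls x) n) (x n))) \<longlonglongrightarrow> 0"
    using null_sym[OF assms] by (auto simp: null_class_def)
qed

lemma cls_in: "x \<in> Cs \<Longrightarrow> cls x \<in> carrier B"
  by (simp add: completion_simps)

lemma add_cls:
  assumes "x \<in> Cs" "y \<in> Cs" shows "cls x \<oplus>\<^bsub>B\<^esub> cls y = cls (\<lambda>n. x n \<oplus> y n)"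
  unfolding completion_simps
proof (rule cls_eqI)
  note c = cauchy_closed[OF assms(1)] cauchy_closed[OF assms(2)]
    cauchy_closed[OF rep_cls(1)[OF assms(1)]] cauchy_closed[OF rep_cls(1)[OF assms(2)]]
  show "(\<lambda>n. p (diff A (rep (cls x) n \<oplus> rep (cls y) n) (x n \<oplus> y n))) \<longlonglongrightarrow> 0"
    by (rule tendsto_0_le[OF tendsto_add_zero[OF rep_cls(2)[OF assms(1)] rep_cls(2)[OF assms(2)]]])
      (auto simp: c diff_add intro!: subadd)
qed (use assms in \<open>auto intro!: cauchy_add rep_cls\<close>)

lemma scale_cls:
  assumes "x \<in> Cs" shows "scale B c (cls x) = cls (\<lambda>n. scale A c (x n))"
  unfolding completion_simps
proof (rule cls_eqI)
  note c = cauchy_closed[OF assms(1)] cauchy_closed[OF rep_cls(1)[OF assms(1)]]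
  show "(\<lambda>n. p (diff A (scale A c (rep (cls x) n)) (scale A c (x n)))) \<longlonglongrightarrow> 0"
    by (rule null_le[OF rep_cls(2)[OF assms], of _ _ "cmod c"]) (auto simp: c diff_scale homog)
qed (use assms in \<open>auto intro!: cauchy_scale rep_cls\<close>)

lemma star_cls:
  assumes "x \<in> Cs" shows "star B (cls x) = cls (\<lambda>n. star A (x n))"
  unfolding completion_simps
proof (rule cls_eqI)
  note c = cauchy_closed[OF assms(1)] cauchy_closed[OF rep_cls(1)[OF assms(1)]]
  show "(\<lambda>n. p (diff A (star A (rep (cls x) n)) (star A (x n)))) \<longlonglongrightarrow> 0"
    by (rule null_le[OF rep_cls(2)[OF assms], of _ _ 1]) (auto simp: c diff_star)
qed (use assms in \<open>auto intro!: cauchy_star rep_cls\<close>)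

lemma mult_cls:
  assumes "x \<in> Cs" "y \<in> Cs" shows "cls x \<cdot>\<^bsub>B\<^esub> cls y = cls (\<lambda>n. x n \<cdot> y n)"
  unfolding completion_simps
proof (rule cls_eqI)
  let ?x = "rep (cls x)" and ?y = "rep (cls y)"
  note c = cauchy_closed[OF assms(1)] cauchy_closed[OF assms(2)]
    cauchy_closed[OF rep_cls(1)[OF assms(1)]] cauchy_closed[OF rep_cls(1)[OF assms(2)]]
  obtain M where M: "M > 0" "\<forall>n. p (x n) \<le> M" using cauchy_bounded[OF assms(1)] by blast
  obtain L where L: "L > 0" "\<forall>n. p (?y n) \<le> L" using cauchy_bounded[OF rep_cls(1)[OF assms(2)]] by blast
  show "(\<lambda>n. p (diff A (?x n \<cdot> ?y n) (x n \<cdot> y n))) \<longlonglongrightarrow> 0"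
  proof (rule tendsto_0_le)
    show "(\<lambda>n. p (diff A (?x n) (x n)) * L + M * p (diff A (?y n) (y n))) \<longlonglongrightarrow> 0"
      by (rule tendsto_add_zero[OF tendsto_mult_left_zero[OF rep_cls(2)[OF assms(1)]]
           tendsto_mult_right_zero[OF rep_cls(2)[OF assms(2)]]])
    fix n
    have "p (diff A (?x n \<cdot> ?y n) (x n \<cdot> y n)) \<le> p (diff A (?x n) (x n)) * p (?y n) + p (x n) * p (diff A (?y n) (y n))"
      by (rule diff_mult_bound) (use c in auto)
    also have "\<dots> \<le> p (diff A (?x n) (x n)) * L + M * p (diff A (?y n) (y n))"
      using M L c by (intro add_mono mult_mono) (auto intro: less_imp_le)
    finally show "p (diff A (?x n \<cdot> ?y n) (x n \<cdot> y n)) \<le> p (diff A (?x n) (x n)) * L + M * p (diff A (?y n) (y n))" .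
  qed (use c in auto)
qed (use assms in \<open>auto intro!: cauchy_mult rep_cls\<close>)

lemma zero_cls: "zero B = cls (\<lambda>n. \<zero>)"
  by (simp add: completion_simps)

lemma carrierE: assumes "X \<in> carrier B" obtains x where "x \<in> Cs" "X = cls x"
  using assms by (auto simp: completion_simps)

lemmas ops_cls = add_cls scale_cls star_cls mult_cls zero_cls
lemmas cauchy_intros = cauchy_add cauchy_scale cauchy_star cauchy_mult cauchy_const

lemma completion_star_algebra: "star_algebra B"
proof
  fix X Y Z and c d :: complex
  show "zero B \<in> carrier B" by (simp add: zero_cls cls_in cauchy_const)
  assume "X \<in> carrier B"
  then obtain x where x: "x \<in> Cs" "X = cls x" by (rule carrierE)
  note cx = cauchy_closed[OF x(1)]
  show "scale B c X \<in> carrier B" "star B X \<in> carrier B"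
    and "X \<oplus>\<^bsub>B\<^esub> zero B = X" "X \<oplus>\<^bsub>B\<^esub> scale B (-1) X = zero B" "scale B 1 X = X"
    and "scale B c (scale B d X) = scale B (c * d) X" "scale B (c + d) X = scale B c X \<oplus>\<^bsub>B\<^esub> scale B d X"
    and "star B (scale B c X) = scale B (cnj c) (star B X)" "star B (star B X) = X"
    using x by (simp_all add: ops_cls cls_in cauchy_intros cx add_zero add_neg scale_one scale_scale
        scale_add_left star_scale star_star)
  assume "Y \<in> carrier B"
  then obtain y where y: "y \<in> Cs" "Y = cls y" by (rule carrierE)
  note cy = cauchy_closed[OF y(1)]
  show "X \<oplus>\<^bsub>B\<^esub> Y \<in> carrier B" "X \<cdot>\<^bsub>B\<^esub> Y \<in> carrier B" "X \<oplus>\<^bsub>B\<^esub> Y = Y \<oplus>\<^bsub>B\<^esub> X"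
    and "scale B c (X \<oplus>\<^bsub>B\<^esub> Y) = scale B c X \<oplus>\<^bsub>B\<^esub> scale B c Y"
    and "scale B c X \<cdot>\<^bsub>B\<^esub> Y = scale B c (X \<cdot>\<^bsub>B\<^esub> Y)" "X \<cdot>\<^bsub>B\<^esub> scale B c Y = scale B c (X \<cdot>\<^bsub>B\<^esub> Y)"
    and "star B (X \<oplus>\<^bsub>B\<^esub> Y) = star B X \<oplus>\<^bsub>B\<^esub> star B Y" "star B (X \<cdot>\<^bsub>B\<^esub> Y) = star B Y \<cdot>\<^bsub>B\<^esub> star B X"
    using x y by (simp_all add: ops_cls cls_in cauchy_intros cx cy add_comm scale_add_right
        scale_mult_left scale_mult_right star_add star_mult)
  assume "Z \<in> carrier B"
  then obtain z where z: "z \<in> Cs" "Z = cls z" by (rule carrierE)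
  note cz = cauchy_closed[OF z(1)]
  show "X \<oplus>\<^bsub>B\<^esub> Y \<oplus>\<^bsub>B\<^esub> Z = X \<oplus>\<^bsub>B\<^esub> (Y \<oplus>\<^bsub>B\<^esub> Z)" "X \<cdot>\<^bsub>B\<^esub> Y \<cdot>\<^bsub>B\<^esub> Z = X \<cdot>\<^bsub>B\<^esub> (Y \<cdot>\<^bsub>B\<^esub> Z)"
    and "X \<cdot>\<^bsub>B\<^esub> (Y \<oplus>\<^bsub>B\<^esub> Z) = X \<cdot>\<^bsub>B\<^esub> Y \<oplus>\<^bsub>B\<^esub> X \<cdot>\<^bsub>B\<^esub> Z" "(X \<oplus>\<^bsub>B\<^esub> Y) \<cdot>\<^bsub>B\<^esub> Z = X \<cdot>\<^bsub>B\<^esub> Z \<oplus>\<^bsub>B\<^esub> Y \<cdot>\<^bsub>B\<^esub> Z"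
    using x y z by (simp_all add: ops_cls cauchy_intros cx cy cz add_assoc mult_assoc distrib_left distrib_right)
qed

lemma diff_cls: "\<lbrakk>x \<in> Cs; y \<in> Cs\<rbrakk> \<Longrightarrow> diff B (cls x) (cls y) = cls (\<lambda>n. diff A (x n) (y n))"
  by (simp add: diff_def ops_cls cauchy_intros)

text \<open>The chosen representative differs from x by a null sequence, so x computes the same
  limit. Identities and inequalities between norms thereby pass from A to the completion.\<close>

lemma norm_cls:
  assumes "x \<in> Cs" shows "(\<lambda>n. p (x n)) \<longlonglongrightarrow> completion_norm p (cls x)"
proof -
  note c = cauchy_closed[OF assms] cauchy_closed[OF rep_cls(1)[OF assms]]
  have 1: "(\<lambda>n. p (rep (cls x) n)) \<longlonglongrightarrow> completion_norm p (cls x)"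
    using cauchy_norm_convergent[OF rep_cls(1)[OF assms]]
    unfolding completion_norm_def by (simp add: convergent_LIMSEQ_iff)
  have "(\<lambda>n. p (rep (cls x) n) - p (x n)) \<longlonglongrightarrow> 0"
    by (rule Lim_null_comparison[OF always_eventually rep_cls(2)[OF assms]])
      (use c abs_p_diff in auto)
  from tendsto_diff[OF 1 this] show ?thesis by simp
qed

lemma completion_normed: "normed_star_algebra B (completion_norm p)"
proof -
  interpret B: star_algebra B by (rule completion_star_algebra)
  have "cstar_seminorm B (completion_norm p)"
    unfolding cstar_seminorm_def
  proof (intro conjI ballI allI)
    fix X Y c assume "X \<in> carrier B"
    then obtain x where x: "x \<in> Cs" "X = cls x" by (rule carrierE)
    note cx = cauchy_closed[OF x(1)]
    note nx = norm_cls[OF x(1)]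
    show "0 \<le> completion_norm p X"
      unfolding x(2) by (rule LIMSEQ_le_const[OF nx]) (simp add: cx)
    show "completion_norm p (scale B c X) = cmod c * completion_norm p X"
      using LIMSEQ_unique[OF norm_cls[OF cauchy_scale[OF x(1)], of c] tendsto_mult_left[OF nx, of "cmod c", folded homog[OF cx]]]
      by (simp add: x scale_cls)
    show "completion_norm p (star B X \<cdot>\<^bsub>B\<^esub> X) = (completion_norm p X)\<^sup>2"
      using LIMSEQ_unique[OF norm_cls[OF cauchy_mult[OF cauchy_star[OF x(1)] x(1)]] tendsto_power[OF nx, of 2, folded cstar_eq[OF cx]]]
      by (simp add: x ops_cls cauchy_intros)
    assume "Y \<in> carrier B"
    then obtain y where y: "y \<in> Cs" "Y = cls y" by (rule carrierE)
    note cy = cauchy_closed[OF y(1)]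
    note ny = norm_cls[OF y(1)]
    show "completion_norm p (X \<oplus>\<^bsub>B\<^esub> Y) \<le> completion_norm p X + completion_norm p Y"
      unfolding x(2) y(2) add_cls[OF x(1) y(1)]
      by (rule LIMSEQ_le[OF norm_cls[OF cauchy_add[OF x(1) y(1)]] tendsto_add[OF nx ny]]) (simp add: subadd cx cy)
    show "completion_norm p (X \<cdot>\<^bsub>B\<^esub> Y) \<le> completion_norm p X * completion_norm p Y"
      unfolding x(2) y(2) mult_cls[OF x(1) y(1)]
      by (rule LIMSEQ_le[OF norm_cls[OF cauchy_mult[OF x(1) y(1)]] tendsto_mult[OF nx ny]]) (simp add: submult cx cy)
  qed
  then show ?thesis
    by (simp add: normed_star_algebra_iff completion_star_algebra topo_completion)
qed

lemma completion_definite: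
  assumes "X \<in> carrier B" "completion_norm p X = 0" shows "X = zero B"
proof -
  obtain x where x: "x \<in> Cs" "X = cls x" using assms(1) by (rule carrierE)
  show ?thesis
    unfolding x(2) zero_cls
    by (rule cls_eqI) (use x norm_cls[OF x(1)] assms(2) cauchy_closed[OF x(1)] in \<open>auto simp: cauchy_const\<close>)
qed

lemma norm_const: "a \<in> carrier A \<Longrightarrow> completion_norm p (cls (\<lambda>n. a)) = p a"
  using LIMSEQ_unique[OF norm_cls[OF cauchy_const]] by blast

lemma norm_diff_const_le:
  assumes x: "x \<in> Cs" and N: "\<And>m. m \<ge> N \<Longrightarrow> p (diff A (x m) a) \<le> e" and a: "a \<in> carrier A"
  shows "completion_norm p (diff B (cls x) (cls (\<lambda>n. a))) \<le> e"
  unfolding diff_cls[OF x cauchy_const[OF a]]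
  by (rule LIMSEQ_le_const2[OF norm_cls[OF cauchy_diff[OF x cauchy_const[OF a]]]]) (use N in auto)

lemma completion_dense:
  assumes "X \<in> carrier B" "e > 0"
  shows "\<exists>a\<in>carrier A. completion_norm p (diff B X (cls (\<lambda>n. a))) < e"
proof -
  obtain x where x: "x \<in> Cs" "X = cls x" using assms(1) by (rule carrierE)
  obtain N where N: "\<forall>m\<ge>N. \<forall>n\<ge>N. p (diff A (x m) (x n)) < e / 2"
    using cauchyD[OF x(1), of "e / 2"] assms(2) by auto
  have "completion_norm p (diff B X (cls (\<lambda>n. x N))) \<le> e / 2"
    unfolding x(2) by (rule norm_diff_const_le[of _ N]) (use N x cauchy_closed[OF x(1)] in \<open>auto intro: less_imp_le\<close>)
  then show ?thesis using assms(2) cauchy_closed[OF x(1), of N] by (intro bexI[of _ "x N"]) auto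
qed

text \<open>Density replaces the Cauchy filter by elements of A: the k-th one is eventually within
  1/(k+1) of the filter. These elements form a Cauchy sequence in A, whose class is already the
  limit, so no diagonal sequence has to be extracted.\<close>

lemma completion_complete: "complete_talg B"
  unfolding complete_talg_def
proof (intro allI impI, elim conjE)
  interpret B: normed_star_algebra B "completion_norm p" by (rule completion_normed)
  let ?N = "completion_norm p"
  fix F assume F: "F \<noteq> bot" and car: "eventually (\<lambda>X. X \<in> carrier B) F"
    and cau: "\<forall>U. openin (topo B) U \<and> zero B \<in> U \<longrightarrow> eventually (\<lambda>(X, Y). diff B X Y \<in> U) (F \<times>\<^sub>F F)"
  have near: "\<exists>a\<in>carrier A. eventually (\<lambda>X. X \<in> carrier B \<and> ?N (diff B X (cls (\<lambda>n. a))) < e) F" if e: "e > 0" for e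
  proof -
    have op: "openin (topo B) {X \<in> carrier B. ?N (diff B X (zero B)) < e / 2}"
      unfolding B.topo_norm
      by (rule openin_seminorm_ball[OF B.star_algebra_axioms B.seminorm]) auto
    have "zero B \<in> {X \<in> carrier B. ?N (diff B X (zero B)) < e / 2}" using e by simp
    then have "eventually (\<lambda>(X, Y). diff B X Y \<in> {X \<in> carrier B. ?N (diff B X (zero B)) < e / 2}) (F \<times>\<^sub>F F)"
      using cau op by blast
    then obtain P Q where PQ: "eventually P F" "eventually Q F"
      "\<And>X Y. P X \<Longrightarrow> Q Y \<Longrightarrow> diff B X Y \<in> {X \<in> carrier B. ?N (diff B X (zero B)) < e / 2}"
      unfolding eventually_prod_filter by auto
    have "eventually (\<lambda>Y. Q Y \<and> Y \<in> carrier B) F" using PQ(2) car by (rule eventually_conj)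
    then obtain Y where Y: "Q Y" "Y \<in> carrier B" using F eventually_happens by blast
    obtain a where a: "a \<in> carrier A" "?N (diff B Y (cls (\<lambda>n. a))) < e / 2"
      using completion_dense[OF Y(2), of "e / 2"] e by auto
    have "eventually (\<lambda>X. X \<in> carrier B \<and> ?N (diff B X (cls (\<lambda>n. a))) < e) F"
      using PQ(1) car
    proof eventually_elim
      case (elim X)
      have "?N (diff B X Y) < e / 2" using PQ(3)[OF elim(1) Y(1)] by auto
      then show ?case
        using B.p_diff_triangle[of X Y "cls (\<lambda>n. a)"] elim Y a(2) cls_in[OF cauchy_const[OF a(1)]] by auto
    qed
    then show ?thesis using a(1) by blast
  qed
  have "\<forall>k. \<exists>a. a \<in> carrier A \<and> eventually (\<lambda>X. X \<in> carrier B \<and> ?N (diff B X (cls (\<lambda>n. a))) < 1 / real (Suc k)) F"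
  proof
    fix k
    have "0 < 1 / real (Suc k)" by simp
    from near[OF this] show "\<exists>a. a \<in> carrier A \<and> eventually (\<lambda>X. X \<in> carrier B \<and> ?N (diff B X (cls (\<lambda>n. a))) < 1 / real (Suc k)) F"
      by blast
  qed
  from choice[OF this] obtain a where a': "\<forall>k. a k \<in> carrier A \<and>
    eventually (\<lambda>X. X \<in> carrier B \<and> ?N (diff B X (cls (\<lambda>n. a k))) < 1 / real (Suc k)) F" ..
  have a: "a k \<in> carrier A"
    "eventually (\<lambda>X. X \<in> carrier B \<and> ?N (diff B X (cls (\<lambda>n. a k))) < 1 / real (Suc k)) F" for k
    using a' by blast+
  have ca: "cls (\<lambda>n. a k) \<in> carrier B" for k by (rule cls_in[OF cauchy_const[OF a(1)]])
  have dist: "p (diff A (a k) (a l)) \<le> 1 / real (Suc k) + 1 / real (Suc l)" for k l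
  proof -
    obtain X where X: "X \<in> carrier B" "?N (diff B X (cls (\<lambda>n. a k))) < 1 / real (Suc k)" "?N (diff B X (cls (\<lambda>n. a l))) < 1 / real (Suc l)"
      using eventually_happens[OF eventually_conj[OF a(2)[of k] a(2)[of l]]] F by blast
    have "p (diff A (a k) (a l)) = ?N (diff B (cls (\<lambda>n. a k)) (cls (\<lambda>n. a l)))"
      by (simp add: diff_cls cauchy_const a norm_const)
    also have "\<dots> \<le> ?N (diff B (cls (\<lambda>n. a k)) X) + ?N (diff B X (cls (\<lambda>n. a l)))"
      by (rule B.p_diff_triangle) (use ca X in auto)
    also have "?N (diff B (cls (\<lambda>n. a k)) X) = ?N (diff B X (cls (\<lambda>n. a k)))"
      by (rule B.p_diff_commute) (use ca X in auto)
    finally show ?thesis using X by simp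
  qed
  have small: "\<exists>K. \<forall>k\<ge>K. 1 / real (Suc k) < e" if "e > 0" for e :: real
  proof -
    obtain K where K: "inverse (real (Suc K)) < e" using reals_Archimedean[OF \<open>e > 0\<close>] by blast
    have "1 / real (Suc k) < e" if "k \<ge> K" for k
    proof -
      have "1 / real (Suc k) \<le> 1 / real (Suc K)" using that by (intro divide_left_mono) auto
      then show ?thesis using K by (simp add: inverse_eq_divide)
    qed
    then show ?thesis by blast
  qed
  have aC: "a \<in> Cs"
  proof -
    have "\<exists>K. \<forall>m\<ge>K. \<forall>n\<ge>K. p (diff A (a m) (a n)) < e" if e: "e > 0" for e :: real
    proof -
      obtain K where K: "\<forall>k\<ge>K. 1 / real (Suc k) < e / 2" using small[of "e / 2"] e by auto
      have "p (diff A (a m) (a n)) < e" if "m \<ge> K" "n \<ge> K" for m n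
        using dist[of m n] K[rule_format, of m] K[rule_format, of n] that by linarith
      then show ?thesis by blast
    qed
    then show ?thesis using a(1) by (simp add: cauchy_seqs_def)
  qed
  have "limitin (topo B) (\<lambda>X. X) (cls a) F"
    unfolding B.topo_norm
  proof (rule limitin_seminorm_topologyI[OF cls_in[OF aC] car])
    fix q and e :: real assume q: "q \<in> {?N}" and e: "e > 0"
    obtain K where K: "\<forall>k\<ge>K. 1 / real (Suc k) < e / 3" using small[of "e / 3"] e by auto
    have K1: "1 / real (Suc K) < e / 3" using K by blast
    \<comment> \<open>\<open>dist\<close> contributes two terms below e/3; the last third is the
      distance from X to the class of the constant \<open>a K\<close>.\<close>
    have le: "?N (diff B (cls a) (cls (\<lambda>n. a K))) \<le> 2 * e / 3"
    proof (rule norm_diff_const_le[OF aC _ a(1)])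
      fix m assume "m \<ge> K"
      then show "p (diff A (a m) (a K)) \<le> 2 * e / 3"
        using dist[of m K] K[rule_format, of m] K1 by linarith
    qed
    show "eventually (\<lambda>X. q (diff B X (cls a)) < e) F"
      using a(2)[of K]
    proof eventually_elim
      case (elim X)
      have "?N (diff B X (cls a)) \<le> ?N (diff B X (cls (\<lambda>n. a K))) + ?N (diff B (cls (\<lambda>n. a K)) (cls a))"
        by (rule B.p_diff_triangle) (use elim ca cls_in[OF aC] in auto)
      also have "?N (diff B (cls (\<lambda>n. a K)) (cls a)) = ?N (diff B (cls a) (cls (\<lambda>n. a K)))"
        by (rule B.p_diff_commute) (use ca cls_in[OF aC] in auto)
      finally show ?case using elim le K1 q by auto
    qed
  qed
  then show "\<exists>X. limitin (topo B) (\<lambda>X. X) X F" by blast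
qed

end

lemma normed_Hausdorff:
  assumes "normed_star_algebra A p" and definite: "\<And>x. \<lbrakk>x \<in> carrier A; p x = 0\<rbrakk> \<Longrightarrow> x = zero A"
  shows "Hausdorff_space (topo A)"
proof -
  interpret normed_star_algebra A p by fact
  show ?thesis
    unfolding Hausdorff_space_def
  proof (intro allI impI)
    fix x y assume "x \<in> topspace (topo A) \<and> y \<in> topspace (topo A) \<and> x \<noteq> y"
    then have xy: "x \<in> carrier A" "y \<in> carrier A" "x \<noteq> y" by auto
    define d where "d = p (diff A x y)"
    have "d \<noteq> 0" using definite[of "diff A x y"] diff_eq_zeroD xy by (auto simp: d_def)
    moreover have "d \<ge> 0" using xy by (simp add: d_def)
    ultimately have d: "d > 0" by simp
    let ?U = "\<lambda>z. {w \<in> carrier A. p (diff A w z) < d / 2}"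
    have "openin (topo A) (?U z)" if "z \<in> carrier A" for z
      unfolding topo_norm by (rule openin_seminorm_ball[OF star_algebra_axioms seminorm _ that]) simp
    moreover have "disjnt (?U x) (?U y)"
    proof -
      have False if "w \<in> carrier A" "p (diff A w x) < d / 2" "p (diff A w y) < d / 2" for w
        using p_diff_triangle[of x w y] p_diff_commute[of x w] that xy by (simp add: d_def)
      then show ?thesis by (auto simp: disjnt_def)
    qed
    ultimately show "\<exists>U V. openin (topo A) U \<and> openin (topo A) V \<and> x \<in> U \<and> y \<in> V \<and> disjnt U V"
      using xy d by (intro exI[of _ "?U x"] exI[of _ "?U y"]) auto
  qed
qed

lemma (in cstar_seminormed) completion_cstar: "cstar_algebra B"
  using completion_normed completion_complete normed_Hausdorff[OF completion_normed completion_definite]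
  by (auto simp: cstar_algebra_def normed_star_algebra_iff)

text \<open>Serves twice: with p = q and the maps of the action, and with the identity map and q
  \<le> p for the connecting maps.\<close>

lemma completion_map_props:
  assumes "star_algebra A" "cstar_seminorm A p" "cstar_seminorm A q" "star_hom A A \<phi>"
    and "\<forall>a\<in>carrier A. q (\<phi> a) \<le> p a"
  shows completion_map_cls: "x \<in> cauchy_seqs A p \<Longrightarrow>
      (\<lambda>n. \<phi> (x n)) \<in> cauchy_seqs A q \<and> completion_map A q \<phi> (null_class A p x) = null_class A q (\<lambda>n. \<phi> (x n))"
    and completion_map_hom: "star_hom (completion A p) (completion A q) (completion_map A q \<phi>)"
    and completion_map_le: "X \<in> carrier (completion A p) \<Longrightarrow>
      completion_norm q (completion_map A q \<phi> X) \<le> completion_norm p X"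
proof -
  interpret P: cstar_seminormed A p using assms by (simp add: cstar_seminormed_def cstar_seminormed_axioms_def)
  interpret Q: cstar_seminormed A q using assms by (simp add: cstar_seminormed_def cstar_seminormed_axioms_def)
  note hom = star_homD[OF assms(4)]
  have le: "\<And>a. a \<in> carrier A \<Longrightarrow> q (\<phi> a) \<le> p a" using assms(5) by blast
  have dle: "q (diff A (\<phi> a) (\<phi> b)) \<le> p (diff A a b)" if "a \<in> carrier A" "b \<in> carrier A" for a b
    using le[of "diff A a b"] that by (simp add: star_hom_diff[OF assms(4,1)])
  have in_Cs: "(\<lambda>n. \<phi> (x n)) \<in> cauchy_seqs A q" if x: "x \<in> cauchy_seqs A p" for x
  proof -
    have "\<exists>N. \<forall>m\<ge>N. \<forall>n\<ge>N. q (diff A (\<phi> (x m)) (\<phi> (x n))) < e" if "e > 0" for e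
      using P.cauchyD[OF x that] dle[OF P.cauchy_closed[OF x] P.cauchy_closed[OF x]] by (meson order_le_less_trans)
    then show ?thesis using P.cauchy_closed[OF x] by (simp add: cauchy_seqs_def hom)
  qed
  have map_cls: "completion_map A q \<phi> (null_class A p x) = null_class A q (\<lambda>n. \<phi> (x n))"
    if x: "x \<in> cauchy_seqs A p" for x
    unfolding completion_map_def
  proof (rule Q.cls_eqI[OF in_Cs[OF P.rep_cls(1)[OF x]] in_Cs[OF x]])
    note c = P.cauchy_closed[OF x] P.cauchy_closed[OF P.rep_cls(1)[OF x]]
    show "(\<lambda>n. q (diff A (\<phi> (rep (null_class A p x) n)) (\<phi> (x n)))) \<longlonglongrightarrow> 0"
      by (rule tendsto_0_le[OF P.rep_cls(2)[OF x]]) (use c in \<open>auto simp: hom intro!: dle\<close>)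
  qed
  then show "x \<in> cauchy_seqs A p \<Longrightarrow> (\<lambda>n. \<phi> (x n)) \<in> cauchy_seqs A q \<and>
      completion_map A q \<phi> (null_class A p x) = null_class A q (\<lambda>n. \<phi> (x n))"
    using in_Cs by blast
  show "star_hom (completion A p) (completion A q) (completion_map A q \<phi>)"
  proof (rule star_homI)
    fix X Y c assume "X \<in> carrier (completion A p)"
    then obtain x where x: "x \<in> cauchy_seqs A p" "X = null_class A p x" by (rule P.carrierE)
    note cx = P.cauchy_closed[OF x(1)]
    show "completion_map A q \<phi> X \<in> carrier (completion A q)"
      using x by (simp add: map_cls Q.cls_in in_Cs)
    show "completion_map A q \<phi> (scale (completion A p) c X) = scale (completion A q) c (completion_map A q \<phi> X)"
      "completion_map A q \<phi> (star (completion A p) X) = star (completion A q) (completion_map A q \<phi> X)"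
      using x by (simp_all add: map_cls P.ops_cls Q.ops_cls in_Cs P.cauchy_intros hom cx)
    assume "Y \<in> carrier (completion A p)"
    then obtain y where y: "y \<in> cauchy_seqs A p" "Y = null_class A p y" by (rule P.carrierE)
    note cy = P.cauchy_closed[OF y(1)]
    show "completion_map A q \<phi> (X \<oplus>\<^bsub>completion A p\<^esub> Y) = completion_map A q \<phi> X \<oplus>\<^bsub>completion A q\<^esub> completion_map A q \<phi> Y"
      "completion_map A q \<phi> (X \<cdot>\<^bsub>completion A p\<^esub> Y) = completion_map A q \<phi> X \<cdot>\<^bsub>completion A q\<^esub> completion_map A q \<phi> Y"
      using x y by (simp_all add: map_cls P.ops_cls Q.ops_cls in_Cs P.cauchy_intros hom cx cy)
  qed
  assume "X \<in> carrier (completion A p)"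
  then obtain x where x: "x \<in> cauchy_seqs A p" "X = null_class A p x" by (rule P.carrierE)
  show "completion_norm q (completion_map A q \<phi> X) \<le> completion_norm p X"
    unfolding x(2) map_cls[OF x(1)]
    by (rule LIMSEQ_le[OF Q.norm_cls[OF in_Cs[OF x(1)]] P.norm_cls[OF x(1)]])
      (use le P.cauchy_closed[OF x(1)] in blast)
qed

section \<open>Approximation by elementary tensors\<close>

text \<open>Sums grow by one elementary tensor at a time, so additive identities spread from
  elementary tensors by induction.\<close>

inductive_set elem_span :: "('a, 'm) talg_scheme \<Rightarrow> ('x::topological_space \<Rightarrow> 'a) set" for A where
  zero: "(\<lambda>x. zero A) \<in> elem_span A"
| step: "\<lbrakk>a \<in> carrier A; f \<in> carrier C0; h \<in> elem_span A\<rbrakk>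
    \<Longrightarrow> (\<lambda>x. elem_tensor A a f x \<oplus>\<^bsub>A\<^esub> h x) \<in> elem_span A"

context lc_star_algebra
begin

context
  assumes compact_UNIV: "compact (UNIV :: 'x::topological_space set)"
begin

lemma elem_span_C0: "h \<in> elem_span A \<Longrightarrow> (h :: 'x \<Rightarrow> 'a) \<in> C0_carrier A"
proof (induction rule: elem_span.induct)
  case zero
  then show ?case using const_C0[OF compact_UNIV] by blast
next
  case (step a f h)
  interpret T: star_algebra "tensor_C0 A :: ('x \<Rightarrow> 'a) talg" by (rule tensor_C0_star_algebra[OF compact_UNIV])
  show ?case using T.add_closed[of "elem_tensor A a f" h] step elem_tensor_C0[OF compact_UNIV] by simp
qed

text \<open>The sum of the f i times h, minus the sum of f i \<otimes> a i, is the sum of f i (h - a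
  i). For a partition of unity only the local approximation errors remain.\<close>

lemma elem_span_combination:
  fixes h :: "'x \<Rightarrow> 'a"
  assumes r: "r \<in> cont_seminorms A" and h: "\<And>y. h y \<in> carrier A"
    and "finite T" "\<And>i. i \<in> T \<Longrightarrow> a i \<in> carrier A" "\<And>i. i \<in> T \<Longrightarrow> f i \<in> carrier C0"
  shows "\<exists>k\<in>elem_span A. \<forall>y. r (diff A (scale A (\<Sum>i\<in>T. f i y) (h y)) (k y)) \<le>
    (\<Sum>i\<in>T. cmod (f i y) * r (diff A (h y) (a i)))"
  using assms(3-5)
proof (induction T)
  case empty
  interpret cstar_seminormed A r using r by (rule cont_seminormed)
  show ?case using elem_span.zero[of A] h by (intro bexI[of _ "\<lambda>x. \<zero>"]) auto
next
  case (insert i T)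
  interpret cstar_seminormed A r using r by (rule cont_seminormed)
  obtain k where k: "k \<in> elem_span A" "\<And>y. r (diff A (scale A (\<Sum>i\<in>T. f i y) (h y)) (k y)) \<le>
    (\<Sum>i\<in>T. cmod (f i y) * r (diff A (h y) (a i)))"
    using insert.IH insert.prems by auto
  have kc: "k y \<in> carrier A" for y using elem_span_C0[OF k(1)] by (rule C0_carrierD)
  have ai: "a i \<in> carrier A" and fi: "f i \<in> carrier C0" using insert.prems by auto
  show ?case
  proof (intro bexI[OF _ elem_span.step[OF ai fi k(1)]] allI)
    fix y
    have "r (diff A (scale A (\<Sum>i\<in>insert i T. f i y) (h y)) (elem_tensor A (a i) (f i) y \<oplus> k y))
        = r (scale A (f i y) (diff A (h y) (a i)) \<oplus> diff A (scale A (\<Sum>i\<in>T. f i y) (h y)) (k y))"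
      using insert.hyps h ai kc by (simp add: scale_add_left diff_add elem_tensor_def diff_scale)
    also have "\<dots> \<le> cmod (f i y) * r (diff A (h y) (a i)) + (\<Sum>i\<in>T. cmod (f i y) * r (diff A (h y) (a i)))"
      by (rule order_trans[OF subadd add_mono]) (use h ai kc k(2) in \<open>auto simp: homog\<close>)
    finally show "r (diff A (scale A (\<Sum>i\<in>insert i T. f i y) (h y)) (elem_tensor A (a i) (f i) y \<oplus> k y))
        \<le> (\<Sum>i\<in>insert i T. cmod (f i y) * r (diff A (h y) (a i)))"
      using insert.hyps by simp
  qed
qed

text \<open>The partition of unity is built from the functions \<open>y \<mapsto> max 0 (e - r (h y - h x))\<close>.\<close>

lemma elem_span_dense:
  fixes h :: "'x \<Rightarrow> 'a"
  assumes h: "h \<in> C0_carrier A" and r: "r \<in> cont_seminorms A" and e: "e > 0"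
  shows "\<exists>k\<in>elem_span A. sup_seminorm r (diff (tensor_C0 A) h k) \<le> e"
proof -
  interpret cstar_seminormed A r using r by (rule cont_seminormed)
  have hc: "h y \<in> carrier A" for y using h by (rule C0_carrierD)
  define g where "g x y = max 0 (e - r (diff A (h y) (h x)))" for x y
  have g_cont: "continuous_on UNIV (g x)" for x
  proof -
    interpret T: star_algebra "tensor_C0 A :: ('x \<Rightarrow> 'a) talg" by (rule tensor_C0_star_algebra[OF compact_UNIV])
    have "(\<lambda>y. diff A (h y) (h x)) \<in> C0_carrier A"
      using T.diff_closed[of h "\<lambda>_. h x"] h const_C0[OF compact_UNIV hc] by simp
    then show ?thesis
      unfolding g_def by (intro continuous_intros C0_carrier_continuous[OF _ r])
  qed
  have g0: "0 \<le> g x y" for x y by (simp add: g_def)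
  have g1: "r (diff A (h y) (h x)) < e" if "g x y \<noteq> 0" for x y using that by (auto simp: g_def max_def split: if_splits)
  have "open {y. g x y > 0}" for x
    using g_cont[of x] by (auto intro!: open_Collect_less)
  \<comment> \<open>At y the function centred at y itself has the value e.\<close>
  moreover have "UNIV \<subseteq> (\<Union>x\<in>UNIV. {y. g x y > 0})"
    using e hc by (auto simp: g_def)
  ultimately obtain T where T: "finite T" "UNIV \<subseteq> (\<Union>x\<in>T. {y. g x y > 0})"
    using compactE_image[OF compact_UNIV, of UNIV "\<lambda>x. {y. g x y > 0}"] by metis
  define G where "G y = (\<Sum>x\<in>T. g x y)" for y
  have G: "G y > 0" for y
  proof -
    obtain x where "x \<in> T" "g x y > 0" using T(2) by blast
    then show ?thesis unfolding G_def using T(1) g0 by (intro sum_pos2[of T x]) auto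
  qed
  define f where "f x y = complex_of_real (g x y / G y)" for x y
  have f: "f x \<in> carrier C0" for x
    unfolding carrier_C0_iff[OF compact_UNIV] f_def G_def
    by (intro continuous_intros g_cont) (use G in \<open>auto simp: G_def less_imp_neq[symmetric]\<close>)
  have fnorm: "cmod (f x y) = g x y / G y" for x y
    unfolding f_def norm_of_real using g0[of x y] G[of y] by simp
  have fsum: "(\<Sum>x\<in>T. g x y / G y) = 1" for y
    using G[of y] by (simp add: G_def flip: sum_divide_distrib)
  then have fsum': "(\<Sum>x\<in>T. f x y) = 1" for y
    by (simp add: f_def flip: of_real_sum of_real_divide)
  obtain k where k: "k \<in> elem_span A" "\<forall>y. r (diff A (scale A (\<Sum>x\<in>T. f x y) (h y)) (k y)) \<le>
      (\<Sum>x\<in>T. cmod (f x y) * r (diff A (h y) (h x)))"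
    using elem_span_combination[of r h T h f, OF r hc T(1) hc f] by blast
  have "r (diff A (h y) (k y)) \<le> e" for y
  proof -
    have "r (diff A (h y) (k y)) \<le> (\<Sum>x\<in>T. g x y / G y * r (diff A (h y) (h x)))"
      using k(2)[rule_format, of y] hc by (simp add: fsum' scale_one fnorm)
    also have "\<dots> \<le> (\<Sum>x\<in>T. g x y / G y * e)"
    proof (rule sum_mono)
      fix x show "g x y / G y * r (diff A (h y) (h x)) \<le> g x y / G y * e"
        using g1[of x y] g0[of x y] G[of y] by (cases "g x y = 0") (auto intro!: divide_right_mono mult_left_mono)
    qed
    also have "\<dots> = (\<Sum>x\<in>T. g x y / G y) * e" by (rule sum_distrib_right[symmetric])
    also have "\<dots> = e" using fsum[of y] by simp
    finally show ?thesis .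
  qed
  then show ?thesis using k(1) by (intro bexI[of _ k]) (auto intro: sup_seminorm_le[OF compact_UNIV])
qed

end

section \<open>Morphisms into multiplier algebras\<close>

lemma mult_seminorm_seminorm:
  assumes p: "p \<in> cont_seminorms A"
  shows "seminorm_on (mult_algebra A) (mult_seminorm A p)"
proof -
  interpret cstar_seminormed A p using p by (rule cont_seminormed)
  interpret M: star_algebra "mult_algebra A" by (rule mult_algebra_star_algebra)
  have scale: "mult_seminorm A p (scale (mult_algebra A) c m) \<le> cmod c * mult_seminorm A p m"
    if m: "m \<in> multipliers A" for c m
    by (rule mult_seminorm_le[OF p])
      (use mult_seminorm_bound[OF m p] mult_seminorm_nonneg[OF m p] multiplier_fst_closed[OF m] in
        \<open>auto simp: homog mult.assoc intro: mult_left_mono\<close>)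
  show ?thesis
    unfolding seminorm_on_def
  proof (intro conjI ballI allI)
    fix m n c assume m: "m \<in> carrier (mult_algebra A)"
    then have m': "m \<in> multipliers A" by simp
    show "0 \<le> mult_seminorm A p m" by (rule mult_seminorm_nonneg[OF m' p])
    show "mult_seminorm A p (scale (mult_algebra A) c m) = cmod c * mult_seminorm A p m"
    proof (cases "c = 0")
      case True
      then show ?thesis
        using scale[OF m', of 0] mult_seminorm_nonneg[OF _ p, of "scale (mult_algebra A) 0 m"] M.scale_closed[OF m, of 0]
        by (simp del: mult_algebra_simps add: mult_algebra_simps(1))
    next
      case False
      have "mult_seminorm A p m = mult_seminorm A p (scale (mult_algebra A) (1 / c) (scale (mult_algebra A) c m))"
        using False m by (simp del: mult_algebra_simps add: M.scale_scale M.scale_one)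
      also have "\<dots> \<le> cmod (1 / c) * mult_seminorm A p (scale (mult_algebra A) c m)"
        by (rule scale) (use M.scale_closed[OF m, of c] in \<open>simp only: mult_algebra_simps(1)\<close>)
      finally have "cmod c * mult_seminorm A p m \<le> mult_seminorm A p (scale (mult_algebra A) c m)"
        using False by (simp del: mult_algebra_simps add: norm_divide field_simps)
      then show ?thesis using scale[OF m', of c] by (simp del: mult_algebra_simps)
    qed
    assume n: "n \<in> carrier (mult_algebra A)"
    then have n': "n \<in> multipliers A" by simp
    show "mult_seminorm A p (m \<oplus>\<^bsub>mult_algebra A\<^esub> n) \<le> mult_seminorm A p m + mult_seminorm A p n"
    proof (rule mult_seminorm_le[OF p])
      fix a assume a: "a \<in> carrier A"
      then have "p (fst m a \<oplus> fst n a) \<le> mult_seminorm A p m * p a + mult_seminorm A p n * p a"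
        by (intro order_trans[OF subadd add_mono] mult_seminorm_bound m' n' p multiplier_fst_closed[of _ A])
      then show "p (fst (m \<oplus>\<^bsub>mult_algebra A\<^esub> n) a) \<le> (mult_seminorm A p m + mult_seminorm A p n) * p a"
        using a by (simp add: semiring_class.distrib_right)
    qed (simp add: mult_seminorm_nonneg[OF m' p] mult_seminorm_nonneg[OF n' p])
  qed
qed

text \<open>The lower bound comes from testing on \<open>star A a\<close>: by the C*-identity, a a*
  has the square of p a as its seminorm. Operator seminorms of embedded functions can thus be read
  as sup seminorms.\<close>

lemma mult_seminorm_embed:
  assumes a: "a \<in> carrier A" and p: "p \<in> cont_seminorms A"
  shows "mult_seminorm A p (mult_embed A a) = p a"
proof (rule antisym[OF mult_seminorm_embed_le[OF a p]])
  interpret cstar_seminormed A p using p by (rule cont_seminormed)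
  have "(p a)\<^sup>2 = p (a \<cdot> star A a)" using cstar_eq[of "star A a"] a by (simp add: star_star)
  also have "\<dots> \<le> mult_seminorm A p (mult_embed A a) * p a"
    using mult_seminorm_bound[OF mult_embed_in[OF a] p, of "star A a"] a by (simp add: mult_embed_def)
  finally show "p a \<le> mult_seminorm A p (mult_embed A a)"
    using nonneg[OF a] mult_seminorm_nonneg[OF mult_embed_in[OF a] p]
    by (cases "p a = 0") (auto simp: power2_eq_square)
qed

text \<open>Continuity at zero in terms of a generating family of the domain, the form in which the
  density argument and the continuity of orbit seminorms use a morphism.\<close>

lemma morphism_mult_small:
  assumes "morphism C (mult_algebra A) \<Phi>" "star_algebra C" "topo C = seminorm_topology C P"
    and p: "p \<in> cont_seminorms A" and e: "e > 0"
  shows "\<exists>F d. finite F \<and> F \<subseteq> P \<and> d > 0 \<and>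
    (\<forall>x\<in>carrier C. (\<forall>q\<in>F. q x < d) \<longrightarrow> mult_seminorm A p (\<Phi> x) < e)"
proof -
  interpret M: star_algebra "mult_algebra A" by (rule mult_algebra_star_algebra)
  interpret C: star_algebra C by fact
  have hom: "star_hom C (mult_algebra A) \<Phi>" and
    cont: "continuous_map (seminorm_topology C P) (seminorm_topology (mult_algebra A) (mult_seminorm A ` cont_seminorms A)) \<Phi>"
    using assms(1,3) by (simp_all add: morphism_iff topo_mult_algebra)
  have z: "\<Phi> (zero C) = zero (mult_algebra A)" by (rule star_hom_zero[OF hom assms(2) M.star_algebra_axioms])
  obtain V where V: "openin (seminorm_topology C P) V" "zero C \<in> V"
    "\<forall>y\<in>V. mult_seminorm A p (diff (mult_algebra A) (\<Phi> y) (\<Phi> (zero C))) < e"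
    using continuous_map_into_seminormD[OF M.star_algebra_axioms mult_seminorm_seminorm[OF p] _ cont _ e, of "zero C"] p by auto
  obtain F d where F: "finite F" "F \<subseteq> P" "d > 0" "{y \<in> carrier C. \<forall>q\<in>F. q (diff C y (zero C)) < d} \<subseteq> V"
    using V(1,2) unfolding openin_seminorm_topology by blast
  have "mult_seminorm A p (\<Phi> x) < e" if "x \<in> carrier C" "\<forall>q\<in>F. q x < d" for x
  proof -
    have "x \<in> V" using F(4) that by auto
    then show ?thesis using V(3) that(1) star_hom_closed[OF hom that(1)] by (auto simp: z simp del: mult_algebra_simps)
  qed
  then show ?thesis using F by blast
qed

text \<open>Morphisms from \<open>C(G, A)\<close> to \<open>M(C(G, C(G, A)))\<close> are compared with explicit formulas by applying
  both to a constant function and evaluating at a point.\<close>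

lemma morphism_tensor_determined:
  fixes L :: "('x::topological_space \<Rightarrow> 'a) \<Rightarrow> 'a" and t s :: 'x
  assumes cpt: "compact (UNIV :: 'x set)"
    and \<Phi>: "morphism (tensor_C0 A) (mult_algebra (tensor_C0 (tensor_C0 A))) (\<Phi> :: ('x \<Rightarrow> 'a) \<Rightarrow> ('x \<Rightarrow> 'x \<Rightarrow> 'a) multiplier)"
    and L_closed: "\<And>h. h \<in> C0_carrier A \<Longrightarrow> L h \<in> carrier A"
    and L_add: "\<And>g h. \<lbrakk>g \<in> C0_carrier A; h \<in> C0_carrier A\<rbrakk> \<Longrightarrow> L (\<lambda>x. g x \<oplus> h x) = L g \<oplus> L h"
    and L_zero: "L (\<lambda>x. \<zero>) = \<zero>"
    and L_bound: "\<And>p. p \<in> cont_seminorms A \<Longrightarrow>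
      \<exists>r\<in>cont_seminorms A. \<forall>h\<in>C0_carrier A. p (L h) \<le> sup_seminorm r h"
    and elem: "\<And>a f. \<lbrakk>a \<in> carrier A; f \<in> carrier C0\<rbrakk> \<Longrightarrow>
      fst (\<Phi> (elem_tensor A a f)) (\<lambda>t s. e) t s = L (elem_tensor A a f) \<cdot> e"
    and faithful: "\<And>x. \<lbrakk>x \<in> carrier A; \<forall>p\<in>cont_seminorms A. p x = 0\<rbrakk> \<Longrightarrow> x = \<zero>"
    and e: "e \<in> carrier A" and h: "h \<in> C0_carrier A"
  shows "fst (\<Phi> h) (\<lambda>t s. e) t s = L h \<cdot> e"
proof -
  let ?X = "tensor_C0 A :: ('x \<Rightarrow> 'a) talg" and ?Y = "tensor_C0 (tensor_C0 A) :: ('x \<Rightarrow> 'x \<Rightarrow> 'a) talg"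
  interpret X: lc_star_algebra ?X by (rule tensor_C0_lc[OF cpt])
  interpret Y: lc_star_algebra ?Y by (rule X.tensor_C0_lc[OF cpt])
  let ?H = "\<lambda>(t::'x) (s::'x). e"
  have H: "?H \<in> C0_carrier ?X" using X.const_C0[OF cpt, of "\<lambda>s. e"] const_C0[OF cpt e] by simp
  have hom: "star_hom ?X (mult_algebra ?Y) \<Phi>" using \<Phi> by (simp add: morphism_iff)
  define \<Psi> where "\<Psi> g = fst (\<Phi> g) ?H t s" for g
  have \<Phi>_in: "\<Phi> g \<in> multipliers ?Y" if "g \<in> C0_carrier A" for g
    using star_hom_closed[OF hom] that by simp
  have \<Phi>H: "fst (\<Phi> g) ?H \<in> C0_carrier ?X" if "g \<in> C0_carrier A" for g
    using multiplier_fst_closed[OF \<Phi>_in[OF that], of ?H] H by simp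
  have \<Psi>_closed: "\<Psi> g \<in> carrier A" if "g \<in> C0_carrier A" for g
    using C0_carrierD[OF \<Phi>H[OF that], of t] C0_carrierD[of "fst (\<Phi> g) ?H t" A s] by (simp add: \<Psi>_def)
  have \<Psi>_add: "\<Psi> (\<lambda>x. g x \<oplus> k x) = \<Psi> g \<oplus> \<Psi> k" if "g \<in> C0_carrier A" "k \<in> C0_carrier A" for g k
    using star_hom_add[OF hom, of g k] that H by (simp add: \<Psi>_def)
  have \<Psi>_zero: "\<Psi> (\<lambda>x. \<zero>) = \<zero>"
    using star_hom_zero[OF hom X.star_algebra_axioms Y.mult_algebra_star_algebra] H by (simp add: \<Psi>_def)
  have span: "\<Psi> k = L k \<cdot> e" if "k \<in> elem_span A" for k
    using that
  proof (induction rule: elem_span.induct)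
    case zero
    then show ?case using e by (simp add: \<Psi>_zero L_zero)
  next
    case (step a f k)
    note c = elem_tensor_C0[OF cpt step(1,2)] elem_span_C0[OF cpt step(3)]
    have "\<Psi> (elem_tensor A a f) = L (elem_tensor A a f) \<cdot> e" using elem[OF step(1,2)] by (simp add: \<Psi>_def)
    then show ?case using step.IH e by (simp add: \<Psi>_add[OF c] L_add[OF c] distrib_right L_closed c)
  qed
  have "p (diff A (\<Psi> h) (L h \<cdot> e)) = 0" if p: "p \<in> cont_seminorms A" for p
  proof -
    interpret cstar_seminormed A p using p by (rule cont_seminormed)
    have p1: "sup_seminorm p \<in> cont_seminorms ?X" by (rule sup_seminorm_cont[OF cpt p])
    have p2: "sup_seminorm (sup_seminorm p) \<in> cont_seminorms ?Y" by (rule X.sup_seminorm_cont[OF cpt p1])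
    obtain r0 where r0: "r0 \<in> cont_seminorms A" "\<forall>h\<in>C0_carrier A. p (L h) \<le> sup_seminorm r0 h"
      using L_bound[OF p] by blast
    \<comment> \<open>h is split into k, a sum of elementary tensors where both sides agree, and a
      remainder g that is small for \<open>\<Phi>\<close> and for \<open>L\<close>.\<close>
    have main: "p (diff A (\<Psi> h) (L h \<cdot> e)) \<le> \<epsilon> * (2 * p e)" if \<epsilon>: "\<epsilon> > 0" for \<epsilon>
    proof -
      obtain F d where F: "finite F" "F \<subseteq> sup_seminorm ` cont_seminorms A" "d > 0"
        "\<forall>g\<in>carrier ?X. (\<forall>q\<in>F. q g < d) \<longrightarrow> mult_seminorm ?Y (sup_seminorm (sup_seminorm p)) (\<Phi> g) < \<epsilon>"
        using Y.morphism_mult_small[OF \<Phi> X.star_algebra_axioms topo_tensor_C0 p2 \<epsilon>] by blast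
      obtain F0 where F0: "finite F0" "F0 \<subseteq> cont_seminorms A" "F = sup_seminorm ` F0"
        using finite_subset_image[OF F(1,2)] by auto
      \<comment> \<open>One seminorm dominates those controlling \<open>\<Phi>\<close> and the one
        controlling \<open>L\<close>, so a single approximation serves both.\<close>
      obtain r where r: "r \<in> cont_seminorms A" "\<forall>q\<in>insert r0 F0. \<forall>x. q x \<le> r x"
        using cont_seminorms_finite_bound[OF star_algebra_axioms, of "insert r0 F0"] F0 r0(1) by auto
      have sup_mono: "sup_seminorm q g \<le> sup_seminorm r g" if "q \<in> insert r0 F0" "g \<in> C0_carrier A" for q and g :: "'x \<Rightarrow> 'a"
        by (rule sup_seminorm_le[OF cpt]) (use r le_sup_seminorm[OF cpt that(2) r(1)] that(1) in \<open>blast intro: order_trans\<close>)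
      \<comment> \<open>The bound d/2 yields the strict inequality required for
        \<open>\<Phi> g\<close>, and \<epsilon> bounds \<open>L g\<close>.\<close>
      obtain k where k: "k \<in> elem_span A" "sup_seminorm r (diff ?X h k) \<le> min (d / 2) \<epsilon>"
        using elem_span_dense[OF cpt h r(1), of "min (d / 2) \<epsilon>"] F(3) \<epsilon> by auto
      have kc: "k \<in> C0_carrier A" by (rule elem_span_C0[OF cpt k(1)])
      define g where "g = diff ?X h k"
      have gc: "g \<in> C0_carrier A" using X.diff_closed[of h k] h kc by (simp add: g_def)
      have hg: "h = (\<lambda>x. g x \<oplus> k x)" using C0_carrierD[OF h] C0_carrierD[OF kc] by (simp add: g_def)
      have "sup_seminorm q g < d" if "q \<in> F0" for q
        using sup_mono[of q g] that k(2) F(3) gc unfolding g_def by auto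
      then have "mult_seminorm ?Y (sup_seminorm (sup_seminorm p)) (\<Phi> g) < \<epsilon>"
        using F(4) gc F0(3) by auto
      then have ms: "mult_seminorm ?Y (sup_seminorm (sup_seminorm p)) (\<Phi> g) \<le> \<epsilon>" by simp
      have "p (\<Psi> g) \<le> sup_seminorm p (fst (\<Phi> g) ?H t)"
        unfolding \<Psi>_def using C0_carrierD[OF \<Phi>H[OF gc], of t] by (intro le_sup_seminorm[OF cpt _ p]) simp
      also have "\<dots> \<le> sup_seminorm (sup_seminorm p) (fst (\<Phi> g) ?H)"
        by (rule X.le_sup_seminorm[OF cpt \<Phi>H[OF gc] p1])
      also have "\<dots> \<le> mult_seminorm ?Y (sup_seminorm (sup_seminorm p)) (\<Phi> g) * sup_seminorm (sup_seminorm p) ?H"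
        by (rule Y.mult_seminorm_bound[OF \<Phi>_in[OF gc] p2]) (use H in simp)
      also have "\<dots> \<le> \<epsilon> * p e"
      proof (rule mult_mono[OF ms])
        show "sup_seminorm (sup_seminorm p) ?H \<le> p e"
          by (intro X.sup_seminorm_le[OF cpt] sup_seminorm_le[OF cpt]) simp
        interpret S: cstar_seminormed ?Y "sup_seminorm (sup_seminorm p)"
          using p2 by (rule Y.cont_seminormed)
        show "0 \<le> sup_seminorm (sup_seminorm p) ?H" using H by (intro S.nonneg) simp
      qed (use \<epsilon> in simp)
      finally have 1: "p (\<Psi> g) \<le> \<epsilon> * p e" .
      have "p (L g) \<le> \<epsilon>"
        using r0(2) gc sup_mono[of r0 g] k(2) unfolding g_def by fastforce
      then have 2: "p (L g \<cdot> e) \<le> \<epsilon> * p e"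
        using submult[OF L_closed[OF gc] e] e by (meson mult_right_mono nonneg order_trans)
      have "diff A (\<Psi> h) (L h \<cdot> e) = diff A (\<Psi> g \<oplus> \<Psi> k) (L g \<cdot> e \<oplus> L k \<cdot> e)"
        unfolding hg \<Psi>_add[OF gc kc] L_add[OF gc kc] using e by (simp add: distrib_right L_closed gc kc)
      also have "\<dots> = diff A (\<Psi> g) (L g \<cdot> e) \<oplus> diff A (\<Psi> k) (L k \<cdot> e)"
        using e by (simp add: diff_add \<Psi>_closed L_closed gc kc)
      also have "\<dots> = diff A (\<Psi> g) (L g \<cdot> e)"
        using e gc kc by (simp add: span[OF k(1)] L_closed \<Psi>_closed add_zero)
      finally have eq: "diff A (\<Psi> h) (L h \<cdot> e) = diff A (\<Psi> g) (L g \<cdot> e)" .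
      show ?thesis
        unfolding eq using p_diff_le[of "\<Psi> g" "L g \<cdot> e"] 1 2 e gc \<Psi>_closed L_closed by fastforce
    qed
    have c: "diff A (\<Psi> h) (L h \<cdot> e) \<in> carrier A" using e h \<Psi>_closed L_closed by simp
    show ?thesis
    proof (rule ccontr)
      assume "p (diff A (\<Psi> h) (L h \<cdot> e)) \<noteq> 0"
      then have pos: "p (diff A (\<Psi> h) (L h \<cdot> e)) > 0" using nonneg[OF c] by linarith
      define D where "D = p (diff A (\<Psi> h) (L h \<cdot> e))"
      have D: "D > 0" using pos by (simp add: D_def)
      have pe: "0 \<le> p e" using e by simp
      \<comment> \<open>This value of \<epsilon> brings the bound below D/2; the summand 1 covers
        the case p e = 0.\<close>
      have "D \<le> D / (4 * p e + 1) * (2 * p e)"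
        unfolding D_def by (rule main) (use pos pe in \<open>simp add: add_nonneg_pos\<close>)
      also have "\<dots> < D"
        using D pe mult_nonneg_nonneg[of D "p e"] by (simp add: field_simps add_nonneg_pos add_pos_nonneg)
      finally show False by simp
    qed
  qed
  then have "diff A (\<Psi> h) (L h \<cdot> e) = \<zero>"
    using faithful[of "diff A (\<Psi> h) (L h \<cdot> e)"] e h \<Psi>_closed L_closed by simp
  then have "\<Psi> h = L h \<cdot> e" by (rule diff_eq_zeroD) (use e h \<Psi>_closed L_closed in auto)
  then show ?thesis by (simp add: \<Psi>_def)
qed

end

section \<open>The points of the group acting on the algebra\<close>

text \<open>A neighbourhood of zero avoiding x would contain a basic seminorm ball, and x lies in
  every such ball around zero.\<close>

lemma (in lc_star_algebra) Hausdorff_faithful: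
  assumes "Hausdorff_space (topo A)" "x \<in> carrier A" "\<forall>p\<in>cont_seminorms A. p x = 0"
  shows "x = \<zero>"
proof (rule ccontr)
  assume "x \<noteq> \<zero>"
  then obtain U V where UV: "openin (topo A) V" "x \<in> U" "\<zero> \<in> V" "disjnt U V"
    using assms(1,2) unfolding Hausdorff_space_def by (metis topspace_topo zero_closed)
  then obtain F e where "F \<subseteq> cont_seminorms A" "e > 0"
      "{y \<in> carrier A. \<forall>p\<in>F. p (diff A y \<zero>) < e} \<subseteq> V"
    unfolding topo_eq openin_seminorm_topology by blast
  moreover from this have "\<forall>p\<in>F. p x = 0" using assms(3) by blast
  then have "\<forall>p\<in>F. p (diff A x \<zero>) < e" using \<open>e > 0\<close> assms(2) by (metis diff_zero)
  ultimately have "x \<in> V" using assms(2) by blast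
  then show False using UV by (auto simp: disjnt_def)
qed

locale compact_kac_action = lc_star_algebra A for A :: "('a, 'm) talg_scheme" (structure) +
  fixes \<alpha> :: "'a \<Rightarrow> ('g::topological_group_add \<Rightarrow> 'a) multiplier"
  assumes compact_group: "compact (UNIV :: 'g set)"
    and faithful: "\<lbrakk>x \<in> carrier A; \<forall>p\<in>cont_seminorms A. p x = 0\<rbrakk> \<Longrightarrow> x = \<zero>"
    and kac: "kac_action A \<alpha>"
begin

abbreviation "X \<equiv> tensor_C0 A :: ('g \<Rightarrow> 'a) talg"
abbreviation "Y \<equiv> tensor_C0 (tensor_C0 A) :: ('g \<Rightarrow> 'g \<Rightarrow> 'a) talg"

sublocale X: lc_star_algebra X by (rule tensor_C0_lc[OF compact_group])

lemma \<alpha>_morphism: "morphism A (mult_algebra X) \<alpha>"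
  using kac by (simp add: kac_action_def S_morphism_def)

lemma \<alpha>_inj: "inj_on \<alpha> (carrier A)"
  using kac by (simp add: kac_action_def)

text \<open>For compact G the constant 1 lies in C(G), and 1 \<otimes> 1 is the unit multiplier. The
  defining condition of M(A, C(G)) at f = 1 then says that the multiplier itself comes from a
  function.\<close>

lemma \<alpha>_embed: assumes a: "a \<in> carrier A" shows "\<exists>h\<in>C0_carrier A. \<alpha> a = mult_embed X h"
proof -
  have rel: "\<alpha> a \<in> mult_rel A" using kac a by (auto simp: kac_action_def)
  then have m: "\<alpha> a \<in> multipliers X" by (simp add: mult_rel_def)
  have one: "(\<lambda>_. 1) \<in> carrier (C0 :: ('g \<Rightarrow> complex) talg)"
    by (simp only: carrier_C0_iff[OF compact_group] continuous_on_const)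
  have "mult_tensor A (mult_one A) (\<lambda>_::'g. 1) = mult_one X"
    by (auto simp: mult_tensor_def mult_one_def scale_one C0_carrierD cong: restrict_cong)
  moreover have "\<alpha> a \<cdot>\<^bsub>mult_algebra X\<^esub> mult_one X = \<alpha> a"
    using dc_fst_extensional[OF multiplier_dc[OF m]] dc_snd_extensional[OF multiplier_dc[OF m]]
      multiplier_fst_closed[OF m] multiplier_snd_closed[OF m]
    by (auto simp: mult_one_def extensional_restrict cong: restrict_cong intro!: prod_eqI)
  ultimately have "\<alpha> a \<in> mult_embed X ` C0_carrier A"
    using rel one unfolding mult_rel_def by force
  then show ?thesis by blast
qed

definition coact :: "'a \<Rightarrow> 'g \<Rightarrow> 'a" where
  "coact a = (SOME h. h \<in> C0_carrier A \<and> \<alpha> a = mult_embed X h)"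

definition act :: "'g \<Rightarrow> 'a \<Rightarrow> 'a" where "act t a = coact a t"

lemma coact: assumes "a \<in> carrier A" shows "coact a \<in> C0_carrier A" "\<alpha> a = mult_embed X (coact a)"
  using someI_ex[of "\<lambda>h. h \<in> C0_carrier A \<and> \<alpha> a = mult_embed X h"] \<alpha>_embed[OF assms]
  unfolding coact_def by blast+

lemma coact_eqI:
  assumes "a \<in> carrier A" "h \<in> C0_carrier A" "\<alpha> a = mult_embed X h" shows "coact a = h"
  by (rule tensor_embed_inj[OF compact_group faithful]) (use coact assms in auto)

text \<open>\<open>\<alpha>\<close> and the embedding of C(G, A) are both homomorphisms, and
  injectivity of the embedding pulls each operation back to functions.\<close>

lemma coact_hom: "star_hom A X coact"
proof -
  have \<alpha>: "star_hom A (mult_algebra X) \<alpha>" using \<alpha>_morphism by (simp add: morphism_iff)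
  note h = star_homD[OF \<alpha>] and e = star_homD[OF X.mult_embed_star_hom]
  show ?thesis
  proof (rule star_homI)
    fix x y c assume x: "x \<in> carrier A"
    note cx = coact[OF x]
    have cx': "coact x \<in> carrier X" using cx by simp
    show "coact x \<in> carrier X" by fact
    have "\<alpha> (scale A c x) = mult_embed X (scale X c (coact x))"
      "\<alpha> (star A x) = mult_embed X (star X (coact x))"
      by (simp_all only: h(3)[OF x] e(3)[OF cx'] h(5)[OF x] e(5)[OF cx'] cx(2))
    then show "coact (scale A c x) = scale X c (coact x)" "coact (star A x) = star X (coact x)"
      using X.scale_closed[OF cx', of c] X.star_closed[OF cx'] scale_closed[OF x] star_closed[OF x]
      unfolding tensor_C0_simps(1) by (blast intro: coact_eqI)+
    assume y: "y \<in> carrier A"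
    note cy = coact[OF y]
    have cy': "coact y \<in> carrier X" using cy by simp
    have "\<alpha> (x \<oplus> y) = mult_embed X (coact x \<oplus>\<^bsub>X\<^esub> coact y)"
      "\<alpha> (x \<cdot> y) = mult_embed X (coact x \<cdot>\<^bsub>X\<^esub> coact y)"
      by (simp_all only: h(2)[OF x y] e(2)[OF cx' cy'] h(4)[OF x y] e(4)[OF cx' cy'] cx(2) cy(2))
    then show "coact (x \<oplus> y) = coact x \<oplus>\<^bsub>X\<^esub> coact y" "coact (x \<cdot> y) = coact x \<cdot>\<^bsub>X\<^esub> coact y"
      using X.add_closed[OF cx' cy'] X.mult_closed[OF cx' cy'] add_closed[OF x y] mult_closed[OF x y]
      unfolding tensor_C0_simps(1) by (blast intro: coact_eqI)+
  qed
qed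

lemma act_hom: "star_hom A A (act t)"
  using star_homD[OF coact_hom] C0_carrierD[of "coact _" A t]
  by (intro star_homI) (auto simp: act_def)

lemmas act_closed = star_hom_closed[OF act_hom]

definition orbit_seminorm :: "('a \<Rightarrow> real) \<Rightarrow> 'a \<Rightarrow> real" where
  "orbit_seminorm p a = sup_seminorm p (coact a)"

text \<open>The C*-identity is pulled back along \<open>coact\<close>. For continuity, the operator
  seminorm of \<open>\<alpha> a\<close> is the sup seminorm of \<open>coact a\<close>, so continuity
  of \<open>\<alpha>\<close> into the multiplier algebra is what is needed.\<close>

lemma orbit_seminorm_cont:
  assumes p: "p \<in> cont_seminorms A"
  shows "orbit_seminorm p \<in> cont_seminorms A"
proof -
  have p1: "sup_seminorm p \<in> cont_seminorms X" by (rule sup_seminorm_cont[OF compact_group p])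
  have "cstar_seminorm A (sup_seminorm p \<circ> coact)"
    by (rule cstar_seminorm_pullback[OF coact_hom star_algebra_axioms]) (use p1 in \<open>simp add: cont_seminorms_def\<close>)
  moreover have "sup_seminorm p \<circ> coact = orbit_seminorm p" by (auto simp: orbit_seminorm_def)
  ultimately have "cstar_seminorm A (orbit_seminorm p)" by simp
  then show ?thesis
  proof (rule cont_seminormI[OF star_algebra_axioms _ topo_eq])
    fix e :: real assume e: "e > 0"
    obtain F d where F: "finite F" "F \<subseteq> cont_seminorms A" "d > 0"
      "\<forall>x\<in>carrier A. (\<forall>q\<in>F. q x < d) \<longrightarrow> mult_seminorm X (sup_seminorm p) (\<alpha> x) < e"
      using X.morphism_mult_small[OF \<alpha>_morphism star_algebra_axioms topo_eq p1 e] by blast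
    moreover have "mult_seminorm X (sup_seminorm p) (\<alpha> x) = orbit_seminorm p x" if "x \<in> carrier A" for x
      using coact[OF that] X.mult_seminorm_embed[OF _ p1, of "coact x"] by (simp add: orbit_seminorm_def)
    ultimately show "\<exists>F d. finite F \<and> F \<subseteq> cont_seminorms A \<and> d > 0 \<and>
        (\<forall>x\<in>carrier A. (\<forall>r\<in>F. r x < d) \<longrightarrow> orbit_seminorm p x < e)"
      by (intro exI[of _ F] exI[of _ d]) auto
  qed
qed

lemma act_le_orbit_seminorm:
  "\<lbrakk>a \<in> carrier A; p \<in> cont_seminorms A\<rbrakk> \<Longrightarrow> p (act t a) \<le> orbit_seminorm p a"
  unfolding act_def orbit_seminorm_def by (rule le_sup_seminorm[OF compact_group coact(1)])

text \<open>The extensions agree on \<open>\<alpha> a\<close>, which is the embedded function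
  \<open>coact a\<close>, so \<open>\<Theta>\<close> and \<open>\<Delta>\<close> agree there. On a
  constant e, at the point with first argument t and second s, they are governed by h \<mapsto>
  \<open>act s (h t)\<close> and h \<mapsto> \<open>h (t + s)\<close>; the orbit seminorm supplies
  the bound for the former.\<close>

lemma act_act:
  assumes a: "a \<in> carrier A" shows "act s (act t a) = act (t + s) a"
proof -
  obtain \<Theta> \<Theta>' \<Delta> \<Delta>' where
    \<Theta>: "is_alpha_tensor_id A \<alpha> \<Theta>" "mult_extension X Y \<Theta> \<Theta>'" and
    \<Delta>: "is_id_tensor_flip_comult A \<Delta>" "mult_extension X Y \<Delta> \<Delta>'" and
    eq: "\<forall>a\<in>carrier A. \<Theta>' (\<alpha> a) = \<Delta>' (\<alpha> a)"
    using kac unfolding kac_action_def by blast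
  have ca: "coact a \<in> C0_carrier A" by (rule coact(1)[OF a])
  have \<Theta>\<Delta>: "\<Theta> (coact a) = \<Delta> (coact a)"
  proof -
    have "\<Theta>' (mult_embed X (coact a)) = \<Delta>' (mult_embed X (coact a))"
      using eq a coact(2)[OF a] by metis
    then show ?thesis using \<Theta>(2) \<Delta>(2) ca by (simp add: mult_extension_def)
  qed
  have zero: "act s \<zero> = \<zero>" by (rule star_hom_zero[OF act_hom star_algebra_axioms star_algebra_axioms])
  have H: "(\<lambda>(t::'g) (s::'g). e) \<in> C0_carrier X" "(\<lambda>(s::'g). e) \<in> C0_carrier A" if "e \<in> carrier A" for e
    using X.const_C0[OF compact_group, of "\<lambda>s. e"] const_C0[OF compact_group that] by simp_all
  have "act s (coact a t) \<cdot> e = coact a (t + s) \<cdot> e" if e: "e \<in> carrier A" for e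
  proof -
    have "fst (\<Theta> (coact a)) (\<lambda>t s. e) t s = act s (coact a t) \<cdot> e"
    proof (rule morphism_tensor_determined[OF compact_group _ _ _ _ _ _ faithful e ca])
      show "morphism X (mult_algebra Y) \<Theta>" using \<Theta>(1) by (simp add: is_alpha_tensor_id_def)
      show "\<exists>r\<in>cont_seminorms A. \<forall>h\<in>C0_carrier A. p (act s (h t)) \<le> sup_seminorm r h"
        if p: "p \<in> cont_seminorms A" for p
        using le_sup_seminorm[OF compact_group _ orbit_seminorm_cont[OF p]] act_le_orbit_seminorm[OF C0_carrierD p]
        by (intro bexI[OF _ orbit_seminorm_cont[OF p]]) (blast intro: order_trans)
      show "fst (\<Theta> (elem_tensor A b f)) (\<lambda>t s. e) t s = act s (elem_tensor A b f t) \<cdot> e"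
        if b: "b \<in> carrier A" and f: "f \<in> carrier C0" for b and f :: "'g \<Rightarrow> complex"
      proof -
        have "\<Theta> (elem_tensor A b f) = mult_tensor X (\<alpha> b) f"
          using \<Theta>(1) b f by (simp add: is_alpha_tensor_id_def)
        then have "fst (\<Theta> (elem_tensor A b f)) (\<lambda>t s. e) t s = scale A (f t) (act s b \<cdot> e)"
          using H[OF e] coact(2)[OF b] by (simp add: mult_tensor_def mult_embed_def act_def)
        then show ?thesis
          using b e act_closed[OF b] by (simp add: elem_tensor_def star_hom_scale[OF act_hom] scale_mult_left)
      qed
    qed (auto simp: zero act_closed C0_carrierD star_hom_add[OF act_hom])
    moreover have "fst (\<Delta> (coact a)) (\<lambda>t s. e) t s = coact a (t + s) \<cdot> e"
    proof (rule morphism_tensor_determined[OF compact_group _ _ _ _ _ _ faithful e ca])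
      show "morphism X (mult_algebra Y) \<Delta>" using \<Delta>(1) by (simp add: is_id_tensor_flip_comult_def)
      show "\<exists>r\<in>cont_seminorms A. \<forall>h\<in>C0_carrier A. p (h (t + s)) \<le> sup_seminorm r h"
        if p: "p \<in> cont_seminorms A" for p
        using le_sup_seminorm[OF compact_group _ p] by (intro bexI[OF _ p]) blast
      show "fst (\<Delta> (elem_tensor A b f)) (\<lambda>t s. e) t s = elem_tensor A b f (t + s) \<cdot> e"
        if b: "b \<in> carrier A" and f: "f \<in> carrier C0" for b and f :: "'g \<Rightarrow> complex"
      proof -
        have "\<Delta> (elem_tensor A b f) = elem_tensor2 A b (tensor_flip (comult f))"
          using \<Delta>(1) b f by (simp add: is_id_tensor_flip_comult_def)
        then show ?thesis
          using H[OF e] b e by (simp add: elem_tensor2_def tensor_flip_def comult_def elem_tensor_def scale_mult_left)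
      qed
    qed (auto simp: C0_carrierD)
    ultimately show ?thesis using \<Theta>\<Delta> by simp
  qed
  then have "act s (coact a t) = coact a (t + s)"
    using act_closed[OF C0_carrierD[OF ca]] C0_carrierD[OF ca]
    by (rule mult_embed_inj[rotated]) (assumption | rule faithful)+
  then show ?thesis by (simp add: act_def)
qed

text \<open>The action law gives \<open>act s (act 0 a) = act s a\<close> for all s, so
  \<open>\<alpha>\<close> takes the same value at \<open>act 0 a\<close> and at
  \<open>a\<close>.\<close>

lemma act_zero: assumes a: "a \<in> carrier A" shows "act 0 a = a"
proof -
  have b: "act 0 a \<in> carrier A" by (rule act_closed[OF a])
  have "coact (act 0 a) = coact a"
    using act_act[OF a, of _ 0] by (auto simp: act_def)
  then have "\<alpha> (act 0 a) = \<alpha> a" using coact(2)[OF a] coact(2)[OF b] by simp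
  then show ?thesis using \<alpha>_inj a b by (auto dest: inj_onD)
qed

section \<open>Invariant seminorms\<close>

definition invariant_seminorms :: "('a \<Rightarrow> real) set" where
  "invariant_seminorms = {q \<in> cont_seminorms A. \<forall>t. \<forall>a\<in>carrier A. q (act t a) = q a}"

text \<open>The orbit function of \<open>act t a\<close> is that of a after the translation s
  \<mapsto> t + s. This is a bijection of the group, so both have the same values and the same
  supremum.\<close>

lemma orbit_seminorm_invariant:
  assumes p: "p \<in> cont_seminorms A"
  shows "orbit_seminorm p \<in> invariant_seminorms"
proof -
  have "orbit_seminorm p (act t a) = orbit_seminorm p a" if a: "a \<in> carrier A" for t a
  proof -
    have eq: "coact (act t a) = (\<lambda>s. coact a (t + s))"
      using act_act[OF a] by (auto simp: act_def)
    have "range (\<lambda>s. p (coact a (t + s))) = range (\<lambda>s. p (coact a s))"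
    proof (intro equalityI subsetI)
      fix u assume "u \<in> range (\<lambda>s. p (coact a s))"
      then obtain s where "u = p (coact a (t + (- t + s)))" by (auto simp flip: add.assoc)
      then show "u \<in> range (\<lambda>s. p (coact a (t + s)))" by blast
    qed auto
    then show ?thesis by (simp add: orbit_seminorm_def sup_seminorm_def eq)
  qed
  then show ?thesis using orbit_seminorm_cont[OF p] by (simp add: invariant_seminorms_def)
qed

lemma le_orbit_seminorm:
  "\<lbrakk>p \<in> cont_seminorms A; a \<in> carrier A\<rbrakk> \<Longrightarrow> p a \<le> orbit_seminorm p a"
  using act_le_orbit_seminorm[of a p 0] act_zero by simp

lemma invariant_cont: "q \<in> invariant_seminorms \<Longrightarrow> q \<in> cont_seminorms A"
  by (simp add: invariant_seminorms_def)

lemma invariant_act: "\<lbrakk>q \<in> invariant_seminorms; a \<in> carrier A\<rbrakk> \<Longrightarrow> q (act t a) = q a"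
  by (simp add: invariant_seminorms_def)

lemma invariant_max:
  "\<lbrakk>p \<in> invariant_seminorms; q \<in> invariant_seminorms\<rbrakk> \<Longrightarrow> (\<lambda>x. max (p x) (q x)) \<in> invariant_seminorms"
  by (simp add: invariant_seminorms_def cont_seminorms_max star_algebra_axioms)

section \<open>The inverse system\<close>

abbreviation "B q \<equiv> completion A q"

definition "completed_act q t = completion_map A q (act t)"

definition "connecting r q = completion_map A q (\<lambda>x. x)" for r q :: "'a \<Rightarrow> real"

definition "canonical a = (\<lambda>q\<in>invariant_seminorms. null_class A q (\<lambda>n. a))"

definition le_on :: "('a \<Rightarrow> real) \<Rightarrow> ('a \<Rightarrow> real) \<Rightarrow> bool" where
  "le_on q r \<longleftrightarrow> (\<forall>x\<in>carrier A. q x \<le> r x)"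

lemma invariant_seminormed: "q \<in> invariant_seminorms \<Longrightarrow> cstar_seminormed A q"
  by (rule cont_seminormed[OF invariant_cont])

lemma invariant_cstar: "q \<in> invariant_seminorms \<Longrightarrow> cstar_seminorm A q"
  using invariant_cont by (auto simp: cont_seminorms_def)

text \<open>The algebraic laws and isometry are inherited termwise from sequences. Continuity of
  orbits needs density: X is replaced by an element of A within e/3, and isometry keeps the error
  below e/3 for all group elements at once.\<close>

lemma isometric_action_completion:
  assumes q: "q \<in> invariant_seminorms"
  shows "isometric_action (B q) (completion_norm q) (completed_act q)"
proof -
  interpret Q: cstar_seminormed A q by (rule invariant_seminormed[OF q])
  interpret B: normed_star_algebra "B q" "completion_norm q" by (rule Q.completion_normed)
  have act_le: "\<forall>a\<in>carrier A. q (act t a) \<le> q a" for t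
    using invariant_act[OF q] by simp
  note props = completion_map_props[OF star_algebra_axioms invariant_cstar[OF q] invariant_cstar[OF q] act_hom act_le]
  have cls: "(\<lambda>n. act t (x n)) \<in> cauchy_seqs A q" "completed_act q t (null_class A q x) = null_class A q (\<lambda>n. act t (x n))"
    if "x \<in> cauchy_seqs A q" for t x
    using props(1)[OF that] by (auto simp: completed_act_def)
  show ?thesis
  proof
    show "compact (UNIV :: 'g set)" by (rule compact_group)
    show hom: "star_hom (B q) (B q) (completed_act q t)" for t
      unfolding completed_act_def by (rule props(2))
    show iso: "completion_norm q (completed_act q t X) = completion_norm q X" if X: "X \<in> carrier (B q)" for X t
    proof -
      obtain x where x: "x \<in> cauchy_seqs A q" "X = null_class A q x" using X by (rule Q.carrierE)
      have "(\<lambda>n. q (act t (x n))) = (\<lambda>n. q (x n))"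
        using Q.cauchy_closed[OF x(1)] invariant_act[OF q] by simp
      then show ?thesis
        using LIMSEQ_unique[OF Q.norm_cls[OF cls(1)[OF x(1), of t]]] Q.norm_cls[OF x(1)] by (simp add: x cls)
    qed
    show "X = zero (B q)" if "X \<in> carrier (B q)" "completion_norm q X = 0" for X
      using that by (rule Q.completion_definite)
    show "completed_act q 0 X = X" if X: "X \<in> carrier (B q)" for X
    proof -
      obtain x where x: "x \<in> cauchy_seqs A q" "X = null_class A q x" using X by (rule Q.carrierE)
      then show ?thesis using Q.cauchy_closed[OF x(1)] by (simp add: cls act_zero)
    qed
    show "completed_act q s (completed_act q t X) = completed_act q (t + s) X" if X: "X \<in> carrier (B q)" for X s t
    proof -
      obtain x where x: "x \<in> cauchy_seqs A q" "X = null_class A q x" using X by (rule Q.carrierE)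
      then show ?thesis using Q.cauchy_closed[OF x(1)] by (simp add: cls act_act)
    qed
    show "((\<lambda>y. completion_norm q (diff (B q) (completed_act q y X) (completed_act q x X))) \<longlongrightarrow> 0) (nhds x)"
      if X: "X \<in> carrier (B q)" for X x
    proof (rule tendstoI)
      let ?N = "completion_norm q"
      let ?b = "completed_act q"
      fix e :: real assume e: "e > 0"
      obtain a where a: "a \<in> carrier A" "?N (diff (B q) X (null_class A q (\<lambda>n. a))) < e / 3"
        using Q.completion_dense[OF X, of "e / 3"] e by auto
      let ?a = "null_class A q (\<lambda>n. a)"
      have ca: "?a \<in> carrier (B q)" by (rule Q.cls_in[OF Q.cauchy_const[OF a(1)]])
      note bc = star_hom_closed[OF hom]
      have near: "?N (diff (B q) (?b y X) (?b y ?a)) < e / 3" for y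
        using a(2) iso[of "diff (B q) X ?a" y] X ca
        by (simp add: star_hom_diff[OF hom B.star_algebra_axioms])
      have "((\<lambda>y. q (diff A (act y a) (act x a))) \<longlongrightarrow> 0) (nhds x)"
        using coact(1)[OF a(1)] invariant_cont[OF q] C0_carrier_iff[OF compact_group] unfolding act_def by blast
      then have "eventually (\<lambda>y. q (diff A (act y a) (act x a)) < e / 3) (nhds x)"
        by (rule order_tendstoD) (use e in simp)
      then show "eventually (\<lambda>y. dist (?N (diff (B q) (?b y X) (?b x X))) 0 < e) (nhds x)"
      proof eventually_elim
        case (elim y)
        have m: "?N (diff (B q) (?b y ?a) (?b x ?a)) = q (diff A (act y a) (act x a))"
          using a(1) by (simp add: cls Q.cauchy_const Q.diff_cls act_closed Q.norm_const)
        have "?N (diff (B q) (?b y X) (?b x X)) \<le> ?N (diff (B q) (?b y X) (?b y ?a)) + ?N (diff (B q) (?b y ?a) (?b x X))"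
          by (rule B.p_diff_triangle) (use bc X ca in auto)
        also have "?N (diff (B q) (?b y ?a) (?b x X)) \<le> ?N (diff (B q) (?b y ?a) (?b x ?a)) + ?N (diff (B q) (?b x ?a) (?b x X))"
          by (rule B.p_diff_triangle) (use bc X ca in auto)
        also have "?N (diff (B q) (?b x ?a) (?b x X)) = ?N (diff (B q) (?b x X) (?b x ?a))"
          by (rule B.p_diff_commute) (use bc X ca in auto)
        finally show ?case
          using near[of y] near[of x] m elim B.nonneg[OF B.diff_closed[OF bc[OF X, of y] bc[OF X, of x]]]
          by (simp add: dist_real_def)
      qed
    qed
  qed
qed

lemma connecting_props:
  assumes q: "q \<in> invariant_seminorms" and r: "r \<in> invariant_seminorms" and le: "le_on q r"
  shows connecting_cls: "x \<in> cauchy_seqs A r \<Longrightarrow> x \<in> cauchy_seqs A q \<and> connecting r q (null_class A r x) = null_class A q x"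
    and connecting_hom: "star_hom (B r) (B q) (connecting r q)"
    and connecting_le: "z \<in> carrier (B r) \<Longrightarrow> completion_norm q (connecting r q z) \<le> completion_norm r z"
    and connecting_morphism: "morphism (B r) (B q) (connecting r q)"
proof -
  have id: "star_hom A A (\<lambda>x. x)" by (rule star_homI) auto
  note props = completion_map_props[OF star_algebra_axioms invariant_cstar[OF r] invariant_cstar[OF q] id]
  have le': "\<forall>a\<in>carrier A. q a \<le> r a" using le by (simp add: le_on_def)
  show "x \<in> cauchy_seqs A r \<Longrightarrow> x \<in> cauchy_seqs A q \<and> connecting r q (null_class A r x) = null_class A q x"
    using props(1)[OF le'] by (simp add: connecting_def)
  show h: "star_hom (B r) (B q) (connecting r q)"
    using props(2)[OF le'] by (simp add: connecting_def)
  show l: "z \<in> carrier (B r) \<Longrightarrow> completion_norm q (connecting r q z) \<le> completion_norm r z" for z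
    using props(3)[OF le'] by (simp add: connecting_def)
  show "morphism (B r) (B q) (connecting r q)"
    by (rule normed_morphismI[OF cstar_seminormed.completion_normed[OF invariant_seminormed[OF r]]
        cstar_seminormed.completion_normed[OF invariant_seminormed[OF q]] h l])
qed

lemma inverse_system: "cstar_inverse_system invariant_seminorms le_on B connecting"
  unfolding cstar_inverse_system_def directed_index_def
proof (intro conjI ballI impI)
  show "invariant_seminorms \<noteq> {}"
    using orbit_seminorm_invariant[OF cont_seminorms_zero[OF star_algebra_axioms]] by blast
  show "le_on q q" for q by (simp add: le_on_def)
  show "le_on p r" if "le_on p q" "le_on q r" for p q r
    using that unfolding le_on_def by (meson order_trans)
  show "\<exists>r\<in>invariant_seminorms. le_on p r \<and> le_on q r"
    if "p \<in> invariant_seminorms" "q \<in> invariant_seminorms" for p q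
    by (rule bexI[OF _ invariant_max[OF that]]) (auto simp: le_on_def)
  show "cstar_algebra (B q)" if "q \<in> invariant_seminorms" for q
    by (rule cstar_seminormed.completion_cstar[OF invariant_seminormed[OF that]])
  show "morphism (B r) (B q) (connecting r q)"
    if "q \<in> invariant_seminorms" "r \<in> invariant_seminorms" "le_on q r" for q r
    by (rule connecting_morphism[OF that])
  show "connecting q q z = z" if q: "q \<in> invariant_seminorms" and z: "z \<in> carrier (B q)" for q z
  proof -
    obtain x where "x \<in> cauchy_seqs A q" "z = null_class A q x"
      using cstar_seminormed.carrierE[OF invariant_seminormed[OF q] z] by blast
    then show ?thesis using connecting_cls[OF q q] by (simp add: le_on_def)
  qed
  show "connecting q p (connecting r q z) = connecting r p z"
    if "p \<in> invariant_seminorms" "q \<in> invariant_seminorms" and r: "r \<in> invariant_seminorms"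
      and "le_on p q" "le_on q r" and z: "z \<in> carrier (B r)" for p q r z
  proof -
    obtain x where x: "x \<in> cauchy_seqs A r" "z = null_class A r x"
      using cstar_seminormed.carrierE[OF invariant_seminormed[OF r] z] by blast
    have "le_on p r" using that(4,5) unfolding le_on_def by (meson order_trans)
    then show ?thesis
      using connecting_cls[OF that(2,3,5) x(1)] connecting_cls[OF that(1,2,4), of x]
        connecting_cls[OF that(1,3) _ x(1)] by (simp add: x)
  qed
qed

end

lemma normed_star_algebra_lc: "normed_star_algebra A p \<Longrightarrow> lc_star_algebra A"
proof -
  assume "normed_star_algebra A p"
  then interpret normed_star_algebra A p .
  show ?thesis by (rule lc_star_algebra_axioms)
qed

text \<open>Injectivity of the embedding forces the h in the definition of
  \<open>induced_mult\<close> to be f g, and \<open>\<pi>\<close> commutes with scaling by f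
  x.\<close>

lemma induced_multI:
  fixes g :: "'x::topological_space \<Rightarrow> 'a"
  assumes cpt: "compact (UNIV :: 'x set)" and A: "lc_star_algebra A" and B: "lc_star_algebra B"
    and faithful: "\<And>x. \<lbrakk>x \<in> carrier A; \<forall>p\<in>cont_seminorms A. p x = 0\<rbrakk> \<Longrightarrow> x = zero A"
    and \<pi>: "star_hom A B \<pi>" and g: "g \<in> C0_carrier A" and \<pi>g: "\<pi> \<circ> g \<in> C0_carrier B"
  shows "induced_mult A B \<pi> (mult_embed (tensor_C0 A) g) (mult_embed (tensor_C0 B) (\<pi> \<circ> g))"
proof -
  interpret A: lc_star_algebra A by fact
  interpret B: lc_star_algebra B by fact
  have comp: "\<pi> \<circ> (\<lambda>x. scale A (f x) (g x)) = (\<lambda>x. scale B (f x) ((\<pi> \<circ> g) x))" for f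
    using C0_carrierD[OF g] by (auto simp: star_hom_scale[OF \<pi>])
  show ?thesis
    unfolding induced_mult_def
  proof (intro conjI ballI impI)
    show "mult_embed (tensor_C0 A) g \<in> mult_rel A" by (rule A.mult_embed_in_mult_rel[OF cpt g])
    show "mult_embed (tensor_C0 B) (\<pi> \<circ> g) \<in> mult_rel B" by (rule B.mult_embed_in_mult_rel[OF cpt \<pi>g])
    fix f :: "'x \<Rightarrow> complex" and h :: "'x \<Rightarrow> 'a"
    assume f: "f \<in> carrier C0" and h: "h \<in> carrier (tensor_C0 A)"
    have eq: "h = (\<lambda>x. scale A (f x) (g x))"
      if "mult_embed (tensor_C0 A) (\<lambda>x. scale A (f x) (g x)) = mult_embed (tensor_C0 A) h"
      by (rule A.tensor_embed_inj[OF cpt faithful _ A.C0_carrier_scale[OF cpt g f] that[symmetric]]) (use h in simp_all)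
    show "mult_embed (tensor_C0 B) (\<pi> \<circ> g) \<cdot>\<^bsub>mult_algebra (tensor_C0 B)\<^esub> mult_tensor B (mult_one B) f
        = mult_embed (tensor_C0 B) (\<pi> \<circ> h)"
      if "mult_embed (tensor_C0 A) g \<cdot>\<^bsub>mult_algebra (tensor_C0 A)\<^esub> mult_tensor A (mult_one A) f = mult_embed (tensor_C0 A) h"
      using that eq unfolding A.embed_mult_tensor(1)[OF cpt g f] B.embed_mult_tensor(1)[OF cpt \<pi>g f]
      by (simp only: comp)
    show "mult_tensor B (mult_one B) f \<cdot>\<^bsub>mult_algebra (tensor_C0 B)\<^esub> mult_embed (tensor_C0 B) (\<pi> \<circ> g)
        = mult_embed (tensor_C0 B) (\<pi> \<circ> h)"
      if "mult_tensor A (mult_one A) f \<cdot>\<^bsub>mult_algebra (tensor_C0 A)\<^esub> mult_embed (tensor_C0 A) g = mult_embed (tensor_C0 A) h"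
      using that eq unfolding A.embed_mult_tensor(2)[OF cpt g f] B.embed_mult_tensor(2)[OF cpt \<pi>g f]
      by (simp only: comp)
  qed
qed

section \<open>The isomorphism onto the inverse limit\<close>

context compact_kac_action
begin

abbreviation "limit \<equiv> inverse_limit invariant_seminorms le_on B connecting"

lemma limit_simps:
  "carrier limit = inverse_limit_carrier invariant_seminorms le_on B connecting"
  "add limit x y = (\<lambda>q\<in>invariant_seminorms. x q \<oplus>\<^bsub>B q\<^esub> y q)"
  "scale limit c x = (\<lambda>q\<in>invariant_seminorms. scale (B q) c (x q))"
  "mult limit x y = (\<lambda>q\<in>invariant_seminorms. x q \<cdot>\<^bsub>B q\<^esub> y q)"
  "star limit x = (\<lambda>q\<in>invariant_seminorms. star (B q) (x q))"
  "topo limit = subtopology (product_topology (\<lambda>q. topo (B q)) invariant_seminorms)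
    (inverse_limit_carrier invariant_seminorms le_on B connecting)"
  by (simp_all add: inverse_limit_def)

definition point :: "('a \<Rightarrow> real) \<Rightarrow> 'a \<Rightarrow> (nat \<Rightarrow> 'a) set" where
  "point q a = null_class A q (\<lambda>n. a)"

lemma canonical_apply: "q \<in> invariant_seminorms \<Longrightarrow> canonical a q = point q a"
  by (simp add: canonical_def point_def)

lemma point_props:
  assumes q: "q \<in> invariant_seminorms"
  shows point_hom: "star_hom A (B q) (point q)"
    and point_norm: "a \<in> carrier A \<Longrightarrow> completion_norm q (point q a) = q a"
    and point_dense: "\<lbrakk>Z \<in> carrier (B q); e > 0\<rbrakk> \<Longrightarrow> \<exists>a\<in>carrier A. completion_norm q (diff (B q) Z (point q a)) < e"
    and completed_act_point: "a \<in> carrier A \<Longrightarrow> completed_act q t (point q a) = point q (act t a)"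
proof -
  interpret Q: cstar_seminormed A q by (rule invariant_seminormed[OF q])
  show "star_hom A (B q) (point q)"
    by (rule star_homI) (simp_all add: point_def Q.cls_in Q.cauchy_const Q.ops_cls)
  show "a \<in> carrier A \<Longrightarrow> completion_norm q (point q a) = q a"
    by (simp add: point_def Q.norm_const)
  show "\<lbrakk>Z \<in> carrier (B q); e > 0\<rbrakk> \<Longrightarrow> \<exists>a\<in>carrier A. completion_norm q (diff (B q) Z (point q a)) < e"
    unfolding point_def by (rule Q.completion_dense)
  have act_le: "\<forall>a\<in>carrier A. q (act t a) \<le> q a"
    using invariant_act[OF q] by simp
  show "a \<in> carrier A \<Longrightarrow> completed_act q t (point q a) = point q (act t a)"
    using completion_map_cls[OF star_algebra_axioms invariant_cstar[OF q] invariant_cstar[OF q] act_hom act_le, OF Q.cauchy_const]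
    by (simp add: point_def completed_act_def)
qed

lemmas point_closed = star_hom_closed[OF point_hom]

lemma point_diff_norm:
  assumes "q \<in> invariant_seminorms" "a \<in> carrier A" "b \<in> carrier A"
  shows "completion_norm q (diff (B q) (point q a) (point q b)) = q (diff A a b)"
  using point_norm[OF assms(1), of "diff A a b"] assms
  by (simp add: star_hom_diff[OF point_hom[OF assms(1)] star_algebra_axioms])

lemma connecting_point:
  assumes "q \<in> invariant_seminorms" "r \<in> invariant_seminorms" "le_on q r" "a \<in> carrier A"
  shows "connecting r q (point r a) = point q a"
  using connecting_cls[OF assms(1-3) cstar_seminormed.cauchy_const[OF invariant_seminormed[OF assms(2)] assms(4)]]
  by (simp add: point_def)

lemma canonical_in:
  assumes a: "a \<in> carrier A" shows "canonical a \<in> carrier limit"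
proof -
  have "canonical a \<in> (\<Pi>\<^sub>E q\<in>invariant_seminorms. carrier (B q))"
    by (rule PiE_I, simp add: canonical_apply point_closed a) (simp add: canonical_def)
  then show ?thesis
    using a by (simp add: limit_simps inverse_limit_carrier_def canonical_apply connecting_point)
qed

lemma completion_normed: "q \<in> invariant_seminorms \<Longrightarrow> normed_star_algebra (B q) (completion_norm q)"
  by (rule cstar_seminormed.completion_normed[OF invariant_seminormed])

lemma point_morphism:
  assumes q: "q \<in> invariant_seminorms"
  shows "morphism A (B q) (point q)"
  unfolding morphism_iff
proof
  interpret Q: cstar_seminormed A q by (rule invariant_seminormed[OF q])
  show "star_hom A (B q) (point q)" by (rule point_hom[OF q])
  show "continuous_map (topo A) (topo (B q)) (point q)"
    unfolding topo_eq topo_completion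
  proof (rule continuous_map_seminorm_topologyI)
    show "point q x \<in> carrier (B q)" if "x \<in> carrier A" for x by (rule point_closed[OF q that])
    show "\<exists>F d. finite F \<and> F \<subseteq> cont_seminorms A \<and> 0 < d \<and>
        (\<forall>y\<in>carrier A. (\<forall>r\<in>F. r (diff A y x) < d) \<longrightarrow> N (diff (B q) (point q y) (point q x)) < e)"
      if "x \<in> carrier A" "N \<in> {completion_norm q}" "e > 0" for x N and e :: real
      using that invariant_cont[OF q] point_diff_norm[OF q]
      by (intro exI[of _ "{q}"] exI[of _ e]) auto
  qed
qed

lemma canonical_morphism: "morphism A limit canonical"
  unfolding morphism_iff
proof
  show "star_hom A limit canonical"
    by (rule star_homI, rule canonical_in)
      (auto simp: limit_simps canonical_def simp flip: point_def simp: star_homD[OF point_hom] intro!: restrict_ext)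
  have "continuous_map (topo A) (topo (B q)) (\<lambda>a. canonical a q)" if q: "q \<in> invariant_seminorms" for q
    using point_morphism[OF q] by (simp add: canonical_apply[OF q] morphism_iff)
  moreover have "canonical ` carrier A \<subseteq> extensional invariant_seminorms" by (auto simp: canonical_def)
  ultimately show "continuous_map (topo A) (topo limit) canonical"
    using canonical_in by (auto simp: limit_simps continuous_map_in_subtopology continuous_map_componentwise)
qed

text \<open>Every continuous seminorm is dominated by its orbit seminorm, which is one of the
  indices. Equal images make all of these vanish at a - b, and separation gives a = b.\<close>

lemma canonical_inj: "inj_on canonical (carrier A)"
proof (rule inj_onI)
  fix a b assume ab: "a \<in> carrier A" "b \<in> carrier A" "canonical a = canonical b"
  have c: "diff A a b \<in> carrier A" using ab by simp
  have "p (diff A a b) = 0" if p: "p \<in> cont_seminorms A" for p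
  proof -
    interpret P: cstar_seminormed A p using p by (rule cont_seminormed)
    have q: "orbit_seminorm p \<in> invariant_seminorms" by (rule orbit_seminorm_invariant[OF p])
    interpret Q: normed_star_algebra "B (orbit_seminorm p)" "completion_norm (orbit_seminorm p)"
      by (rule completion_normed[OF q])
    have "point (orbit_seminorm p) a = point (orbit_seminorm p) b"
      using ab(3) canonical_apply[OF q] by metis
    then have "orbit_seminorm p (diff A a b) = 0"
      using point_diff_norm[OF q ab(1,2)] point_closed[OF q ab(2)] by simp
    then show ?thesis using le_orbit_seminorm[OF p c] P.nonneg[OF c] by simp
  qed
  then have "diff A a b = \<zero>" using faithful c by blast
  then show "a = b" using ab(1,2) by (rule diff_eq_zeroD)
qed

text \<open>A compatible family is the limit of the Cauchy filter generated by the sets of elements that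
  approximate it in one of the completions.\<close>

lemma canonical_surj:
  assumes complete: "complete_talg A" and z: "z \<in> carrier limit"
  shows "z \<in> canonical ` carrier A"
proof -
  have zc: "z q \<in> carrier (B q)" if "q \<in> invariant_seminorms" for q
    using z that by (auto simp: limit_simps inverse_limit_carrier_def)
  have zcon: "connecting r q (z r) = z q" if "q \<in> invariant_seminorms" "r \<in> invariant_seminorms" "le_on q r" for q r
    using z that by (auto simp: limit_simps inverse_limit_carrier_def)
  define S where "S = (\<lambda>(q, e::real). {a \<in> carrier A. completion_norm q (diff (B q) (z q) (point q a)) < e})"
  define J where "J = invariant_seminorms \<times> {e::real. e > 0}"
  define F where "F = (INF j\<in>J. principal (S j))"
  obtain q0 where q0: "q0 \<in> invariant_seminorms"
    using orbit_seminorm_invariant[OF cont_seminorms_zero[OF star_algebra_axioms]] by blast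
  then have J: "(q0, 1) \<in> J" by (simp add: J_def)
  have mono: "S (r, e) \<subseteq> S (q, e')"
    if qr: "q \<in> invariant_seminorms" "r \<in> invariant_seminorms" "le_on q r" and e: "e \<le> e'" for q r e e'
  proof
    fix a assume "a \<in> S (r, e)"
    then have a: "a \<in> carrier A" "completion_norm r (diff (B r) (z r) (point r a)) < e" by (auto simp: S_def)
    interpret R: normed_star_algebra "B r" "completion_norm r" by (rule completion_normed[OF qr(2)])
    have "diff (B q) (z q) (point q a) = connecting r q (diff (B r) (z r) (point r a))"
      using star_hom_diff[OF connecting_hom[OF qr] R.star_algebra_axioms zc[OF qr(2)] point_closed[OF qr(2) a(1)]]
      by (simp add: zcon[OF qr] connecting_point[OF qr a(1)])
    then have "completion_norm q (diff (B q) (z q) (point q a)) \<le> completion_norm r (diff (B r) (z r) (point r a))"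
      using connecting_le[OF qr R.diff_closed[OF zc[OF qr(2)] point_closed[OF qr(2) a(1)]]] by simp
    then show "a \<in> S (q, e')" using a e by (simp add: S_def)
  qed
  have "F \<noteq> bot"
  proof -
    have "F = bot \<longleftrightarrow> (\<exists>j\<in>J. principal (S j) = bot)"
      unfolding F_def
    proof (rule INF_filter_bot_base)
      fix i j assume "i \<in> J" "j \<in> J"
      then obtain q e r d where ij: "i = (q, e)" "j = (r, d)" "q \<in> invariant_seminorms" "r \<in> invariant_seminorms" "e > 0" "d > 0"
        by (auto simp: J_def)
      \<comment> \<open>The connecting maps are contractive, so approximation in the completion at
        the maximum implies approximation at q and at r; the sets \<open>S\<close> form a filter
        base.\<close>
      let ?m = "\<lambda>x. max (q x) (r x)"
      have m: "?m \<in> invariant_seminorms" by (rule invariant_max[OF ij(3,4)])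
      have "S (?m, min e d) \<subseteq> S i" "S (?m, min e d) \<subseteq> S j"
        unfolding ij(1,2) by (rule mono[OF ij(3) m] mono[OF ij(4) m]; simp add: le_on_def)+
      then show "\<exists>k\<in>J. principal (S k) \<le> inf (principal (S i)) (principal (S j))"
        using m ij(5,6) by (intro bexI[of _ "(?m, min e d)"]) (simp_all add: J_def)
    qed
    moreover have "S j \<noteq> {}" if j: "j \<in> J" for j
    proof -
      obtain q e where q: "j = (q, e)" "q \<in> invariant_seminorms" "e > 0" using j by (auto simp: J_def)
      then show ?thesis using point_dense[OF q(2) zc[OF q(2)] q(3)] by (auto simp: S_def)
    qed
    ultimately show ?thesis by (auto simp: principal_eq_bot_iff)
  qed
  have ev: "eventually (\<lambda>a. a \<in> S (q, e)) F" if "q \<in> invariant_seminorms" "e > 0" for q e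
    unfolding F_def by (rule eventually_INF1[of "(q, e)"]) (use that in \<open>auto simp: J_def eventually_principal\<close>)
  have close: "q (diff A a b) < 2 * e"
    if q: "q \<in> invariant_seminorms" and a: "a \<in> S (q, e)" and b: "b \<in> S (q, e)" for q e a b
  proof -
    interpret Q: normed_star_algebra "B q" "completion_norm q" by (rule completion_normed[OF q])
    have ab: "a \<in> carrier A" "b \<in> carrier A" using a b by (auto simp: S_def)
    have "q (diff A a b) \<le> completion_norm q (diff (B q) (point q a) (z q)) + completion_norm q (diff (B q) (z q) (point q b))"
      unfolding point_diff_norm[OF q ab, symmetric]
      by (rule Q.p_diff_triangle) (use ab q zc point_closed in auto)
    also have "completion_norm q (diff (B q) (point q a) (z q)) = completion_norm q (diff (B q) (z q) (point q a))"
      by (rule Q.p_diff_commute) (use ab q zc point_closed in auto)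
    finally show ?thesis using a b by (simp add: S_def)
  qed
  have "\<exists>x. limitin (topo A) (\<lambda>y. y) x F"
  proof (rule complete[unfolded complete_talg_def, rule_format], intro conjI allI impI)
    show "F \<noteq> bot" by fact
    show "eventually (\<lambda>x. x \<in> carrier A) F"
      using ev[OF q0 zero_less_one] by eventually_elim (simp add: S_def)
    fix U assume U: "openin (topo A) U \<and> \<zero> \<in> U"
    then obtain F' d where F': "finite F'" "F' \<subseteq> cont_seminorms A" "d > 0"
        "{y \<in> carrier A. \<forall>p\<in>F'. p (diff A y \<zero>) < d} \<subseteq> U"
      unfolding topo_eq openin_seminorm_topology by blast
    obtain r where r: "r \<in> cont_seminorms A" "\<forall>p\<in>F'. \<forall>x. p x \<le> r x"
      using cont_seminorms_finite_bound[OF star_algebra_axioms F'(1,2)] by blast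
    let ?q = "orbit_seminorm r"
    have q: "?q \<in> invariant_seminorms" by (rule orbit_seminorm_invariant[OF r(1)])
    have "diff A a b \<in> U" if ab: "a \<in> S (?q, d / 2)" "b \<in> S (?q, d / 2)" for a b
    proof -
      have c: "diff A a b \<in> carrier A" using ab by (simp add: S_def)
      have "p (diff A a b) < d" if "p \<in> F'" for p
        using close[OF q ab] le_orbit_seminorm[OF r(1) c] r(2) that by (smt (verit) field_sum_of_halves)
      then show ?thesis using F'(4) c by auto
    qed
    moreover have "eventually (\<lambda>a. a \<in> S (?q, d / 2)) F" using F'(3) by (intro ev[OF q]) simp
    ultimately show "eventually (\<lambda>(x, y). diff A x y \<in> U) (F \<times>\<^sub>F F)"
      unfolding eventually_prod_filter by (intro exI[of _ "\<lambda>a. a \<in> S (?q, d / 2)"]) auto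
  qed
  then obtain x where x: "limitin (topo A) (\<lambda>y. y) x F" ..
  have xc: "x \<in> carrier A" using x by (simp add: limitin_def)
  have "z q = point q x" if q: "q \<in> invariant_seminorms" for q
  proof -
    interpret Q: normed_star_algebra "B q" "completion_norm q" by (rule completion_normed[OF q])
    have px: "point q x \<in> carrier (B q)" by (rule point_closed[OF q xc])
    have c: "diff (B q) (z q) (point q x) \<in> carrier (B q)" using zc[OF q] px by simp
    have small: "completion_norm q (diff (B q) (z q) (point q x)) < 2 * e" if e: "e > 0" for e
    proof -
      have "eventually (\<lambda>a. q (diff A a x) < e) F"
        using x e unfolding topo_eq
        by (intro limitin_seminorm_topologyD[OF star_algebra_axioms cont_seminorm_on[OF invariant_cont[OF q]] invariant_cont[OF q]])
      then have "eventually (\<lambda>a. q (diff A a x) < e \<and> a \<in> S (q, e)) F"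
        using ev[OF q e] by (rule eventually_conj)
      then obtain a where a: "q (diff A a x) < e" "a \<in> S (q, e)"
        using eventually_happens \<open>F \<noteq> bot\<close> by blast
      then have ac: "a \<in> carrier A" by (simp add: S_def)
      have "completion_norm q (diff (B q) (z q) (point q x)) \<le>
          completion_norm q (diff (B q) (z q) (point q a)) + completion_norm q (diff (B q) (point q a) (point q x))"
        by (rule Q.p_diff_triangle) (use zc[OF q] px point_closed[OF q ac] in auto)
      then show ?thesis using a by (simp add: S_def point_diff_norm[OF q ac xc])
    qed
    have "completion_norm q (diff (B q) (z q) (point q x)) = 0"
    proof (rule ccontr)
      assume "completion_norm q (diff (B q) (z q) (point q x)) \<noteq> 0"
      then have "completion_norm q (diff (B q) (z q) (point q x)) > 0" using Q.nonneg[OF c] by linarith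
      then show False using small[of "completion_norm q (diff (B q) (z q) (point q x)) / 2"] by simp
    qed
    then have "diff (B q) (z q) (point q x) = zero (B q)"
      using cstar_seminormed.completion_definite[OF invariant_seminormed[OF q] c] by blast
    then show ?thesis using zc[OF q] px by (rule Q.diff_eq_zeroD)
  qed
  moreover have "z \<in> extensional invariant_seminorms"
    using z by (simp add: limit_simps inverse_limit_carrier_def PiE_iff)
  ultimately have "z = canonical x"
    by (intro extensionalityI[of _ invariant_seminorms]) (auto simp: canonical_apply, simp add: canonical_def)
  then show ?thesis using xc by blast
qed

text \<open>One invariant seminorm q dominates the finitely many that describe \<open>U\<close> near
  a. By surjectivity every point of the limit is some \<open>canonical b\<close>, and its
  q-component is as far from that of a as q (b - a) tells. A cylinder over the single component q
  therefore lies in the image.\<close>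

lemma canonical_open:
  assumes complete: "complete_talg A"
  shows "open_map (topo A) (topo limit) canonical"
  unfolding open_map_def
proof (intro allI impI)
  fix U assume U: "openin (topo A) U"
  show "openin (topo limit) (canonical ` U)"
  proof (subst openin_subopen, intro ballI)
    fix z assume "z \<in> canonical ` U"
    then obtain a where a: "a \<in> U" "z = canonical a" by blast
    have ac: "a \<in> carrier A" using a(1) openin_subset[OF U] by auto
    obtain F d where F: "finite F" "F \<subseteq> cont_seminorms A" "d > 0"
        "{y \<in> carrier A. \<forall>p\<in>F. p (diff A y a) < d} \<subseteq> U"
      using U a(1) unfolding topo_eq openin_seminorm_topology by blast
    obtain r where r: "r \<in> cont_seminorms A" "\<forall>p\<in>F. \<forall>x. p x \<le> r x"
      using cont_seminorms_finite_bound[OF star_algebra_axioms F(1,2)] by blast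
    define q where "q = orbit_seminorm r"
    have q: "q \<in> invariant_seminorms" unfolding q_def by (rule orbit_seminorm_invariant[OF r(1)])
    interpret Q: normed_star_algebra "B q" "completion_norm q" by (rule completion_normed[OF q])
    let ?W = "{w \<in> carrier (B q). completion_norm q (diff (B q) w (point q a)) < d}"
    have W: "openin (topo (B q)) ?W"
      unfolding topo_completion
      by (rule openin_seminorm_ball[OF Q.star_algebra_axioms Q.seminorm _ point_closed[OF q ac]]) simp
    have "continuous_map (product_topology (\<lambda>q. topo (B q)) invariant_seminorms) (topo (B q)) (\<lambda>x. x q)"
      by (rule continuous_map_product_projection[OF q])
    then have "continuous_map (topo limit) (topo (B q)) (\<lambda>x. x q)"
      unfolding limit_simps by (rule continuous_map_from_subtopology)
    then have op: "openin (topo limit) {x \<in> topspace (topo limit). x q \<in> ?W}"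
      using W by (rule openin_continuous_map_preimage)
    have top: "topspace (topo limit) = carrier limit"
      using canonical_in
      by (auto simp: limit_simps inverse_limit_carrier_def topo_completion PiE_def Pi_def)
    show "\<exists>T. openin (topo limit) T \<and> z \<in> T \<and> T \<subseteq> canonical ` U"
    proof (intro exI conjI)
      show "openin (topo limit) {x \<in> topspace (topo limit). x q \<in> ?W}" by (rule op)
      show "z \<in> {x \<in> topspace (topo limit). x q \<in> ?W}"
        using canonical_in[OF ac] point_closed[OF q ac] F(3) by (simp add: top a(2) canonical_apply[OF q])
      show "{x \<in> topspace (topo limit). x q \<in> ?W} \<subseteq> canonical ` U"
      proof
        fix w assume w: "w \<in> {x \<in> topspace (topo limit). x q \<in> ?W}"
        then obtain b where b: "b \<in> carrier A" "w = canonical b"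
          using canonical_surj[OF complete] top by blast
        have c: "diff A b a \<in> carrier A" using b ac by simp
        have "q (diff A b a) < d"
          using w point_diff_norm[OF q b(1) ac] by (simp add: b(2) canonical_apply[OF q])
        then have "r (diff A b a) < d" using le_orbit_seminorm[OF r(1) c] by (simp add: q_def)
        then have "\<forall>p\<in>F. p (diff A b a) < d" using r(2) by (meson order_le_less_trans)
        then have "b \<in> U" using F(4) b(1) by blast
        then show "w \<in> canonical ` U" using b(2) by blast
      qed
    qed
  qed
qed

lemma canonical_iso:
  assumes "complete_talg A"
  shows "talg_iso A limit canonical"
proof -
  have cont: "continuous_map (topo A) (topo limit) canonical"
    using canonical_morphism by (simp add: morphism_iff)
  have "topspace (topo limit) \<subseteq> carrier limit" by (auto simp: limit_simps)
  then have "canonical ` topspace (topo A) = topspace (topo limit)"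
    using canonical_surj[OF assms] continuous_map_image_subset_topspace[OF cont] by auto
  then have "homeomorphic_map (topo A) (topo limit) canonical"
    using bijective_open_imp_homeomorphic_map[OF cont canonical_open[OF assms]] canonical_inj by simp
  then show ?thesis using canonical_morphism by (simp add: talg_iso_def)
qed

definition completed_coaction :: "('a \<Rightarrow> real) \<Rightarrow> (nat \<Rightarrow> 'a) set \<Rightarrow> ('g \<Rightarrow> (nat \<Rightarrow> 'a) set) multiplier" where
  "completed_coaction q b = mult_embed (tensor_C0 (B q)) (\<lambda>t. completed_act q t b)"

lemma completed_orbit_in:
  assumes q: "q \<in> invariant_seminorms" and b: "b \<in> carrier (B q)"
  shows "(\<lambda>t. completed_act q t b) \<in> C0_carrier (B q)"
proof -
  interpret I: isometric_action "B q" "completion_norm q" "completed_act q"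
    by (rule isometric_action_completion[OF q])
  show ?thesis using I.orbit_in[OF b] by (simp add: I.orbit_def)
qed

theorem inverse_limit_of_actions:
  assumes "complete_talg A"
  shows "is_inverse_limit_of_actions A \<alpha> invariant_seminorms le_on B connecting canonical completed_coaction"
  unfolding is_inverse_limit_of_actions_def
proof (intro conjI ballI impI)
  show "cstar_inverse_system invariant_seminorms le_on B connecting" by (rule inverse_system)
  show "talg_iso A limit canonical" by (rule canonical_iso[OF assms])
  show "kac_action (B q) (completed_coaction q)" if q: "q \<in> invariant_seminorms" for q
    using isometric_action.kac_action_isometric[OF isometric_action_completion[OF q]]
    by (simp add: completed_coaction_def[abs_def])
  have lc: "lc_star_algebra (B q)" if "q \<in> invariant_seminorms" for q
    using completion_normed[OF that] normed_star_algebra_lc by blast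
  show "induced_mult (B r) (B q) (connecting r q) (completed_coaction r b) (completed_coaction q (connecting r q b))"
    if qr: "q \<in> invariant_seminorms" "r \<in> invariant_seminorms" "le_on q r" and b: "b \<in> carrier (B r)" for q r b
  proof -
    interpret R: isometric_action "B r" "completion_norm r" "completed_act r"
      by (rule isometric_action_completion[OF qr(2)])
    have cb: "connecting r q b \<in> carrier (B q)" by (rule star_hom_closed[OF connecting_hom[OF qr] b])
    \<comment> \<open>Equivariance of the connecting map: on representing sequences both sides apply
      \<open>act t\<close> termwise.\<close>
    have eq: "connecting r q \<circ> (\<lambda>t. completed_act r t b) = (\<lambda>t. completed_act q t (connecting r q b))"
    proof
      fix t
      obtain x where x: "x \<in> cauchy_seqs A r" "b = null_class A r x"
        using cstar_seminormed.carrierE[OF invariant_seminormed[OF qr(2)] b] by blast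
      have le: "\<forall>a\<in>carrier A. p (act t a) \<le> p a" if "p \<in> invariant_seminorms" for p
        using invariant_act[OF that] by simp
      have map: "(\<lambda>n. act t (y n)) \<in> cauchy_seqs A p \<and> completed_act p t (null_class A p y) = null_class A p (\<lambda>n. act t (y n))"
        if p: "p \<in> invariant_seminorms" and y: "y \<in> cauchy_seqs A p" for p y
        unfolding completed_act_def
        by (rule completion_map_cls[OF star_algebra_axioms invariant_cstar[OF p] invariant_cstar[OF p] act_hom le[OF p] y])
      show "(connecting r q \<circ> (\<lambda>t. completed_act r t b)) t = completed_act q t (connecting r q b)"
        using map[OF qr(2) x(1)] connecting_cls[OF qr x(1)] connecting_cls[OF qr, of "\<lambda>n. act t (x n)"] map[OF qr(1), of x]
        by (simp add: x(2))
    qed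
    have "induced_mult (B r) (B q) (connecting r q) (mult_embed (tensor_C0 (B r)) (\<lambda>t. completed_act r t b))
        (mult_embed (tensor_C0 (B q)) (connecting r q \<circ> (\<lambda>t. completed_act r t b)))"
      by (rule induced_multI[OF compact_group lc[OF qr(2)] lc[OF qr(1)] _ connecting_hom[OF qr] completed_orbit_in[OF qr(2) b]])
        (use R.faithful in \<open>auto simp: eq intro: completed_orbit_in[OF qr(1) cb]\<close>)
    then show ?thesis by (simp add: completed_coaction_def eq)
  qed
  show "induced_mult A (B q) (\<lambda>a. canonical a q) (\<alpha> a) (completed_coaction q (canonical a q))"
    if q: "q \<in> invariant_seminorms" and a: "a \<in> carrier A" for q a
  proof -
    have eq: "point q \<circ> coact a = (\<lambda>t. completed_act q t (point q a))"
      using completed_act_point[OF q a] by (auto simp: act_def)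
    have "induced_mult A (B q) (point q) (mult_embed X (coact a)) (mult_embed (tensor_C0 (B q)) (point q \<circ> coact a))"
      by (rule induced_multI[OF compact_group lc_star_algebra_axioms lc[OF q] _ point_hom[OF q] coact(1)[OF a]])
        (use faithful in \<open>auto simp: eq intro: completed_orbit_in[OF q point_closed[OF q a]]\<close>)
    then show ?thesis
      by (simp add: completed_coaction_def eq coact(2)[OF a] canonical_apply[OF q])
  qed
qed

end

theorem corollary4p5:
  fixes A :: "'a talg"
    and \<alpha> :: "'a \<Rightarrow> ('g::{topological_group_add, t2_space} \<Rightarrow> 'a) multiplier"
  assumes "compact (UNIV :: 'g set)"
    and "locally_cstar_algebra A"
    and "kac_action A \<alpha>"
  shows "inverse_limit_action A \<alpha>"
proof -
  obtain P where A: "star_algebra A" "Hausdorff_space (topo A)" "complete_talg A"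
    "\<And>p. p \<in> P \<Longrightarrow> cstar_seminorm A p" "topo A = seminorm_topology A P"
    using assms(2) unfolding locally_cstar_algebra_def by blast
  interpret lc_star_algebra A by (rule lc_star_algebraI(1)[OF A(1,4,5)])
  interpret compact_kac_action A \<alpha>
    by unfold_locales (use assms(1,3) Hausdorff_faithful[OF A(2)] in auto)
  show ?thesis
    unfolding inverse_limit_action_def using inverse_limit_of_actions[OF A(3)] by blast
qed

end
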